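(* Let $p$ be a prime and let $G$ be a finite Camina $p$-group of nilpotency class $3$. Then $$c(G)=|G/Z(G)|^{1/2}\,c(Z(G)).$$ Moreover, when $p$ is an odd prime, $c(G)=\mu(G)=q(G)=|G/Z(G)|^{1/2}\,c(Z(G))$.
   Context: All groups are finite; $G'$ denotes the commutator subgroup. A $p$-group $G$ is called a Camina $p$-group if for every $g\in G\setminus G'$ the conjugacy class of $g$ is $gG'$. A quasi-permutation matrix is a square complex matrix whose trace is a non-negative integer. $c(G)$ is the minimal degree of a faithful representation of $G$ by complex quasi-permutation matrices; $q(G)$ is the minimal degree of a faithful representation of $G$ by quasi-permutation matrices over $\mathbb{Q}$; $\mu(G)$ is the least positive integer $n$ such that $G$ embeds in the symmetric group $S_n$. *)

theory Defs
  imports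
    Complex_Main
    "HOL-Algebra.Sym_Groups"
    "Jordan_Normal_Form.Matrix"
    "HOL-Computational_Algebra.Primes"
begin

definition group_center :: "('a, 'b) monoid_scheme \<Rightarrow> 'a set" where
  "group_center G =
     {z \<in> carrier G. \<forall>g \<in> carrier G. z \<otimes>\<^bsub>G\<^esub> g = g \<otimes>\<^bsub>G\<^esub> z}"

definition conjugacy_class :: "('a, 'b) monoid_scheme \<Rightarrow> 'a \<Rightarrow> 'a set" where
  "conjugacy_class G g = {x \<otimes>\<^bsub>G\<^esub> g \<otimes>\<^bsub>G\<^esub> inv\<^bsub>G\<^esub> x |x. x \<in> carrier G}"

(* The commutator convention is the one underlying the library's derived subgroup, so that
   commutator_subgroup G H H = derived G H. *)
definition commutator_subgroup :: "('a, 'b) monoid_scheme \<Rightarrow> 'a set \<Rightarrow> 'a set \<Rightarrow> 'a set" where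
  "commutator_subgroup G H K =
     generate G {h \<otimes>\<^bsub>G\<^esub> k \<otimes>\<^bsub>G\<^esub> inv\<^bsub>G\<^esub> h \<otimes>\<^bsub>G\<^esub> inv\<^bsub>G\<^esub> k |h k. h \<in> H \<and> k \<in> K}"

(* Indexed from 0: lower_central G 0 is the whole group, lower_central G 1 the commutator subgroup. *)
primrec lower_central :: "('a, 'b) monoid_scheme \<Rightarrow> nat \<Rightarrow> 'a set" where
  "lower_central G 0 = carrier G"
| "lower_central G (Suc i) = commutator_subgroup G (lower_central G i) (carrier G)"

(* A relation rather than a function, since not every group has a nilpotency class. *)
definition has_nilpotency_class :: "('a, 'b) monoid_scheme \<Rightarrow> nat \<Rightarrow> bool" where
  "has_nilpotency_class G n \<longleftrightarrow>
     lower_central G n = {\<one>\<^bsub>G\<^esub>} \<and> (\<forall>i<n. lower_central G i \<noteq> {\<one>\<^bsub>G\<^esub>})"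

definition finite_p_group :: "nat \<Rightarrow> ('a, 'b) monoid_scheme \<Rightarrow> bool" where
  "finite_p_group p G \<longleftrightarrow> group G \<and> finite (carrier G) \<and> (\<exists>n. order G = p ^ n)"

definition camina_p_group :: "nat \<Rightarrow> ('a, 'b) monoid_scheme \<Rightarrow> bool" where
  "camina_p_group p G \<longleftrightarrow> finite_p_group p G \<and>
     (\<forall>g \<in> carrier G - derived G (carrier G).
        conjugacy_class G g = g <#\<^bsub>G\<^esub> derived G (carrier G))"

definition mat_trace :: "'k::comm_monoid_add mat \<Rightarrow> 'k" where
  "mat_trace A = (\<Sum>i<dim_row A. A $$ (i, i))"

definition quasi_permutation_mat :: "'k::semiring_1 mat \<Rightarrow> bool" where
  "quasi_permutation_mat A \<longleftrightarrow> square_mat A \<and> mat_trace A \<in> \<nat>"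

definition general_linear :: "'k::field itself \<Rightarrow> nat \<Rightarrow> 'k mat monoid" where
  "general_linear T n = units_of (ring_mat T n ())"

(* The field is passed as a type: TYPE(complex) gives c(G), TYPE(rat) gives q(G). *)
definition min_quasi_perm_degree :: "'k::field_char_0 itself \<Rightarrow> ('a, 'b) monoid_scheme \<Rightarrow> nat" where
  "min_quasi_perm_degree T G =
     (LEAST n. 0 < n \<and>
        (\<exists>\<rho> \<in> hom G (general_linear T n). inj_on \<rho> (carrier G) \<and>
           (\<forall>g \<in> carrier G. quasi_permutation_mat (\<rho> g))))"

abbreviation c_degree :: "('a, 'b) monoid_scheme \<Rightarrow> nat" where
  "c_degree G \<equiv> min_quasi_perm_degree TYPE(complex) G"

abbreviation q_degree :: "('a, 'b) monoid_scheme \<Rightarrow> nat" where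
  "q_degree G \<equiv> min_quasi_perm_degree TYPE(rat) G"

definition min_perm_degree :: "('a, 'b) monoid_scheme \<Rightarrow> nat" where
  "min_perm_degree G =
     (LEAST n. 0 < n \<and> (\<exists>\<phi> \<in> hom G (sym_group n). inj_on \<phi> (carrier G)))"

end

theory Submission
  imports
    Defs
    "Jordan_Normal_Form.Schur_Decomposition"
    "HOL-Computational_Algebra.Polynomial_Factorial"
    "HOL-Number_Theory.Number_Theory"
    "HOL-Library.FuncSet"
begin

text \<open>
  Write \<open>|G/Z(G)| = s\<^sup>2\<close> and \<open>|Z(G)| = p\<^sup>d\<close>. Here \<open>Z(G)\<close> is the last nontrivial term \<open>U\<close> of the lower
  central series and is elementary abelian, and all three degrees of \<open>G\<close> equal \<open>s d p\<close>, while
  \<open>c(Z(G)) = d p\<close>.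

  Lower bound: restrict a faithful complex quasi-permutation representation to \<open>Z(G)\<close>. Nontrivial
  characters of the centre move under commutators, so the corresponding components of the trace
  vanish off the centre, and orthogonality makes every nontrivial character that occurs have
  multiplicity at least \<open>s\<close>. By faithfulness \<open>d\<close> independent characters occur; pick a central \<open>z\<close>
  at which all of them are nontrivial. Multiplicities are constant on the \<open>p - 1\<close> Galois conjugates
  of a character, so the characters nontrivial at \<open>z\<close> contribute at least \<open>s d (p - 1)\<close> to the degree,
  and since the trace at \<open>z\<close> is non-negative, the remaining ones contribute at least \<open>s d\<close>.

  Upper bound: let \<open>D\<close> be the commutator subgroup, \<open>\<chi>\<close> a nontrivial character of \<open>U\<close>, and \<open>C\<close> the
  subgroup of those \<open>g\<close> with \<open>\<chi>\<close> trivial on \<open>[D, g]\<close>. For odd \<open>p\<close>, Chevalley--Warning applied to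
  powers of determinants of alternating forms gives \<open>|D|\<^sup>3 \<le> |G| |U|\<^sup>2\<close>, which leaves no room for a
  radical of \<open>\<chi>([c, g])\<close> in \<open>D\<close> larger than \<open>U\<close>. Then \<open>C\<close> contains an isotropic subgroup \<open>A\<close> of index
  \<open>s\<close> in \<open>G\<close> whose \<open>p\<close>-th powers lie in the kernel of \<open>\<chi>\<close>, and \<open>A\<close> has a subgroup of index \<open>p\<close> meeting
  \<open>U\<close> inside that kernel. The coset actions obtained from \<open>d\<close> independent \<open>\<chi>\<close> are jointly faithful.

  The case \<open>p = 2\<close> does not occur, by comparing the Gauss sums \<open>\<Sum>\<^sub>x \<chi>([x\<^sup>2, z])\<close> with group orders.
\<close>

section \<open>Determinants of alternating matrices and the Chevalley--Warning theorem\<close>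

text \<open>The Camina condition concerns only elements outside \<open>D\<close>, so the crux is to
  see that the radical Z0 of \<open>\<chi>([c, g])\<close> in \<open>D\<close> is no larger than
  \<open>U\<close>. Duality gives |G| |Z0| = |D| |C|. For y in \<open>C\<close> the expression
  \<open>\<chi>([[y, x], z])\<close> is symmetric in x and z, because one term of the Hall--Witt
  identity is killed, and with the Camina condition this yields |C|^2 \<le> |G| |D|. Together |G|
  |Z0|^2 \<le> |D|^3, so Z0 = U as soon as |D|^3 \<le> |G| |U|^2. That last bound is a statement
  about spaces of alternating forms all of whose nonzero members are nondegenerate: such a space has
  at most half the dimension of the space the forms live on. For odd p the determinant of such a
  form is a nonzero square, so its power (p - 1)/2 equals 1, which is what Chevalley--Warning can
  count. For p = 2 this power is lost, and quadratic maps take the place of alternating forms. The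
  factor s p of the upper bound is the index s of \<open>A\<close> in \<open>G\<close> times the
  index p, in \<open>A\<close>, of the kernel of a functional that vanishes on the kernel of
  \<open>\<chi>\<close> but not on \<open>U\<close>.\<close>

lemma det_2_alternating: "det (mat 2 2 (\<lambda>(i, j). if i = j then 0 else if i < j then a else - a)) = (a :: 'a :: idom) ^ 2"
proof -
  let ?B = "mat 1 1 (\<lambda>_. a)" and ?C = "mat 1 1 (\<lambda>_. - a)" and ?Z = "0\<^sub>m 1 1 :: 'a mat"
  have "mat 2 2 (\<lambda>(i, j). if i = j then 0 else if i < j then a else - a) = four_block_mat ?Z ?B ?C ?Z"
    by (intro eq_matI) (auto simp: less_2_cases_iff)
  moreover have "det (four_block_mat ?Z ?B ?C ?Z) = det (?Z * ?Z - ?B * ?C)"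
    by (rule det_four_block_mat) auto
  moreover have "det (?Z * ?Z - ?B * ?C) = (?Z * ?Z - ?B * ?C) $$ (0, 0)"
    by (rule det_single) auto
  moreover have "(?Z * ?Z - ?B * ?C) $$ (0, 0) = a ^ 2"
    by (simp add: scalar_prod_def power2_eq_square)
  ultimately show ?thesis by simp
qed

text \<open>Induction by splitting off a nondegenerate plane: clearing the entries below a pivot
  block with rows (0, a) and (-a, 0) leaves a Schur complement that is again alternating, and the
  block contributes \<open>a ^ 2\<close>. The zero diagonal is a separate hypothesis because
  skewness does not give it in characteristic 2.\<close>

lemma alternating_det_square:
  fixes A :: "'a :: field mat"
  assumes A: "A \<in> carrier_mat n n" and alt: "\<And>i j. i < n \<Longrightarrow> j < n \<Longrightarrow> A $$ (j, i) = - A $$ (i, j)"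
    and diag: "\<And>i. i < n \<Longrightarrow> A $$ (i, i) = 0"
  shows "\<exists>q. det A = q ^ 2"
  using assms
proof (induction n arbitrary: A rule: less_induct)
  case (less n)
  note A = less.prems(1) and alt = less.prems(2) and diag = less.prems(3)
  show ?case
  proof (cases "\<exists>j<n. 0 < n \<and> A $$ (0, j) \<noteq> 0")
    case False
    show ?thesis
    proof (cases "n = 0")
      case True
      then have "det A = 1 ^ 2" using A by (simp add: det_dim_zero)
      then show ?thesis by blast
    next
      case n: False
      \<comment> \<open>Row 0 vanishes, hence by skewness so does column 0, and the first unit
        vector lies in the kernel.\<close>
      have "det A = 0"
      proof (subst det_0_iff_vec_prod_zero[OF A], intro exI conjI)
        show "unit_vec n 0 \<noteq> (0\<^sub>v n :: 'a vec)" using n by (auto simp: vec_eq_iff unit_vec_def)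
        show "A *\<^sub>v unit_vec n 0 = 0\<^sub>v n"
          using A False n alt[of 0] by (intro eq_vecI) auto
      qed simp
      then have "det A = 0 ^ 2" by simp
      then show ?thesis by blast
    qed
  next
    case True
    then obtain j where j: "j < n" "A $$ (0, j) \<noteq> 0" by auto
    then have j0: "j \<noteq> 0" using diag[of 0] by (auto intro: ccontr)
    then obtain m where m: "n = 2 + m" using j le_Suc_ex[of 2 n] by auto
    have reduce: "\<exists>q. det B = q ^ 2"
      if B: "B \<in> carrier_mat n n" and altB: "\<And>i j. i < n \<Longrightarrow> j < n \<Longrightarrow> B $$ (j, i) = - B $$ (i, j)"
        and diagB: "\<And>i. i < n \<Longrightarrow> B $$ (i, i) = 0" and a: "B $$ (0, 1) \<noteq> 0" for B :: "'a mat"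
    proof -
      define a where "a = B $$ (0, 1)"
      have a0: "a \<noteq> 0" using a by (simp add: a_def)
      define J where "J = mat 2 2 (\<lambda>(i, j). if i = j then 0 else if i < j then a else - a)"
      define R where "R = mat 2 m (\<lambda>(i, j). B $$ (i, j + 2))"
      define C where "C = mat m 2 (\<lambda>(i, j). B $$ (i + 2, j))"
      define D where "D = mat m m (\<lambda>(i, j). B $$ (i + 2, j + 2))"
      \<comment> \<open>\<open>U\<close> is minus \<open>C\<close> times the inverse of
        \<open>J\<close>, so multiplication by \<open>L\<close> replaces \<open>C\<close> by zero
        and \<open>D\<close> by the Schur complement \<open>U * R + D\<close>.\<close>
      define U where "U = mat m 2 (\<lambda>(i, j). if j = 0 then - B $$ (i + 2, 1) / a else B $$ (i + 2, 0) / a)"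
      have carr: "J \<in> carrier_mat 2 2" "R \<in> carrier_mat 2 m" "C \<in> carrier_mat m 2" "D \<in> carrier_mat m m" "U \<in> carrier_mat m 2"
        by (auto simp: J_def R_def C_def D_def U_def)
      have sh: "Suc (Suc (k - 2)) = k" if "\<not> k < 2" for k using that by simp
      have Bblock: "B = four_block_mat J R C D"
      proof (rule eq_matI)
        fix i j assume "i < dim_row (four_block_mat J R C D)" "j < dim_col (four_block_mat J R C D)"
        then have ij: "i < n" "j < n" using carr m by auto
        have n1: "1 < n" "0 < n" using m by auto
        have b10: "B $$ (Suc 0, 0) = - a" using altB[of 0 1] n1 by (simp add: a_def)
        have b00: "B $$ (0, 0) = 0" "B $$ (Suc 0, Suc 0) = 0" using diagB n1 by auto
        show "B $$ (i, j) = four_block_mat J R C D $$ (i, j)"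
        proof (cases "i < 2")
          case i: True
          show ?thesis
          proof (cases "j < 2")
            case True
            then show ?thesis using i ij carr m b10 b00 by (auto simp: J_def a_def less_2_cases_iff)
          next
            case False
            then show ?thesis using i ij carr m by (simp add: R_def sh)
          qed
        next
          case i: False
          then show ?thesis using ij carr m by (cases "j < 2") (simp_all add: C_def D_def sh)
        qed
      qed (use B carr m in auto)
      define L where "L = four_block_mat (1\<^sub>m 2) (0\<^sub>m 2 m) U (1\<^sub>m m)"
      have "det L = det (1\<^sub>m 2 :: 'a mat) * det (1\<^sub>m m :: 'a mat)"
        unfolding L_def by (rule det_four_block_mat_upper_right_zero) (use carr in auto)
      then have detL: "det L = 1" by simp
      have L: "L \<in> carrier_mat n n" using carr m by (auto simp: L_def)
      have "L * B = four_block_mat (1\<^sub>m 2 * J + 0\<^sub>m 2 m * C) (1\<^sub>m 2 * R + 0\<^sub>m 2 m * D) (U * J + 1\<^sub>m m * C) (U * R + 1\<^sub>m m * D)"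
        unfolding L_def Bblock by (rule mult_four_block_mat) (use carr in auto)
      also have "1\<^sub>m 2 * J + 0\<^sub>m 2 m * C = J" using carr by simp
      also have "1\<^sub>m 2 * R + 0\<^sub>m 2 m * D = R" using carr by simp
      also have "1\<^sub>m m * D = D" using carr by simp
      also have "U * J + 1\<^sub>m m * C = 0\<^sub>m m 2"
      proof (rule eq_matI)
        fix i j assume "i < dim_row (0\<^sub>m m 2 :: 'a mat)" "j < dim_col (0\<^sub>m m 2 :: 'a mat)"
        then have "i < m" "j = 0 \<or> j = 1" by auto
        then show "(U * J + 1\<^sub>m m * C) $$ (i, j) = 0\<^sub>m m 2 $$ (i, j)"
          using carr a0 by (elim disjE) (simp_all add: scalar_prod_def U_def J_def C_def numeral_2_eq_2)
      qed (use carr in auto)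
      finally have "L * B = four_block_mat J R (0\<^sub>m m 2) (U * R + D)" .
      then have "det (L * B) = det J * det (U * R + D)"
        using carr by (auto intro!: det_four_block_mat_lower_left_zero)
      then have detB: "det B = a ^ 2 * det (U * R + D)"
        using det_mult[OF L B] detL by (simp add: J_def det_2_alternating)
      have ent: "(U * R + D) $$ (i, j) = B $$ (i + 2, j + 2) + (B $$ (i + 2, 0) * B $$ (1, j + 2) - B $$ (i + 2, 1) * B $$ (0, j + 2)) / a"
        if "i < m" "j < m" for i j
        unfolding U_def R_def D_def using that by (simp add: scalar_prod_def numeral_2_eq_2 diff_divide_distrib)
      have gen: "x + (y0 * - z1 - y1 * - z0) / a = - (- x + (z0 * - y1 - z1 * - y0) / a)" for x y0 y1 z0 z1 :: 'a
        by (simp add: diff_divide_distrib mult.commute)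
      have "\<exists>q. det (U * R + D) = q ^ 2"
      proof (rule less.IH[of m])
        fix i j assume ij: "i < m" "j < m"
        have e: "B $$ (0, i + 2) = - B $$ (i + 2, 0)" "B $$ (1, i + 2) = - B $$ (i + 2, 1)"
          "B $$ (0, j + 2) = - B $$ (j + 2, 0)" "B $$ (1, j + 2) = - B $$ (j + 2, 1)" "B $$ (i + 2, j + 2) = - B $$ (j + 2, i + 2)"
          by (rule altB, use m ij in simp, use m ij in simp)+
        show "(U * R + D) $$ (j, i) = - (U * R + D) $$ (i, j)"
          unfolding ent[OF ij] ent[OF ij(2,1)] e by (rule gen)
      next
        fix i assume i: "i < m"
        have e: "B $$ (0, i + 2) = - B $$ (i + 2, 0)" "B $$ (1, i + 2) = - B $$ (i + 2, 1)"
          by (rule altB, use m i in simp, use m i in simp)+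
        have e': "B $$ (i + 2, i + 2) = 0" using diagB m i by simp
        show "(U * R + D) $$ (i, i) = 0" unfolding ent[OF i i] e e' by (simp add: mult.commute)
      qed (use m carr in auto)
      then obtain q where "det (U * R + D) = q ^ 2" ..
      then have "det B = (a * q) ^ 2" using detB by (simp add: power_mult_distrib)
      then show ?thesis by blast
    qed
    show ?thesis
    proof (cases "A $$ (0, 1) = 0")
      case False
      show ?thesis
      proof (rule reduce[OF A])
        show "A $$ (k, i) = - A $$ (i, k)" if "i < n" "k < n" for i k by (rule alt) fact+
        show "A $$ (i, i) = 0" if "i < n" for i by (rule diag) fact
      qed (use False in simp)
    next
      case True
      then have j1: "j \<noteq> 1" using j by auto
      \<comment> \<open>When the pivot (0, 1) vanishes, a nonzero entry (0, j) is moved there by a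
        congruence: adding row j to row 1 and column j to column 1 keeps the matrix alternating and
        the determinant unchanged.\<close>
      define E where "E = addrow_mat n (1::'a) 1 j"
      define B where "B = E * A * transpose_mat E"
      have E: "E \<in> carrier_mat n n" by (simp add: E_def)
      have EA: "E * A = addrow 1 1 j A" unfolding E_def by (rule addrow_mat[OF A j(1), symmetric])
      have "det E = 1" unfolding E_def using j1 by (intro det_addrow_mat) simp
      then have det: "det B = det A"
        unfolding B_def using E A by (simp add: det_mult[of _ n] det_transpose[of _ n])
      have n1: "1 < n" "0 < n" using m by auto
      have ET: "(X * transpose_mat E) $$ (i, k) = X $$ (i, k) + (if k = 1 then X $$ (i, j) else 0)"
        if "X \<in> carrier_mat n n" "i < n" "k < n" for X i k
      proof -
        have "X * transpose_mat E = transpose_mat (E * transpose_mat X)"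
          using that E by (simp add: transpose_mult[of _ n n _ n])
        also have "E * transpose_mat X = addrow 1 1 j (transpose_mat X)"
          unfolding E_def using addrow_mat[of "transpose_mat X" n n j 1 1] j that by simp
        finally show ?thesis using that j n1 by simp
      qed
      have ent: "B $$ (i, k) = A $$ (i, k) + (if i = 1 then A $$ (j, k) else 0) +
          (if k = 1 then A $$ (i, j) + (if i = 1 then A $$ (j, j) else 0) else 0)" if "i < n" "k < n" for i k
        unfolding B_def using ET[of "E * A" i k] that E A j n1 EA by (simp add: add_ac)
      have "\<exists>q. det B = q ^ 2"
      proof (rule reduce)
        show "B \<in> carrier_mat n n" using E A by (simp add: B_def)
        fix i k assume ik: "i < n" "k < n"
        show "B $$ (k, i) = - B $$ (i, k)"
          unfolding ent[OF ik] ent[OF ik(2,1)] alt[OF ik] alt[OF ik(1) j(1)] alt[OF j(1) ik(2)] diag[OF j(1)] by simp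
      next
        fix i assume i: "i < n"
        show "B $$ (i, i) = 0" unfolding ent[OF i i] alt[OF i j(1)] diag[OF i] diag[OF j(1)] by simp
      next
        show "B $$ (0, 1) \<noteq> 0" unfolding ent[OF n1(2,1)] using True j by simp
      qed
      then show ?thesis using det by simp
    qed
  qed
qed

section \<open>Alternating determinants and polynomial sums modulo a prime\<close>

lemma det_cong_mod:
  fixes A B :: "int mat"
  assumes "A \<in> carrier_mat n n" "B \<in> carrier_mat n n"
    and "\<And>i j. i < n \<Longrightarrow> j < n \<Longrightarrow> [A $$ (i, j) = B $$ (i, j)] (mod k)"
  shows "[det A = det B] (mod k)"
  unfolding det_def'[OF assms(1)] det_def'[OF assms(2)]
  by (intro cong_sum cong_mult cong_prod cong_refl assms(3)) (auto simp: permutes_in_image)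

text \<open>Over the rationals the determinant is a square \<open>u ^ 2 / v ^ 2\<close> in lowest
  terms. If \<open>p\<close> divided \<open>v\<close> it would divide \<open>u\<close> as well, so
  \<open>v\<close> is a unit modulo \<open>p\<close>, and raising
  \<open>det A * v ^ 2 = u ^ 2\<close> to the power \<open>(p - 1) div 2\<close> reduces the claim
  to Fermat's theorem.\<close>

lemma alternating_int_det_power:
  fixes A :: "int mat"
  assumes A: "A \<in> carrier_mat n n" and alt: "\<And>i j. i < n \<Longrightarrow> j < n \<Longrightarrow> A $$ (j, i) = - A $$ (i, j)"
    and p: "prime p" "odd p" and nd: "\<not> int p dvd det A"
  shows "[det A ^ ((p - 1) div 2) = 1] (mod int p)"
proof -
  let ?A = "map_mat rat_of_int A"
  have "\<exists>q. det ?A = q ^ 2"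
  proof (rule alternating_det_square[of _ n])
    show "?A $$ (j, i) = - ?A $$ (i, j)" if "i < n" "j < n" for i j
      using A that alt[OF that] by simp
    show "?A $$ (i, i) = 0" if "i < n" for i using A that alt[OF that that] by simp
  qed (use A in simp)
  then obtain q where q: "rat_of_int (det A) = q ^ 2" by (auto simp: of_int_hom.hom_det)
  obtain u v where uv: "quotient_of q = (u, v)" by fastforce
  have v: "v > 0" and cop: "coprime u v" and qe: "q = of_int u / of_int v"
    using quotient_of_denom_pos[OF uv] quotient_of_coprime[OF uv] quotient_of_div[OF uv] by auto
  have "rat_of_int (det A * v ^ 2) = rat_of_int (u ^ 2)"
    using q qe v by (simp add: power_divide)
  then have e: "det A * v ^ 2 = u ^ 2" by (simp only: of_int_eq_iff)
  have pi: "prime (int p)" using p by simp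
  have pv: "\<not> int p dvd v"
  proof
    assume d: "int p dvd v"
    then have "int p dvd u ^ 2" unfolding e[symmetric] by (simp add: dvd_mult power2_eq_square)
    then have "int p dvd u" using pi prime_dvd_power by blast
    with d cop pi show False using coprime_common_divisor not_prime_unit by blast
  qed
  have pu: "\<not> int p dvd u"
  proof
    assume "int p dvd u"
    then have "int p dvd det A * v ^ 2" unfolding e by (simp add: power2_eq_square)
    then show False using pi nd pv by (metis prime_dvd_mult_iff prime_dvd_power)
  qed
  have fermat: "[x ^ (p - 1) = 1] (mod int p)" if "\<not> int p dvd x" for x :: int
  proof -
    define y where "y = nat (x mod int p)"
    have "int p > 0" using prime_gt_0_nat[OF p(1)] by simp
    then have y: "int y = x mod int p" by (simp add: y_def)
    then have "\<not> int p dvd int y" using that by (simp add: dvd_mod_iff)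
    then have "[y ^ (p - 1) = 1] (mod p)" using p by (intro fermat_theorem) auto
    then have "[int (y ^ (p - 1)) = int 1] (mod int p)" unfolding cong_int_iff .
    then have "[int y ^ (p - 1) = 1] (mod int p)" by simp
    moreover have "[x ^ (p - 1) = int y ^ (p - 1)] (mod int p)"
      unfolding y by (intro cong_pow) (simp add: cong_def)
    ultimately show ?thesis by (rule cong_trans[rotated])
  qed
  have half: "2 * ((p - 1) div 2) = p - 1" using p(2) by simp
  have "det A ^ ((p - 1) div 2) * v ^ (p - 1) = (det A * v ^ 2) ^ ((p - 1) div 2)"
    by (simp only: power_mult_distrib power_mult[symmetric] half)
  also have "\<dots> = u ^ (p - 1)" unfolding e by (simp only: power_mult[symmetric] half)
  finally have "det A ^ ((p - 1) div 2) * v ^ (p - 1) = u ^ (p - 1)" .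
  then have 1: "[det A ^ ((p - 1) div 2) * v ^ (p - 1) = 1] (mod int p)" using fermat[OF pu] by simp
  have 2: "[det A ^ ((p - 1) div 2) * v ^ (p - 1) = det A ^ ((p - 1) div 2) * 1] (mod int p)"
    by (rule cong_mult[OF cong_refl fermat[OF pv]])
  show ?thesis using cong_trans[OF cong_sym[OF 2] 1] by simp
qed

text \<open>Telescoping \<open>(x + 1) ^ Suc e - x ^ Suc e\<close> over a full residue system gives
  \<open>p ^ Suc e\<close>, and the binomial expansion expresses this through the power sums of
  exponent at most \<open>e\<close>. The top one has coefficient \<open>Suc e < p\<close>, which is
  invertible modulo \<open>p\<close>. For \<open>e = 0\<close> the convention
  \<open>0 ^ 0 = 1\<close> makes the sum equal to \<open>p\<close>.\<close>

lemma dvd_power_sum: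
  assumes p: "prime p" and e: "e < p - 1"
  shows "int p dvd (\<Sum>x\<in>{0..<int p}. x ^ e)"
  using e
proof (induction e rule: less_induct)
  case (less e)
  have reidx: "(\<Sum>x\<in>{0..<int p}. x ^ k) = (\<Sum>x<p. int x ^ k)" for k
    by (rule sum.reindex_bij_witness[of _ int nat]) auto
  have "(\<Sum>x<p. (int x + 1) ^ Suc e - int x ^ Suc e) = int p ^ Suc e"
    using sum_lessThan_telescope[of "\<lambda>x. int x ^ Suc e" p] by (simp add: add.commute)
  moreover have "(int x + 1) ^ Suc e - int x ^ Suc e = (\<Sum>k\<le>e. int (Suc e choose k) * int x ^ k)" for x
    using binomial_ring[of "int x" 1 "Suc e"] by simp
  ultimately have "int p ^ Suc e = (\<Sum>x<p. \<Sum>k\<le>e. int (Suc e choose k) * int x ^ k)" by simp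
  also have "\<dots> = (\<Sum>k\<le>e. int (Suc e choose k) * (\<Sum>x<p. int x ^ k))"
    by (subst sum.swap) (simp add: sum_distrib_left)
  also have "\<dots> = (\<Sum>k<e. int (Suc e choose k) * (\<Sum>x<p. int x ^ k)) + int (Suc e) * (\<Sum>x<p. int x ^ e)"
    by (simp flip: lessThan_Suc_atMost)
  finally have eq: "int p ^ Suc e = (\<Sum>k<e. int (Suc e choose k) * (\<Sum>x<p. int x ^ k)) + int (Suc e) * (\<Sum>x<p. int x ^ e)" .
  have "int p dvd (\<Sum>k<e. int (Suc e choose k) * (\<Sum>x<p. int x ^ k))"
  proof (rule dvd_sum, rule dvd_mult)
    fix k assume "k \<in> {..<e}"
    then show "int p dvd (\<Sum>x<p. int x ^ k)" using less.IH[of k] less.prems by (simp add: reidx)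
  qed
  moreover have "int p dvd int p ^ Suc e" by simp
  ultimately have "int p dvd int (Suc e) * (\<Sum>x<p. int x ^ e)"
    unfolding eq by (simp only: dvd_add_right_iff)
  moreover have "\<not> int p dvd int (Suc e)"
  proof
    assume "int p dvd int (Suc e)"
    then have "p \<le> Suc e" by (simp only: int_dvd_int_iff) (rule dvd_imp_le, auto)
    then show False using less.prems by simp
  qed
  ultimately show ?case using p unfolding reidx by (simp add: prime_dvd_mult_iff)
qed

text \<open>Integer polynomial functions in \<open>r\<close> variables, with \<open>d\<close> an
  upper bound for the degree. Constants are allowed at every \<open>d\<close>, so summands of
  smaller degree need no separate treatment, and multiplying by one variable at a time is the step
  on which the vanishing of sums is proved.\<close>

inductive polyfun :: "nat \<Rightarrow> nat \<Rightarrow> ((nat \<Rightarrow> int) \<Rightarrow> int) \<Rightarrow> bool" for r where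
  const: "polyfun r d (\<lambda>_. a)"
| var: "polyfun r d f \<Longrightarrow> l < r \<Longrightarrow> polyfun r (Suc d) (\<lambda>c. c l * f c)"
| add: "polyfun r d f \<Longrightarrow> polyfun r d g \<Longrightarrow> polyfun r d (\<lambda>c. f c + g c)"

lemma polyfun_scale: "polyfun r d f \<Longrightarrow> d \<le> d' \<Longrightarrow> polyfun r d' (\<lambda>c. a * f c)"
proof (induction arbitrary: d' rule: polyfun.induct)
  case (const d b)
  show ?case by (rule polyfun.const)
next
  case (var d f l)
  then obtain e where "d' = Suc e" "d \<le> e" by (cases d') auto
  then show ?case using polyfun.var[OF var.IH[of e] var.hyps(2)] by (simp add: mult.left_commute)
next
  case (add d f g)
  then show ?case using polyfun.add[OF add.IH(1)[OF add.prems] add.IH(2)[OF add.prems]] by (simp add: distrib_left)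
qed

lemma polyfun_mult: "polyfun r d f \<Longrightarrow> polyfun r e g \<Longrightarrow> polyfun r (d + e) (\<lambda>c. f c * g c)"
proof (induction rule: polyfun.induct)
  case (const d a)
  then show ?case using polyfun_scale[of r e g "d + e" a] by simp
next
  case (var d f l)
  then show ?case using polyfun.var[OF var.IH[OF var.prems] var.hyps(2)] by (simp add: mult.assoc)
next
  case (add d f g)
  then show ?case using polyfun.add[OF add.IH(1)[OF add.prems] add.IH(2)[OF add.prems]] by (simp add: distrib_right)
qed

lemma polyfun_sum: "finite I \<Longrightarrow> (\<And>i. i \<in> I \<Longrightarrow> polyfun r d (f i)) \<Longrightarrow> polyfun r d (\<lambda>c. \<Sum>i\<in>I. f i c)"
proof (induction I rule: finite_induct)
  case empty
  show ?case using polyfun.const[of r d 0] by simp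
next
  case (insert i I)
  then show ?case using polyfun.add[of r d "f i" "\<lambda>c. \<Sum>i\<in>I. f i c"] by simp
qed

lemma polyfun_prod: "finite I \<Longrightarrow> (\<And>i. i \<in> I \<Longrightarrow> polyfun r d (f i)) \<Longrightarrow> polyfun r (card I * d) (\<lambda>c. \<Prod>i\<in>I. f i c)"
proof (induction I rule: finite_induct)
  case empty
  show ?case using polyfun.const[of r 0 1] by simp
next
  case (insert i I)
  then show ?case using polyfun_mult[of r d "f i" "card I * d" "\<lambda>c. \<Prod>i\<in>I. f i c"] by simp
qed

text \<open>The vanishing part of Chevalley--Warning. The monomial in front makes the induction
  work: a factor \<open>c l\<close> of the function is absorbed into the exponent
  \<open>e l\<close>, which leaves the total degree bound unchanged. For a constant the sum splits
  into a product of power sums, and by the degree hypothesis some exponent is below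
  \<open>p - 1\<close>.\<close>

lemma polyfun_sum_mod:
  assumes p: "prime p" and f: "polyfun r d f"
  shows "(\<Sum>i<r. e i) + d < r * (p - 1) \<Longrightarrow>
    int p dvd (\<Sum>c\<in>{..<r} \<rightarrow>\<^sub>E {0..<int p}. (\<Prod>i<r. c i ^ e i) * f c)"
  using f
proof (induction arbitrary: e rule: polyfun.induct)
  case (const d a)
  have "\<exists>i<r. e i < p - 1"
  proof (rule ccontr)
    assume "\<not> (\<exists>i<r. e i < p - 1)"
    then have "(\<Sum>i<r. p - 1) \<le> (\<Sum>i<r. e i)" by (intro sum_mono) (use linorder_not_le in blast)
    then show False using const by simp
  qed
  then obtain i where i: "i < r" "e i < p - 1" by auto
  have "(\<Sum>c\<in>{..<r} \<rightarrow>\<^sub>E {0..<int p}. (\<Prod>i<r. c i ^ e i)) = (\<Prod>i<r. \<Sum>x\<in>{0..<int p}. x ^ e i)"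
    by (rule prod_sum_PiE[symmetric]) auto
  moreover have "int p dvd (\<Prod>i<r. \<Sum>x\<in>{0..<int p}. x ^ e i)"
    by (rule dvd_trans[OF dvd_power_sum[OF p i(2)]], rule dvd_prodI) (use i in auto)
  ultimately show ?case by (simp flip: sum_distrib_right)
next
  case (var d f l)
  let ?e = "e(l := Suc (e l))"
  have "(\<Sum>i<r. ?e i) = Suc (\<Sum>i<r. e i)"
    using var.hyps(2) by (simp add: sum.remove[of "{..<r}" l])
  then have "int p dvd (\<Sum>c\<in>{..<r} \<rightarrow>\<^sub>E {0..<int p}. (\<Prod>i<r. c i ^ ?e i) * f c)"
    using var.prems by (intro var.IH) simp
  moreover have "(\<Prod>i<r. c i ^ ?e i) = (\<Prod>i<r. c i ^ e i) * c l" for c :: "nat \<Rightarrow> int"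
    using var.hyps(2) by (simp add: prod.remove[of "{..<r}" l] mult_ac)
  ultimately show ?case by (simp add: mult.assoc)
next
  case (add d f g)
  then show ?case by (simp add: distrib_left sum.distrib)
qed

text \<open>Counting replaces elimination: the linear map acts on the finite box of residue vectors,
  where a trivial kernel makes it injective and hence surjective.\<close>

lemma linear_mod_surj:
  fixes M :: "nat \<Rightarrow> nat \<Rightarrow> int" and q :: int
  assumes q: "q > 0"
    and inj: "\<And>k. k \<in> {..<m} \<rightarrow>\<^sub>E {0..<q} \<Longrightarrow> (\<And>i. i < m \<Longrightarrow> [(\<Sum>j<m. M i j * k j) = 0] (mod q)) \<Longrightarrow> (\<forall>j<m. k j = 0)"
  shows "\<exists>k. \<forall>i<m. [(\<Sum>j<m. M i j * k j) = v i] (mod q)"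
proof -
  let ?K = "{..<m} \<rightarrow>\<^sub>E {0..<q}"
  let ?F = "\<lambda>k. \<lambda>i\<in>{..<m}. (\<Sum>j<m. M i j * k j) mod q"
  have fin: "finite ?K" by (intro finite_PiE) auto
  have img: "?F ` ?K \<subseteq> ?K"
    by (intro image_subsetI restrict_PiE_iff[THEN iffD2]) (use q in auto)
  have "inj_on ?F ?K"
  proof (rule inj_onI)
    fix k k' assume k: "k \<in> ?K" "k' \<in> ?K" and eq: "?F k = ?F k'"
    \<comment> \<open>The difference of two vectors may leave the box, so its residues are taken
      before the kernel hypothesis is applied.\<close>
    define l where "l = (\<lambda>j\<in>{..<m}. (k j - k' j) mod q)"
    have lK: "l \<in> ?K" unfolding l_def by (intro restrict_PiE_iff[THEN iffD2]) (use q in auto)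
    have "\<forall>j<m. l j = 0"
    proof (rule inj[OF lK])
      fix i assume i: "i < m"
      have "[(\<Sum>j<m. M i j * l j) = (\<Sum>j<m. M i j * (k j - k' j))] (mod q)"
        by (intro cong_sum cong_mult cong_refl) (simp add: l_def cong_def)
      also have "(\<Sum>j<m. M i j * (k j - k' j)) = (\<Sum>j<m. M i j * k j) - (\<Sum>j<m. M i j * k' j)"
        by (simp add: right_diff_distrib sum_subtractf)
      also have "[\<dots> = (\<Sum>j<m. M i j * k' j) - (\<Sum>j<m. M i j * k' j)] (mod q)"
      proof (rule cong_diff[OF _ cong_refl])
        show "[(\<Sum>j<m. M i j * k j) = (\<Sum>j<m. M i j * k' j)] (mod q)"
          using fun_cong[OF eq, of i] i by (simp add: cong_def)
      qed
      finally show "[(\<Sum>j<m. M i j * l j) = 0] (mod q)" by simp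
    qed
    show "k = k'"
    proof (rule PiE_ext[OF k])
      fix j assume j: "j \<in> {..<m}"
      then have "(k j - k' j) mod q = 0" using \<open>\<forall>j<m. l j = 0\<close> by (simp add: l_def)
      then have "[k j = k' j] (mod q)" by (simp add: cong_iff_dvd_diff mod_eq_0_iff_dvd)
      moreover have "k j \<in> {0..<q}" "k' j \<in> {0..<q}" by (rule PiE_mem[OF k(1) j], rule PiE_mem[OF k(2) j])
      ultimately show "k j = k' j" unfolding cong_def by simp
    qed
  qed
  then have sur: "?F ` ?K = ?K" using fin img by (intro endo_inj_surj) auto
  have "(\<lambda>i\<in>{..<m}. v i mod q) \<in> ?K" by (intro restrict_PiE_iff[THEN iffD2]) (use q in auto)
  then obtain k where k: "(\<lambda>i\<in>{..<m}. v i mod q) = ?F k" using sur by (metis (no_types, lifting) imageE)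
  then have "[(\<Sum>j<m. M i j * k j) = v i] (mod q)" if "i < m" for i
  proof -
    have "v i mod q = (\<Sum>j<m. M i j * k j) mod q" using fun_cong[OF k, of i] that by simp
    then show ?thesis unfolding cong_def by (rule sym)
  qed
  then show ?thesis by blast
qed

text \<open>If \<open>m < 2 * r\<close>, the power \<open>(p - 1) div 2\<close> of the determinant
  is a polynomial in the coefficients \<open>c\<close> of degree below \<open>r * (p - 1)\<close>,
  so its values add up to 0 modulo \<open>p\<close>. But by nondegeneracy the value is 1 at every
  nonzero \<open>c\<close>, and it is 0 at \<open>c = 0\<close>, so the sum is
  \<open>p ^ r - 1\<close>.\<close>

lemma alternating_family_bound:
  fixes A :: "nat \<Rightarrow> nat \<Rightarrow> nat \<Rightarrow> int"
  assumes p: "prime p" "odd p" and m: "m > 0"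
    and skew: "\<And>l i j. A l j i = - A l i j"
    and nd: "\<And>c k. c \<in> {..<r} \<rightarrow>\<^sub>E {0..<int p} \<Longrightarrow> \<exists>l<r. c l \<noteq> 0 \<Longrightarrow> k \<in> {..<m} \<rightarrow>\<^sub>E {0..<int p} \<Longrightarrow>
       (\<And>i. i < m \<Longrightarrow> [(\<Sum>j<m. (\<Sum>l<r. c l * A l i j) * k j) = 0] (mod int p)) \<Longrightarrow> (\<forall>j<m. k j = 0)"
  shows "2 * r \<le> m"
proof (rule ccontr)
  assume neg: "\<not> 2 * r \<le> m"
  have p3: "p \<ge> 3" using p prime_ge_2_nat[OF p(1)] by (cases "p = 2") auto
  define M where "M c i j = (\<Sum>l<r. c l * A l i j)" for c i j
  let ?M = "\<lambda>c. mat m m (\<lambda>(i, j). M c i j)"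
  let ?C = "{..<r} \<rightarrow>\<^sub>E {0..<int p}"
  let ?h = "(p - 1) div 2"
  have half: "2 * ?h = p - 1" using p(2) by simp
  have finC: "finite ?C" by (intro finite_PiE) auto
  have one: "[det (?M c) ^ ?h = 1] (mod int p)" if c: "c \<in> ?C" "\<exists>l<r. c l \<noteq> 0" for c
  proof (rule alternating_int_det_power[OF _ _ p])
    show "?M c $$ (j, i) = - ?M c $$ (i, j)" if "i < m" "j < m" for i j
      using that skew[of _ j i] by (simp add: M_def sum_negf)
    \<comment> \<open>Solving for all unit vectors yields a right inverse modulo \<open>p\<close>,
      hence a determinant prime to \<open>p\<close>.\<close>
    have "\<exists>k. \<forall>i<m. [(\<Sum>j<m. M c i j * k j) = of_bool (i = t)] (mod int p)" for t
    proof (rule linear_mod_surj)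
      fix k assume "k \<in> {..<m} \<rightarrow>\<^sub>E {0..<int p}" "\<And>i. i < m \<Longrightarrow> [(\<Sum>j<m. M c i j * k j) = 0] (mod int p)"
      then show "\<forall>j<m. k j = 0" unfolding M_def by (rule nd[OF c])
    qed (use prime_gt_0_nat[OF p(1)] in simp)
    then obtain K where K: "\<And>t i. i < m \<Longrightarrow> [(\<Sum>j<m. M c i j * K t j) = of_bool (i = t)] (mod int p)" by metis
    let ?K = "mat m m (\<lambda>(j, t). K t j)"
    have "[det (?M c * ?K) = det (1\<^sub>m m)] (mod int p)"
    proof (rule det_cong_mod)
      fix i t assume "i < m" "t < m"
      then show "[(?M c * ?K) $$ (i, t) = 1\<^sub>m m $$ (i, t)] (mod int p)"
        using K[of i t] by (simp add: scalar_prod_def lessThan_atLeast0 of_bool_def)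
    qed auto
    then have "[det (?M c) * det ?K = 1] (mod int p)"
      by (simp add: det_mult[of _ m])
    then show "\<not> int p dvd det (?M c)"
      using p3 by (auto simp: cong_iff_dvd_diff) (metis cong_iff_dvd_diff cong_dvd_iff dvd_mult2 int_dvd_int_iff nat_dvd_1_iff_1 of_nat_1 one_less_numeral_iff leD semiring_norm(77) zdvd1_eq)
  qed auto
  have "polyfun r m (\<lambda>c. det (?M c))"
  proof -
    have "polyfun r 1 (\<lambda>c. M c i j)" for i j
      unfolding M_def
    proof (rule polyfun_sum)
      fix l assume "l \<in> {..<r}"
      then show "polyfun r 1 (\<lambda>c. c l * A l i j)" using polyfun.var[OF polyfun.const[of r 0]] by simp
    qed simp
    then have "polyfun r (card {0..<m} * 1) (\<lambda>c. \<Prod>i = 0..<m. M c i (\<pi> i))" for \<pi>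
      by (intro polyfun_prod) auto
    then have "polyfun r m (\<lambda>c. signof \<pi> * (\<Prod>i = 0..<m. M c i (\<pi> i)))" for \<pi>
      by (intro polyfun_scale[of r m]) auto
    then have "polyfun r m (\<lambda>c. \<Sum>\<pi>\<in>{\<pi>. \<pi> permutes {0..<m}}. signof \<pi> * (\<Prod>i = 0..<m. M c i (\<pi> i)))"
      by (intro polyfun_sum finite_permutations) auto
    moreover have "det (?M c) = (\<Sum>\<pi>\<in>{\<pi>. \<pi> permutes {0..<m}}. signof \<pi> * (\<Prod>i = 0..<m. M c i (\<pi> i)))" for c
      by (subst det_def'[of _ m]) (auto intro!: sum.cong prod.cong simp: permutes_in_image)
    ultimately show ?thesis by simp
  qed
  then have "polyfun r (card {..<?h} * m) (\<lambda>c. \<Prod>_<?h. det (?M c))" by (intro polyfun_prod) auto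
  then have "polyfun r (?h * m) (\<lambda>c. det (?M c) ^ ?h)" by simp
  moreover have "?h * m < r * (p - 1)"
  proof -
    have "?h * m < ?h * (2 * r)" using neg p3 by simp
    also have "\<dots> = r * (p - 1)" using half by (metis mult.assoc mult.commute)
    finally show ?thesis .
  qed
  ultimately have "int p dvd (\<Sum>c\<in>?C. (\<Prod>i<r. c i ^ 0) * det (?M c) ^ ?h)"
    by (intro polyfun_sum_mod[OF p(1)]) simp_all
  then have d: "int p dvd (\<Sum>c\<in>?C. det (?M c) ^ ?h)" by simp
  define z where "z = (\<lambda>i\<in>{..<r}. 0 :: int)"
  have z: "z \<in> ?C" unfolding z_def by (intro restrict_PiE_iff[THEN iffD2]) (use p3 in auto)
  have "?M z = 0\<^sub>m m m" by (intro eq_matI) (auto simp: M_def z_def)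
  \<comment> \<open>The empty matrix has determinant 1, so \<open>m > 0\<close> matters
    here.\<close>
  moreover have "det (0\<^sub>m m m :: int mat) = 0"
    using m by (simp add: det_zero)
  ultimately have "det (?M z) ^ ?h = 0" using p3 by (simp add: zero_power)
  then have "(\<Sum>c\<in>?C. det (?M c) ^ ?h) = (\<Sum>c\<in>?C - {z}. det (?M c) ^ ?h)"
    using finC z by (simp add: sum.remove[of ?C z])
  also have "[\<dots> = (\<Sum>c\<in>?C - {z}. 1)] (mod int p)"
  proof (rule cong_sum)
    fix c assume c: "c \<in> ?C - {z}"
    have "\<exists>l<r. c l \<noteq> 0"
    proof (rule ccontr)
      assume "\<not> (\<exists>l<r. c l \<noteq> 0)"
      then have l0: "c l = z l" if "l \<in> {..<r}" for l using that by (simp add: z_def)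
      have cC: "c \<in> ?C" using c by blast
      have "c = z" by (rule PiE_ext[OF cC z l0])
      then show False using c by simp
    qed
    then show "[det (?M c) ^ ?h = 1] (mod int p)" using one c by blast
  qed
  also have "(\<Sum>c\<in>?C - {z}. 1) = int p ^ r - 1"
    using finC z by (simp add: card_PiE of_nat_diff prime_gt_0_nat[OF p(1)] Suc_leI)
  finally have "[(\<Sum>c\<in>?C. det (?M c) ^ ?h) = int p ^ r - 1] (mod int p)" .
  then have "int p dvd int p ^ r - 1" using d by (simp add: cong_dvd_iff)
  moreover have "int p dvd int p ^ r" using neg by (intro dvd_power) auto
  ultimately have "int p dvd 1" by (metis dvd_diff_commute dvd_diff diff_diff_eq2 add_diff_cancel_left' add.commute)
  then show False using p3 by simp
qed

section \<open>Simultaneous diagonalisation\<close>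

lemma mat_trace_comm:
  fixes A :: "'a::comm_ring_1 mat"
  assumes "A \<in> carrier_mat n m" "B \<in> carrier_mat m n"
  shows "mat_trace (A * B) = mat_trace (B * A)"
proof -
  have "mat_trace (A * B) = (\<Sum>i<n. \<Sum>j<m. A $$ (i, j) * B $$ (j, i))"
    using assms by (auto simp: mat_trace_def scalar_prod_def lessThan_atLeast0 intro!: sum.cong)
  also have "\<dots> = (\<Sum>j<m. \<Sum>i<n. B $$ (j, i) * A $$ (i, j))"
    by (subst sum.swap) (simp add: mult.commute)
  also have "\<dots> = mat_trace (B * A)"
    using assms by (auto simp: mat_trace_def scalar_prod_def lessThan_atLeast0 intro!: sum.cong)
  finally show ?thesis .
qed

text \<open>A Schur triangular form \<open>B\<close> of an idempotent is idempotent, so its diagonal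
  entries are 0 or 1, and \<open>k\<close> is the number of ones. If there are none,
  \<open>B\<close> is strictly triangular and equal to its own square; each entry is then a sum of
  products of entries closer to the diagonal, which forces \<open>B = 0\<close>.\<close>

lemma idempotent_trace:
  fixes A :: "complex mat"
  assumes A: "A \<in> carrier_mat n n" and idem: "A * A = A"
  obtains k where "mat_trace A = of_nat k" "k = 0 \<Longrightarrow> A = 0\<^sub>m n n"
proof -
  obtain es where "char_poly A = (\<Prod>a\<leftarrow>es. [:- a, 1:])"
    using char_poly_factorized[OF A] by blast
  from schur_decomposition_exists[OF A this]
  obtain B where B: "B \<in> carrier_mat n n" "upper_triangular B" "similar_mat A B" by blast
  then obtain P Q where "similar_mat_wit A B P Q" by (auto simp: similar_mat_def)
  note wit = similar_mat_witD2[OF A this]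
  have P: "P \<in> carrier_mat n n" and Q: "Q \<in> carrier_mat n n" and PQ: "P * Q = 1\<^sub>m n" and QP: "Q * P = 1\<^sub>m n"
    and APQ: "A = P * B * Q" using wit by auto
  have BQP: "B = Q * A * P"
  proof -
    have "Q * A * P = (Q * P) * B * (Q * P)"
      unfolding APQ using P Q B(1) by (simp add: assoc_mult_mat[of _ n n _ n _ n])
    then show ?thesis using QP B(1) by simp
  qed
  have "B * B = Q * (A * (P * Q) * A) * P"
    unfolding BQP using P Q A by (simp add: assoc_mult_mat[of _ n n _ n _ n])
  then have BB: "B * B = B" using PQ A idem BQP by simp
  have "mat_trace A = mat_trace (Q * (P * B))"
    unfolding APQ using P Q B by (intro mat_trace_comm) auto
  also have "Q * (P * B) = B" using P Q B QP by (simp flip: assoc_mult_mat[of _ n n _ n _ n])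
  finally have tr: "mat_trace A = mat_trace B" .
  have low: "B $$ (i, j) = 0" if "j < i" "i < n" for i j
    using B that by (auto simp: upper_triangular_def)
  have ent: "B $$ (i, j) = (\<Sum>k<n. B $$ (i, k) * B $$ (k, j))" if "i < n" "j < n" for i j
  proof -
    have "B $$ (i, j) = (B * B) $$ (i, j)" using BB by simp
    then show ?thesis using B(1) that by (simp add: scalar_prod_def lessThan_atLeast0)
  qed
  have diag: "B $$ (i, i) = 0 \<or> B $$ (i, i) = 1" if i: "i < n" for i
  proof -
    have "B $$ (i, i) = (\<Sum>k\<in>{i}. B $$ (i, k) * B $$ (k, i))"
      by (subst ent[OF i i], rule sum.mono_neutral_right)
        (use i low in \<open>auto, metis linorder_neqE_nat\<close>)
    then show ?thesis by simp
  qed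
  define k where "k = card {i. i < n \<and> B $$ (i, i) = 1}"
  have "mat_trace B = (\<Sum>i<n. if B $$ (i, i) = 1 then 1 else 0)"
    unfolding mat_trace_def using B(1) diag by (intro sum.cong) auto
  also have "\<dots> = of_nat k" unfolding k_def by (subst sum.If_cases) (auto intro!: arg_cong[of _ _ card])
  finally have trB: "mat_trace B = of_nat k" .
  moreover have "A = 0\<^sub>m n n" if "k = 0"
  proof -
    have "{i. i < n \<and> B $$ (i, i) = 1} = {}" using that unfolding k_def by (subst (asm) card_0_eq) auto
    then have d0: "B $$ (i, i) = 0" if "i < n" for i using diag that by blast
    have "B $$ (i, j) = 0" if "i < n" "j < n" for i j
      using that
    proof (induction "j - i" arbitrary: i j rule: less_induct)
      case less
      show ?case
      proof (cases "j \<le> i")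
        case True then show ?thesis using low d0 less.prems by (cases "i = j") auto
      next
        case False
        have "B $$ (i, k) * B $$ (k, j) = 0" if "k < n" for k
        proof (cases "i < k \<and> k < j")
          case True then show ?thesis using less.hyps[of k i] less.prems that diff_less_mono[of k j i] by simp
        next
          case F: False
          then have "k < i \<or> k = i \<or> k = j \<or> k > j" by auto
          then show ?thesis using low d0 less.prems that by auto
        qed
        then have "(\<Sum>k<n. B $$ (i, k) * B $$ (k, j)) = 0" by (intro sum.neutral) simp
        then show ?thesis using ent[OF less.prems] by simp
      qed
    qed
    then have "B = 0\<^sub>m n n" using B(1) by (intro eq_matI) auto
    then show ?thesis unfolding APQ using P Q by simp
  qed
  ultimately show ?thesis using that tr by simp
qed

section \<open>Averages over finite families of matrices\<close>

definition mat_avg :: "nat \<Rightarrow> 's set \<Rightarrow> ('s \<Rightarrow> complex mat) \<Rightarrow> complex mat" where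
  "mat_avg n S R = mat n n (\<lambda>ij. (\<Sum>s\<in>S. R s $$ ij) / of_nat (card S))"

lemma mat_avg_carrier [simp]: "mat_avg n S R \<in> carrier_mat n n"
  by (simp add: mat_avg_def)

lemma mat_trace_avg:
  assumes "\<And>s. s \<in> S \<Longrightarrow> R s \<in> carrier_mat n n"
  shows "mat_trace (mat_avg n S R) = (\<Sum>s\<in>S. mat_trace (R s)) / of_nat (card S)"
proof -
  have "mat_trace (mat_avg n S R) = (\<Sum>s\<in>S. \<Sum>i<n. R s $$ (i, i)) / of_nat (card S)"
    by (subst sum.swap) (simp add: mat_trace_def mat_avg_def sum_divide_distrib)
  also have "(\<Sum>s\<in>S. \<Sum>i<n. R s $$ (i, i)) = (\<Sum>s\<in>S. mat_trace (R s))"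
    using assms by (intro sum.cong) (auto simp: mat_trace_def)
  finally show ?thesis .
qed

lemma mult_mat_avg:
  assumes S: "\<And>s. s \<in> S \<Longrightarrow> R s \<in> carrier_mat n n" and A: "A \<in> carrier_mat n n"
  shows "A * mat_avg n S R = mat_avg n S (\<lambda>s. A * R s)"
    and "mat_avg n S R * A = mat_avg n S (\<lambda>s. R s * A)"
proof -
  show "A * mat_avg n S R = mat_avg n S (\<lambda>s. A * R s)"
  proof (rule eq_matI)
    fix i j assume "i < dim_row (mat_avg n S (\<lambda>s. A * R s))" "j < dim_col (mat_avg n S (\<lambda>s. A * R s))"
    then have ij: "i < n" "j < n" by (auto simp: mat_avg_def)
    have "(A * mat_avg n S R) $$ (i, j) = (\<Sum>k<n. A $$ (i, k) * ((\<Sum>s\<in>S. R s $$ (k, j)) / of_nat (card S)))"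
      using A ij by (simp add: scalar_prod_def lessThan_atLeast0 mat_avg_def)
    also have "\<dots> = (\<Sum>s\<in>S. \<Sum>k<n. A $$ (i, k) * R s $$ (k, j)) / of_nat (card S)"
      by (subst sum.swap) (simp add: sum_divide_distrib sum_distrib_left)
    also have "\<dots> = (\<Sum>s\<in>S. (A * R s) $$ (i, j)) / of_nat (card S)"
      using A ij S by (intro arg_cong2[of _ _ _ _ "(/)"] sum.cong) (simp_all add: scalar_prod_def lessThan_atLeast0 carrier_matD[OF S])
    finally show "(A * mat_avg n S R) $$ (i, j) = mat_avg n S (\<lambda>s. A * R s) $$ (i, j)"
      using ij by (simp add: mat_avg_def)
  qed (use A in \<open>auto simp: mat_avg_def\<close>)
  show "mat_avg n S R * A = mat_avg n S (\<lambda>s. R s * A)"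
  proof (rule eq_matI)
    fix i j assume "i < dim_row (mat_avg n S (\<lambda>s. R s * A))" "j < dim_col (mat_avg n S (\<lambda>s. R s * A))"
    then have ij: "i < n" "j < n" by (auto simp: mat_avg_def)
    have "(mat_avg n S R * A) $$ (i, j) = (\<Sum>k<n. ((\<Sum>s\<in>S. R s $$ (i, k)) / of_nat (card S)) * A $$ (k, j))"
      using A ij by (simp add: scalar_prod_def lessThan_atLeast0 mat_avg_def)
    also have "\<dots> = (\<Sum>s\<in>S. \<Sum>k<n. R s $$ (i, k) * A $$ (k, j)) / of_nat (card S)"
      by (subst sum.swap) (simp add: sum_divide_distrib sum_distrib_right)
    also have "\<dots> = (\<Sum>s\<in>S. (R s * A) $$ (i, j)) / of_nat (card S)"
      using A ij S by (intro arg_cong2[of _ _ _ _ "(/)"] sum.cong) (simp_all add: scalar_prod_def lessThan_atLeast0 carrier_matD[OF S])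
    finally show "(mat_avg n S R * A) $$ (i, j) = mat_avg n S (\<lambda>s. R s * A) $$ (i, j)"
      using ij by (simp add: mat_avg_def)
  qed (use A in \<open>auto simp: mat_avg_def\<close>)
qed

text \<open>Averaging uses only that left translations permute the finite index set, so no group
  structure is imposed on it. It is applied to a central subgroup twisted by a character, to the
  product of \<open>G\<close> with two copies of that subgroup, and to the common kernel of a set of
  characters.\<close>

locale mat_action =
  fixes n :: nat and S :: "'s set" and f :: "'s \<Rightarrow> 's \<Rightarrow> 's" and R :: "'s \<Rightarrow> complex mat"
  assumes fin: "finite S" "S \<noteq> {}"
    and bij: "s \<in> S \<Longrightarrow> bij_betw (f s) S S"
    and carr: "s \<in> S \<Longrightarrow> R s \<in> carrier_mat n n"
    and mult: "s \<in> S \<Longrightarrow> t \<in> S \<Longrightarrow> R (f s t) = R s * R t"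
begin

lemma absorb: assumes s: "s \<in> S" shows "R s * mat_avg n S R = mat_avg n S R"
proof -
  have "R s * mat_avg n S R = mat_avg n S (\<lambda>t. R s * R t)"
    by (rule mult_mat_avg) (use carr s in auto)
  also have "\<dots> = mat_avg n S (\<lambda>t. R (f s t))"
    using mult s by (auto simp: mat_avg_def intro!: eq_matI sum.cong arg_cong2[of _ _ _ _ "(/)"])
  also have "\<dots> = mat_avg n S R"
  proof -
    have "(\<Sum>t\<in>S. R (f s t) $$ ij) = (\<Sum>t\<in>S. R t $$ ij)" for ij
      using sum.reindex_bij_betw[OF bij[OF s], of "\<lambda>t. R t $$ ij"] .
    then show ?thesis by (simp add: mat_avg_def)
  qed
  finally show ?thesis .
qed

lemma avg_idempotent: "mat_avg n S R * mat_avg n S R = mat_avg n S R" (is "?P * ?P = _")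
proof -
  have "?P * ?P = mat_avg n S (\<lambda>s. R s * ?P)"
    by (rule mult_mat_avg) (use carr in auto)
  also have "\<dots> = mat_avg n S (\<lambda>s. ?P)"
    using absorb by (auto simp: mat_avg_def[of n S "\<lambda>s. R s * _"] mat_avg_def[of n S "\<lambda>s. mat_avg n S R"] intro!: eq_matI sum.cong)
  also have "\<dots> = ?P" using fin by (intro eq_matI) (auto simp: mat_avg_def)
  finally show ?thesis .
qed

text \<open>The average is the projection onto the common fixed vectors, and its trace is their
  dimension. Integrality of multiplicities and of inner products of characters comes from
  here.\<close>

lemma trace_sum: obtains k where "(\<Sum>s\<in>S. mat_trace (R s)) = of_nat k * of_nat (card S)"
proof -
  obtain k where "mat_trace (mat_avg n S R) = of_nat k"
    using idempotent_trace[OF mat_avg_carrier avg_idempotent] by metis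
  then have "(\<Sum>s\<in>S. mat_trace (R s)) / of_nat (card S) = of_nat k"
    using mat_trace_avg[of S R n] carr by simp
  then show ?thesis using that fin by (simp add: field_simps)
qed

text \<open>The complementary idempotent \<open>1 - P\<close> has trace zero and therefore vanishes;
  with \<open>P = 1\<close> the absorption law reads \<open>R s = 1\<close>.\<close>

lemma trivial_if_trace_full:
  assumes tr: "\<And>s. s \<in> S \<Longrightarrow> mat_trace (R s) = of_nat n" and s: "s \<in> S"
  shows "R s = 1\<^sub>m n"
proof -
  let ?P = "mat_avg n S R" let ?Q = "1\<^sub>m n - ?P"
  have t: "mat_trace ?P = of_nat n" using mat_trace_avg[of S R n] carr tr fin by simp
  have Q: "?Q \<in> carrier_mat n n" by (simp add: minus_carrier_mat)
  have "?Q * ?Q = ?Q * 1\<^sub>m n - ?Q * ?P"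
    by (rule mult_minus_distrib_mat[of _ n n]) (auto simp: minus_carrier_mat[OF mat_avg_carrier])
  also have "?Q * ?P = 1\<^sub>m n * ?P - ?P * ?P" by (rule minus_mult_distrib_mat[of _ n n _ _ n]) auto
  also have "\<dots> = 0\<^sub>m n n"
    using avg_idempotent by (simp add: left_mult_one_mat[OF mat_avg_carrier] minus_r_inv_mat[OF mat_avg_carrier])
  also have "?Q * 1\<^sub>m n - 0\<^sub>m n n = ?Q"
    proof -
    have "X - 0\<^sub>m n n = X" if "X \<in> carrier_mat n n" for X :: "complex mat"
      using that by (intro eq_matI) auto
    then show ?thesis unfolding right_mult_one_mat[OF Q] using Q .
  qed
  finally have "?Q * ?Q = ?Q" .
  moreover have "mat_trace ?Q = 0"
  proof -
    have "mat_trace ?Q = (\<Sum>i<n. 1) - mat_trace ?P"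
      by (simp add: mat_trace_def sum_subtractf mat_avg_def)
    then show ?thesis using t by simp
  qed
  ultimately have "?Q = 0\<^sub>m n n" using idempotent_trace[OF Q] by (metis of_nat_eq_0_iff)
  then have "?P = 1\<^sub>m n"
    by (intro eq_matI) (auto simp: mat_eq_iff mat_avg_def)
  then show ?thesis using absorb[OF s] carr[OF s] by simp
qed

end

text \<open>Row and column indices encode pairs through \<open>div n\<close> and
  \<open>mod n\<close>. Tensor products serve one purpose: a product of two traces becomes the trace
  of one matrix, to which averaging applies.\<close>

definition kronecker :: "nat \<Rightarrow> complex mat \<Rightarrow> complex mat \<Rightarrow> complex mat" where
  "kronecker n A B = mat (n * n) (n * n)
     (\<lambda>(i, j). A $$ (i div n, j div n) * B $$ (i mod n, j mod n))"

lemma kronecker_carrier [simp]: "kronecker n A B \<in> carrier_mat (n * n) (n * n)"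
  by (simp add: kronecker_def)

lemma sum_div_mod:
  fixes g :: "nat \<Rightarrow> nat \<Rightarrow> 'b::comm_monoid_add"
  shows "(\<Sum>k<n * n. g (k div n) (k mod n)) = (\<Sum>a<n. \<Sum>b<n. g a b)"
proof -
  have "(\<Sum>k<n * n. g (k div n) (k mod n)) = (\<Sum>a<n. \<Sum>k\<in>{a * n..<a * n + n}. g (k div n) (k mod n))"
    by (rule sum.nat_group[symmetric])
  also have "\<dots> = (\<Sum>a<n. \<Sum>b<n. g a b)"
  proof (rule sum.cong)
    fix a assume "a \<in> {..<n}"
    show "(\<Sum>k\<in>{a * n..<a * n + n}. g (k div n) (k mod n)) = (\<Sum>b<n. g a b)"
    proof -
      have "(\<Sum>k\<in>{0 + a * n..<n + a * n}. g (k div n) (k mod n)) = (\<Sum>b\<in>{0..<n}. g ((b + a * n) div n) ((b + a * n) mod n))"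
        by (rule sum.shift_bounds_nat_ivl)
      also have "\<dots> = (\<Sum>b\<in>{0..<n}. g a b)" by (intro sum.cong) auto
      finally show ?thesis by (simp add: add.commute lessThan_atLeast0)
    qed
  qed simp
  finally show ?thesis .
qed

lemma mat_trace_kronecker:
  assumes "A \<in> carrier_mat n n" "B \<in> carrier_mat n n"
  shows "mat_trace (kronecker n A B) = mat_trace A * mat_trace B"
proof -
  have "mat_trace (kronecker n A B) = (\<Sum>k<n * n. (\<lambda>a b. A $$ (a, a) * B $$ (b, b)) (k div n) (k mod n))"
    by (simp add: mat_trace_def kronecker_def)
  also have "\<dots> = mat_trace A * mat_trace B"
    unfolding sum_div_mod[of "\<lambda>a b. A $$ (a, a) * B $$ (b, b)"] using assms by (simp add: mat_trace_def sum_product)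
  finally show ?thesis .
qed

lemma kronecker_mult:
  assumes "A \<in> carrier_mat n n" "B \<in> carrier_mat n n" "C \<in> carrier_mat n n" "D \<in> carrier_mat n n"
  shows "kronecker n (A * C) (B * D) = kronecker n A B * kronecker n C D"
proof (rule eq_matI)
  fix i j assume "i < dim_row (kronecker n A B * kronecker n C D)" "j < dim_col (kronecker n A B * kronecker n C D)"
  then have ij: "i < n * n" "j < n * n" by (auto simp: kronecker_def)
  then have n: "n > 0" by (cases n) auto
  have b: "i div n < n" "i mod n < n" "j div n < n" "j mod n < n"
    using ij n by (auto simp: less_mult_imp_div_less)
  have "(kronecker n A B * kronecker n C D) $$ (i, j) =
    (\<Sum>k<n * n. (\<lambda>a b. A $$ (i div n, a) * B $$ (i mod n, b) * (C $$ (a, j div n) * D $$ (b, j mod n))) (k div n) (k mod n))"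
    using ij by (simp add: kronecker_def scalar_prod_def lessThan_atLeast0)
  also have "\<dots> = (\<Sum>a<n. A $$ (i div n, a) * C $$ (a, j div n)) * (\<Sum>b<n. B $$ (i mod n, b) * D $$ (b, j mod n))"
    unfolding sum_div_mod[of "\<lambda>a b. A $$ (i div n, a) * B $$ (i mod n, b) * (C $$ (a, j div n) * D $$ (b, j mod n))"]
    by (simp add: sum_product mult_ac)
  also have "\<dots> = kronecker n (A * C) (B * D) $$ (i, j)"
    using ij b assms by (simp add: kronecker_def scalar_prod_def lessThan_atLeast0)
  finally show "kronecker n (A * C) (B * D) $$ (i, j) = (kronecker n A B * kronecker n C D) $$ (i, j)" ..
qed (auto simp: kronecker_def)

lemma smult_smult: "a \<cdot>\<^sub>m (b \<cdot>\<^sub>m A) = (a * b) \<cdot>\<^sub>m (A :: complex mat)"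
  by (intro eq_matI) auto

lemma smult_mult_smult:
  "A \<in> carrier_mat k k \<Longrightarrow> B \<in> carrier_mat k k \<Longrightarrow> (a \<cdot>\<^sub>m A) * (b \<cdot>\<^sub>m B) = (a * b) \<cdot>\<^sub>m (A * B :: complex mat)"
  by (simp add: mult_smult_assoc_mat[of _ k k _ k] mult_smult_distrib[of _ k k _ k] smult_smult mult.commute)

lemma mat_trace_smult: "A \<in> carrier_mat k k \<Longrightarrow> mat_trace (c \<cdot>\<^sub>m A) = c * mat_trace (A :: complex mat)"
  by (auto simp: mat_trace_def sum_distrib_left)

lemma mat_trace_transpose: "A \<in> carrier_mat k k \<Longrightarrow> mat_trace (transpose_mat A) = mat_trace (A :: complex mat)"
  by (auto simp: mat_trace_def)

section \<open>Linear independence of the powers of a root of unity\<close>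

text \<open>The cyclotomic polynomial of \<open>p\<close> shifted by 1, that is ((1 + X)^p - 1) / X;
  in this form it is an Eisenstein polynomial at \<open>p\<close>.\<close>

definition eis_poly :: "nat \<Rightarrow> int poly" where
  "eis_poly p = (\<Sum>k<p. Polynomial.monom (int (p choose (Suc k))) k)"

lemma coeff_eis_poly: "Polynomial.coeff (eis_poly p) k = (if k < p then int (p choose Suc k) else 0)"
  by (simp add: eis_poly_def coeff_sum sum.delta)

lemma degree_eis_poly: assumes "p > 0" shows "degree (eis_poly p) = p - 1"
proof (rule antisym)
  show "degree (eis_poly p) \<le> p - 1"
    using assms by (intro degree_le) (auto simp: coeff_eis_poly)
  show "p - 1 \<le> degree (eis_poly p)"
    using assms by (intro le_degree) (simp add: coeff_eis_poly)
qed

lemma monic_eis_poly: "p > 0 \<Longrightarrow> lead_coeff (eis_poly p) = 1"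
  by (simp add: degree_eis_poly coeff_eis_poly)

lemma eis_poly_root:
  fixes w :: complex
  assumes "w ^ p = 1" "w \<noteq> 1" "p > 0"
  shows "poly (map_poly of_int (eis_poly p)) (w - 1) = 0"
proof -
  have "poly (map_poly of_int (eis_poly p)) (w - 1) = (\<Sum>k<p. of_nat (p choose Suc k) * (w - 1) ^ k)"
    unfolding eis_poly_def by (simp add: of_int_poly_hom.hom_sum hom_distribs poly_sum poly_monom)
  then have "poly (map_poly of_int (eis_poly p)) (w - 1) * (w - 1) = (\<Sum>k<p. of_nat (p choose Suc k) * (w - 1) ^ Suc k)"
    by (simp add: sum_distrib_left mult_ac)
  also have "\<dots> = (\<Sum>k\<le>p. of_nat (p choose k) * (w - 1) ^ k) - 1"
    by (simp add: sum.lessThan_Suc_shift flip: lessThan_Suc_atMost del: sum.lessThan_Suc)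
  also have "\<dots> = 0"
    using binomial_ring[of "w - 1" 1 p] assms(1) by simp
  finally show ?thesis using assms(2) by simp
qed

text \<open>Eisenstein's argument. The constant coefficient is \<open>p\<close>, so in a
  factorisation some factor \<open>b\<close> has constant coefficient prime to \<open>p\<close>. The
  lowest coefficient of the other factor that is prime to \<open>p\<close> then survives in the
  product at the same index, which must be \<open>p - 1\<close>; that factor has full degree and
  \<open>b\<close> is constant.\<close>

lemma eis_poly_irreducible:
  assumes p: "prime p"
  shows "irreducible (eis_poly p)"
proof (rule irreducibleI)
  have p0: "p > 0" "p > 1" using p prime_gt_0_nat prime_gt_1_nat by auto
  show "eis_poly p \<noteq> 0" using monic_eis_poly[OF p0(1)] by auto
  show "\<not> eis_poly p dvd 1"
  proof
    assume "eis_poly p dvd 1"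
    then have "poly (eis_poly p) 0 dvd 1" by (auto simp: dvd_def) (metis poly_1 poly_mult)
    then have "int p dvd 1" by (simp add: poly_0_coeff_0 coeff_eis_poly p0)
    with p0 show False by simp
  qed
  fix f g assume fg: "eis_poly p = f * g"
  have lc: "lead_coeff f * lead_coeff g = 1" using monic_eis_poly[OF p0(1)] fg by (simp add: lead_coeff_mult)
  have deg: "degree f + degree g = p - 1"
    using degree_eis_poly[OF p0(1)] fg lc by (metis degree_mult_eq mult_zero_left mult_zero_right leading_coeff_0_iff zero_neq_one)
  have main: "degree b = 0" if ab: "eis_poly p = a * b" "\<not> int p dvd Polynomial.coeff b 0" "lead_coeff a * lead_coeff b = 1" "degree a + degree b = p - 1" for a b :: "int poly"
  proof -
    have "\<not> int p dvd lead_coeff a" using ab(3) p0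
      by (metis dvd_mult2 int_dvd_int_iff nat_dvd_1_iff_1 of_nat_1 less_irrefl)
    define i where "i = (LEAST i. \<not> int p dvd Polynomial.coeff a i)"
    have i: "\<not> int p dvd Polynomial.coeff a i" unfolding i_def by (rule LeastI) fact
    have j: "int p dvd Polynomial.coeff a j" if "j < i" for j using not_less_Least that unfolding i_def by blast
    have "Polynomial.coeff (a * b) i = Polynomial.coeff a i * Polynomial.coeff b 0 + (\<Sum>j<i. Polynomial.coeff a j * Polynomial.coeff b (i - j))"
      unfolding coeff_mult by (simp flip: lessThan_Suc_atMost)
    moreover have "int p dvd (\<Sum>j<i. Polynomial.coeff a j * Polynomial.coeff b (i - j))" by (intro dvd_sum dvd_mult2 j) simp
    moreover have "\<not> int p dvd Polynomial.coeff a i * Polynomial.coeff b 0"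
      using i ab(2) p by (simp add: prime_dvd_mult_iff)
    ultimately have "\<not> int p dvd Polynomial.coeff (eis_poly p) i" using ab(1) by (simp add: dvd_add_left_iff)
    then have "i < p" "\<not> p dvd p choose Suc i" by (auto simp: coeff_eis_poly split: if_splits)
    then have "i = p - 1" using p p0 dvd_choose_prime[of "Suc i" p] by (cases "Suc i < p") auto
    moreover have "i \<le> degree a" using i by (metis dvd_0_right le_degree)
    ultimately show "degree b = 0" using ab(4) by simp
  qed
  have c0: "Polynomial.coeff f 0 * Polynomial.coeff g 0 = int p"
    using arg_cong[OF fg, of "\<lambda>q. Polynomial.coeff q 0"] p0 by (simp add: coeff_eis_poly coeff_mult)
  have "\<not> (int p dvd Polynomial.coeff f 0 \<and> int p dvd Polynomial.coeff g 0)"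
  proof
    assume "int p dvd Polynomial.coeff f 0 \<and> int p dvd Polynomial.coeff g 0"
    then have "int p * int p dvd int p" using c0 by (metis mult_dvd_mono)
    then have "p * p dvd p * 1" by (simp flip: of_nat_mult)
    then show False using p0 nat_mult_dvd_cancel1[of p p 1] by simp
  qed
  moreover have unit: "h dvd 1" if "degree h = 0" "lead_coeff h dvd 1" for h :: "int poly"
    using that by (elim degree_eq_zeroE) (simp add: is_unit_const_poly_iff)
  moreover have "lead_coeff f dvd 1" "lead_coeff g dvd 1" using lc by (metis dvd_triv_left, metis dvd_triv_right)
  ultimately show "f dvd 1 \<or> g dvd 1"
    using main[OF fg] main[of g f] fg lc deg by (auto simp: mult.commute add.commute)
qed

text \<open>By pseudo-division an annihilating polynomial \<open>B\<close> of least degree divides a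
  scalar multiple of \<open>eis_poly p\<close>. In the factorial ring of integer polynomials
  \<open>eis_poly p\<close> is prime, so it divides \<open>B\<close>, whose degree is too small, or
  the cofactor, which makes \<open>B\<close> a nonzero constant without roots.\<close>

lemma eis_poly_minimal:
  assumes p: "prime p" and w: "w ^ p = 1" "w \<noteq> (1::complex)"
    and A: "poly (map_poly of_int A) (w - 1) = 0" "degree A < p - 1"
  shows "A = 0"
proof (rule ccontr)
  assume "A \<noteq> 0"
  have p0: "p > 0" using p prime_gt_0_nat by auto
  let ?P = "\<lambda>A. A \<noteq> 0 \<and> poly (map_poly of_int A) (w - 1) = 0"
  obtain B where B: "?P B" "\<And>C. ?P C \<Longrightarrow> degree B \<le> degree C"
    using ex_has_least_nat[of ?P A degree] A \<open>A \<noteq> 0\<close> by auto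
  have dB: "degree B < p - 1" using B(2)[of A] A \<open>A \<noteq> 0\<close> by simp
  obtain q r where qr: "pseudo_divmod (eis_poly p) B = (q, r)" by fastforce
  let ?c = "lead_coeff B ^ (Suc (degree (eis_poly p)) - degree B)"
  note pd = pseudo_divmod[OF _ qr]
  have eq: "Polynomial.smult ?c (eis_poly p) = B * q + r" using pd(1) B(1) by simp
  have "poly (map_poly of_int (Polynomial.smult ?c (eis_poly p))) (w - 1) = 0"
    using eis_poly_root[OF w p0] by (simp add: hom_distribs)
  then have "poly (map_poly of_int r) (w - 1) = 0"
    using B(1) unfolding eq by (simp add: hom_distribs)
  then have r: "r = 0" using B(2)[of r] pd(2) B(1) by fastforce
  have pe: "prime_elem (eis_poly p)" using eis_poly_irreducible[OF p] by (rule irreducible_imp_prime_elem_gcd)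
  have "eis_poly p dvd B * q" using eq r by (metis add.right_neutral dvd_smult dvd_refl)
  then have "eis_poly p dvd B \<or> eis_poly p dvd q" using pe by (rule prime_elem_dvd_multD[rotated])
  then show False
  proof
    assume "eis_poly p dvd B"
    then have "degree (eis_poly p) \<le> degree B" using B(1) by (intro dvd_imp_degree_le) auto
    then show False using dB degree_eis_poly[OF p0] by simp
  next
    assume d: "eis_poly p dvd q"
    have c0: "?c \<noteq> 0" using B(1) by simp
    then have q0: "q \<noteq> 0" using eq r monic_eis_poly[OF p0] by auto
    have "degree (eis_poly p) = degree B + degree q"
      using arg_cong[OF eq, of degree] r B(1) q0 c0 by (simp add: degree_mult_eq)
    moreover have "degree (eis_poly p) \<le> degree q" using d q0 by (intro dvd_imp_degree_le) auto
    ultimately have "degree B = 0" by simp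
    then obtain b where b: "B = [:b:]" by (metis degree_eq_zeroE)
    with B(1) show False by (auto simp: map_poly_pCons)
  qed
qed

lemma root_of_unity_relation:
  fixes a :: "nat \<Rightarrow> int" and w :: complex
  assumes p: "prime p" and w: "w ^ p = 1" "w \<noteq> 1"
    and rel: "(\<Sum>k<p. of_int (a k) * w ^ k) = 0" and k: "k < p"
  shows "a k = a 0"
proof -
  have p0: "p > 0" "p > 1" using p prime_gt_0_nat prime_gt_1_nat by auto
  have geo: "(\<Sum>k<p. w ^ k) = 0" using w by (simp add: geometric_sum)
  \<comment> \<open>Subtracting \<open>a (p - 1)\<close> times the vanishing geometric sum removes
    the top term and leaves degree below \<open>p - 1\<close>.\<close>
  define A where "A = (\<Sum>k<p-1. Polynomial.monom (a k - a (p - 1)) k)"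
  have cA: "Polynomial.coeff A k = (if k < p - 1 then a k - a (p - 1) else 0)" for k
    unfolding A_def by (simp add: coeff_sum sum.delta)
  have "poly (map_poly of_int A) w = (\<Sum>k<p-1. of_int (a k - a (p - 1)) * w ^ k)"
    unfolding A_def by (simp add: of_int_poly_hom.hom_sum hom_distribs poly_sum poly_monom)
  also have "\<dots> = (\<Sum>k<p. of_int (a k - a (p - 1)) * w ^ k)"
    using p0 by (cases p) auto
  also have "\<dots> = 0" using rel geo by (simp add: left_diff_distrib sum_subtractf flip: sum_distrib_left)
  finally have Aw: "poly (map_poly of_int A) w = 0" .
  have dA: "A = 0"
  proof (rule ccontr)
    assume A0: "A \<noteq> 0"
    \<comment> \<open>Minimality is known for \<open>w - 1\<close>, so the variable is
      shifted.\<close>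
    let ?B = "A \<circ>\<^sub>p [:1, 1:]"
    have "poly (map_poly of_int ?B) (w - 1) = poly (map_poly of_int A) (1 + (w - 1))"
      by (simp add: of_int_hom.map_poly_pcompose poly_pcompose)
    then have "poly (map_poly of_int ?B) (w - 1) = 0" using Aw by simp
    moreover have "degree ?B < p - 1"
    proof -
      have "degree A < p - 1" using A0 cA[of "degree A"] by (rule_tac ccontr) auto
      then show ?thesis by (simp add: degree_pcompose)
    qed
    ultimately have "?B = 0" by (rule eis_poly_minimal[OF p w])
    then show False using A0 by (auto dest!: pcompose_eq_0)
  qed
  have "a k = a (p - 1)" if "k < p" for k
    using cA[of k] dA that by (cases "k = p - 1") (auto split: if_splits)
  then show ?thesis using k p0 by metis
qed

section \<open>Elementary abelian sections of groups\<close>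

context group
begin

definition comm :: "'a \<Rightarrow> 'a \<Rightarrow> 'a" where
  "comm x y = x \<otimes> y \<otimes> inv x \<otimes> inv y"

lemma inv_cancel_left:
  "x \<in> carrier G \<Longrightarrow> y \<in> carrier G \<Longrightarrow> x \<otimes> (inv x \<otimes> y) = y"
  "x \<in> carrier G \<Longrightarrow> y \<in> carrier G \<Longrightarrow> inv x \<otimes> (x \<otimes> y) = y"
  by (simp_all flip: m_assoc)

lemmas word_simps = m_assoc inv_mult_group inv_cancel_left

lemma comm_closed [simp, intro]: "x \<in> carrier G \<Longrightarrow> y \<in> carrier G \<Longrightarrow> comm x y \<in> carrier G"
  by (simp add: comm_def)

lemma comm_swap: "x \<in> carrier G \<Longrightarrow> y \<in> carrier G \<Longrightarrow> x \<otimes> y = comm x y \<otimes> (y \<otimes> x)"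
  by (simp add: comm_def word_simps)

lemma comm_conj: "x \<in> carrier G \<Longrightarrow> y \<in> carrier G \<Longrightarrow> x \<otimes> y \<otimes> inv x = comm x y \<otimes> y"
  by (simp add: comm_def word_simps)

lemma inv_comm: "x \<in> carrier G \<Longrightarrow> y \<in> carrier G \<Longrightarrow> inv (comm x y) = comm y x"
  by (simp add: comm_def word_simps)

lemma comm_one_iff: "x \<in> carrier G \<Longrightarrow> y \<in> carrier G \<Longrightarrow> comm x y = \<one> \<longleftrightarrow> x \<otimes> y = y \<otimes> x"
  by (metis comm_closed comm_swap l_one m_closed one_closed r_cancel_one' right_cancel)

lemma comm_mult_left:
  "\<lbrakk>x \<in> carrier G; x' \<in> carrier G; y \<in> carrier G\<rbrakk> \<Longrightarrow>
    comm (x \<otimes> x') y = comm x (comm x' y) \<otimes> comm x' y \<otimes> comm x y"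
  by (simp add: comm_def word_simps)

lemma comm_mult_right:
  "\<lbrakk>x \<in> carrier G; y \<in> carrier G; y' \<in> carrier G\<rbrakk> \<Longrightarrow>
    comm x (y \<otimes> y') = comm x y \<otimes> comm y (comm x y') \<otimes> comm x y'"
  by (simp add: comm_def word_simps)

lemma comm_one [simp]: "x \<in> carrier G \<Longrightarrow> comm x \<one> = \<one>" "x \<in> carrier G \<Longrightarrow> comm \<one> x = \<one>"
  "x \<in> carrier G \<Longrightarrow> comm x x = \<one>"
  by (simp_all add: comm_def word_simps)

end

text \<open>Functionals with values in the field of order \<open>p\<close> are encoded as integer-valued maps that
  are additive modulo \<open>p\<close>.\<close>

definition padd :: "nat \<Rightarrow> ('a, 'b) monoid_scheme \<Rightarrow> 'a set \<Rightarrow> ('a \<Rightarrow> int) \<Rightarrow> bool" where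
  "padd p G S f \<longleftrightarrow> (\<forall>x\<in>S. \<forall>y\<in>S. [f (x \<otimes>\<^bsub>G\<^esub> y) = f x + f y] (mod int p))"

context group
begin

text \<open>Left translation by an element is an injection of the finite set into itself, hence
  onto, and so produces the unit and the inverse.\<close>

lemma finite_subgroupI:
  assumes "finite H" "H \<subseteq> carrier G" "H \<noteq> {}" and cl: "\<And>x y. x \<in> H \<Longrightarrow> y \<in> H \<Longrightarrow> x \<otimes> y \<in> H"
  shows "subgroup H G"
proof (rule subgroupI)
  fix a assume a: "a \<in> H"
  then have aG: "a \<in> carrier G" using assms by auto
  have "inj_on (\<lambda>x. a \<otimes> x) H" using aG assms(2) by (auto simp: inj_on_def subset_iff)
  then have sur: "(\<lambda>x. a \<otimes> x) ` H = H" using cl a assms(1) by (intro endo_inj_surj) auto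
  then obtain e where e: "e \<in> H" "a \<otimes> e = a" using a by (metis imageE)
  then have "e \<in> carrier G" using assms(2) by auto
  then have "e = \<one>" using aG e(2) by simp
  then have "\<one> \<in> (\<lambda>x. a \<otimes> x) ` H" using e sur by simp
  then obtain b where b: "b \<in> H" "\<one> = a \<otimes> b" by auto
  then have "b \<in> carrier G" using assms(2) by auto
  then have "inv a = b" using aG b(2) inv_equality[of a b] by (metis inv_inv)
  then show "inv a \<in> H" using b by simp
qed (use assms in auto)

end

lemma prime_inverse_mod:
  assumes "prime p" "\<not> p dvd (i :: nat)"
  shows "\<exists>j. [i * j = 1] (mod p)"
proof -
  have "coprime p i" using assms by (rule prime_imp_coprime)
  then have "coprime i p" by (rule coprime_commute[THEN iffD1])
  then show ?thesis using cong_solve_coprime_nat[of i p] by simp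
qed

text \<open>An elementary abelian quotient of \<open>S\<close> by \<open>N\<close>, described
  without forming cosets. Since commutators lie in \<open>N\<close>, every subgroup between
  \<open>N\<close> and \<open>S\<close> is normal in \<open>S\<close>, which is what makes the
  calculus with congruences modulo such a subgroup work.\<close>

locale elementary_section = group +
  fixes S N :: "'a set" and p :: nat
  assumes S: "subgroup S G" and N: "subgroup N G" and NS: "N \<subseteq> S" and finS: "finite S"
    and p: "prime p"
    and comm_N: "x \<in> S \<Longrightarrow> y \<in> S \<Longrightarrow> comm x y \<in> N"
    and pow_N: "x \<in> S \<Longrightarrow> x [^] p \<in> N"
begin

lemma SG [simp]: "x \<in> S \<Longrightarrow> x \<in> carrier G" using subgroup.mem_carrier[OF S] .

lemmas S_closed [simp] = subgroup.m_closed[OF S] subgroup.one_closed[OF S] subgroup.m_inv_closed[OF S]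

lemma pow_closed [simp]: "x \<in> S \<Longrightarrow> x [^] (n::nat) \<in> S"
  by (induction n) auto

context
  fixes M assumes M: "subgroup M G" and NM: "N \<subseteq> M" and MS: "M \<subseteq> S"
begin

lemmas M_closed [simp] = subgroup.m_closed[OF M] subgroup.one_closed[OF M] subgroup.m_inv_closed[OF M]

lemma M_S [simp]: "x \<in> M \<Longrightarrow> x \<in> S" using MS by auto

lemma conj_M: assumes "x \<in> S" "m \<in> M" shows "x \<otimes> m \<otimes> inv x \<in> M"
proof -
  have "comm x m \<in> M" using comm_N[of x m] assms NM by auto
  then show ?thesis using comm_conj[of x m] assms by simp
qed

lemma coset_mult:
  assumes "x \<in> S" "x' \<in> S" "y \<in> S" "y' \<in> S" "x \<otimes> inv y \<in> M" "x' \<otimes> inv y' \<in> M"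
  shows "(x \<otimes> x') \<otimes> inv (y \<otimes> y') \<in> M"
proof -
  have "(x \<otimes> x') \<otimes> inv (y \<otimes> y') = (x \<otimes> (x' \<otimes> inv y') \<otimes> inv x) \<otimes> (x \<otimes> inv y)"
    using assms by (simp add: word_simps)
  then show ?thesis using conj_M[of x "x' \<otimes> inv y'"] assms by simp
qed

lemma coset_pow:
  assumes "x \<in> S" "y \<in> S" "x \<otimes> inv y \<in> M"
  shows "x [^] (n::nat) \<otimes> inv (y [^] n) \<in> M"
proof (induction n)
  case (Suc n)
  then show ?case using coset_mult[of "x [^] n" x "y [^] n" y] assms by simp
qed simp

lemma pow_mod_M:
  assumes x: "x \<in> S" and "[i = j] (mod p)"
  shows "x [^] i \<otimes> inv (x [^] j) \<in> M"
proof -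
  have *: "x [^] i \<otimes> inv (x [^] j) \<in> M" if c: "[i = j] (mod p)" and l: "j \<le> i" for i j
  proof -
    obtain t where "i = t * p + j" using cong_le_nat[OF l, of p] c by auto
    then have "x [^] i = (x [^] p) [^] t \<otimes> x [^] j"
      using x by (simp add: nat_pow_pow nat_pow_mult mult.commute)
    then have "x [^] i \<otimes> inv (x [^] j) = (x [^] p) [^] t" using x by (simp add: word_simps)
    moreover have "(x [^] p) [^] t \<in> M"
      using pow_N[OF x] NM by (induction t) auto
    ultimately show ?thesis by simp
  qed
  show ?thesis
  proof (cases "j \<le> i")
    case False
    then have "x [^] j \<otimes> inv (x [^] i) \<in> M" using *[OF cong_sym[OF assms(2)]] by simp
    then have "inv (x [^] j \<otimes> inv (x [^] i)) \<in> M" by simp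
    then show ?thesis using x by (simp add: word_simps)
  qed (use * assms in simp)
qed

end

text \<open>Let \<open>M\<close> be maximal among the subgroups between \<open>N\<close> and
  \<open>S\<close> that miss \<open>g\<close>. Adjoining any \<open>h\<close> outside
  \<open>M\<close> brings in \<open>g\<close>, so \<open>h\<close> is congruent modulo
  \<open>M\<close> to a power of \<open>g\<close>; the exponent, unique modulo \<open>p\<close>, is
  the required functional. In other words \<open>M\<close> is a hyperplane that misses
  \<open>g\<close>.\<close>

lemma exists_functional:
  assumes g: "g \<in> S" "g \<notin> N"
  obtains f where "padd p G S f" "\<And>n. n \<in> N \<Longrightarrow> [f n = 0] (mod int p)" "f g = 1"
proof -
  let ?P = "\<lambda>M. subgroup M G \<and> N \<subseteq> M \<and> M \<subseteq> S \<and> g \<notin> M"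
  have "finite (Collect ?P)" by (rule finite_subset[of _ "Pow S"]) (use finS in auto)
  moreover have "N \<in> Collect ?P" using N NS g by auto
  moreover obtain M where M: "?P M" and Mmax: "\<And>M'. ?P M' \<Longrightarrow> card M' \<le> card M"
  proof -
    have fin: "finite (card ` Collect ?P)" using calculation(1) by simp
    moreover have "card ` Collect ?P \<noteq> {}" using \<open>N \<in> Collect ?P\<close> by blast
    ultimately have "Max (card ` Collect ?P) \<in> card ` Collect ?P" by (rule Max_in)
    then obtain M where "?P M" "card M = Max (card ` Collect ?P)" by force
    then have "card M' \<le> card M" if "?P M'" for M' using Max_ge[OF fin, of "card M'"] that by simp
    then show ?thesis using that[of M] \<open>?P M\<close> by blast
  qed
  note Mc = M_closed[of M] and cm = coset_mult[of M] and cp = coset_pow[of M] and pm = pow_mod_M[of M]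
  have finM: "finite M" using M finS finite_subset by blast
  have ex: "\<exists>k<p. h \<otimes> inv (g [^] k) \<in> M" if h: "h \<in> S" for h
  proof (cases "h \<in> M")
    case True
    then show ?thesis using prime_gt_0_nat[OF p] h by (intro exI[of _ 0]) simp
  next
    case False
    let ?M' = "{x \<in> S. \<exists>i::nat. x \<otimes> inv (h [^] i) \<in> M}"
    have "subgroup ?M' G"
    proof (rule finite_subgroupI)
      fix x y assume "x \<in> ?M'" "y \<in> ?M'"
      then obtain i j :: nat where xy: "x \<in> S" "y \<in> S" "x \<otimes> inv (h [^] i) \<in> M" "y \<otimes> inv (h [^] j) \<in> M" by auto
      have "x \<otimes> y \<otimes> inv (h [^] i \<otimes> h [^] j) \<in> M"
        by (rule cm) (use M xy h in simp_all)
      then have "x \<otimes> y \<otimes> inv (h [^] (i + j)) \<in> M" using h by (simp add: nat_pow_mult)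
      then show "x \<otimes> y \<in> ?M'" using xy by auto
    next
      have "\<one> \<in> ?M'" using M h by (auto intro!: exI[of _ 0] subgroup.one_closed)
      then show "?M' \<noteq> {}" by blast
    qed (use finS in auto)
    moreover have "M \<subset> ?M'"
    proof
      show "M \<subseteq> ?M'" using M h by (auto intro!: exI[of _ 0])
      have "h \<in> ?M'" using h M by (auto intro!: exI[of _ 1] subgroup.one_closed)
      then show "M \<noteq> ?M'" using False by auto
    qed
    moreover have "card M < card ?M'" using finS by (intro psubset_card_mono calculation) auto
    moreover have "N \<subseteq> ?M'" "?M' \<subseteq> S" using M calculation(2) by auto
    ultimately have "g \<in> ?M'" using Mmax[of ?M'] by (meson not_less)
    then obtain i :: nat where i: "g \<otimes> inv (h [^] i) \<in> M" by auto
    \<comment> \<open>Otherwise \<open>h [^] i\<close> would lie in \<open>M\<close>, and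
      \<open>g\<close> with it.\<close>
    have "\<not> p dvd i"
    proof
      assume "p dvd i"
      then have "h [^] i \<otimes> inv (h [^] (0::nat)) \<in> M" using pm[of h i 0] M h by (simp add: cong_0_iff)
      then have "(g \<otimes> inv (h [^] i)) \<otimes> h [^] i \<in> M" using i M h by (auto intro: subgroup.m_closed)
      then show False using M g h by (simp add: word_simps)
    qed
    then obtain j where j: "[i * j = 1] (mod p)" using prime_inverse_mod[OF p] by blast
    define k where "k = j mod p"
    have k: "k < p" using prime_gt_0_nat[OF p] by (simp add: k_def)
    have k': "[i * k = 1] (mod p)" using j by (simp add: k_def cong_def mod_mult_right_eq)
    have 1: "g [^] k \<otimes> inv ((h [^] i) [^] k) \<in> M" using cp[of g "h [^] i" k] i M g h by simp
    have 2: "h [^] (i * k) \<otimes> inv (h [^] (1::nat)) \<in> M" using pm[of h "i * k" 1] k' M h by simp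
    have "(g [^] k \<otimes> inv ((h [^] i) [^] k)) \<otimes> (h [^] (i * k) \<otimes> inv (h [^] (1::nat))) \<in> M"
      using 1 2 M by (auto intro: subgroup.m_closed)
    then have "g [^] k \<otimes> inv h \<in> M" using g h by (simp add: word_simps nat_pow_pow)
    then have "inv (g [^] k \<otimes> inv h) \<in> M" using M by (auto intro: subgroup.m_inv_closed)
    then have "h \<otimes> inv (g [^] k) \<in> M" using g h by (simp add: word_simps)
    then show ?thesis using k by blast
  qed
  have gk: "p dvd k" if "g [^] k \<in> M" for k :: nat
  proof (rule ccontr)
    assume "\<not> p dvd k"
    then obtain j where j: "[k * j = 1] (mod p)" using prime_inverse_mod[OF p] by blast
    have "g [^] (k * j) \<otimes> inv (g [^] (1::nat)) \<in> M" using pm[of g "k * j" 1] j M g by simp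
    then have "inv (g [^] (k * j) \<otimes> inv (g [^] (1::nat))) \<in> M" using M by (auto intro: subgroup.m_inv_closed)
    moreover have "(g [^] k) [^] j \<in> M" using that M by (induction j) (auto intro: subgroup.m_closed subgroup.one_closed)
    ultimately have "inv (g [^] (k * j) \<otimes> inv (g [^] (1::nat))) \<otimes> (g [^] k) [^] j \<in> M"
      using M by (auto intro: subgroup.m_closed)
    then show False using M g by (simp add: word_simps nat_pow_pow)
  qed
  have uniq: "[int i = int j] (mod int p)" if "h \<in> S" "h \<otimes> inv (g [^] i) \<in> M" "h \<otimes> inv (g [^] j) \<in> M" for h and i j :: nat
  proof -
    have *: "[int i = int j] (mod int p)" if "h \<in> S" "h \<otimes> inv (g [^] i) \<in> M" "h \<otimes> inv (g [^] j) \<in> M" "i \<le> j" for i j :: nat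
    proof -
      have "inv (h \<otimes> inv (g [^] j)) \<otimes> (h \<otimes> inv (g [^] i)) \<in> M"
        using that M by (auto intro: subgroup.m_closed subgroup.m_inv_closed)
      then have "g [^] j \<otimes> inv (g [^] i) \<in> M" using that g by (simp add: word_simps)
      moreover have "g [^] j = g [^] (j - i) \<otimes> g [^] i" using that g by (simp add: nat_pow_mult)
      ultimately have "g [^] (j - i) \<in> M" using g by (simp add: word_simps)
      then have "p dvd j - i" by (rule gk)
      then have "[j = i] (mod p)" using that by (simp add: cong_altdef_nat)
      then show ?thesis unfolding cong_int_iff by (rule cong_sym)
    qed
    show ?thesis
    proof (cases "i \<le> j")
      case False
      then show ?thesis using cong_sym[OF *[of j i]] that by simp
    qed (use * that in simp)
  qed
  define F where "F h = (SOME k. k < p \<and> h \<otimes> inv (g [^] k) \<in> M)" for h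
  have F: "F h < p" "h \<otimes> inv (g [^] F h) \<in> M" if "h \<in> S" for h
    using someI_ex[OF ex[OF that]] unfolding F_def by auto
  have eqF: "[int (F h) = int k] (mod int p)" if "h \<in> S" "h \<otimes> inv (g [^] k) \<in> M" for h k
    using uniq[of h "F h" k] F that by auto
  have padd: "padd p G S (\<lambda>h. int (F h))"
    unfolding padd_def
  proof (intro ballI)
    fix x y assume xy: "x \<in> S" "y \<in> S"
    have "x \<otimes> y \<otimes> inv (g [^] F x \<otimes> g [^] F y) \<in> M"
      by (rule cm) (use M F xy g in simp_all)
    then have "[int (F (x \<otimes> y)) = int (F x + F y)] (mod int p)"
      using xy g by (intro eqF) (auto simp: nat_pow_mult)
    then show "[int (F (x \<otimes> y)) = int (F x) + int (F y)] (mod int p)" by simp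
  qed
  have Fg: "F g = 1"
  proof -
    have "[int (F g) = int 1] (mod int p)" using g M by (intro eqF) (auto intro: subgroup.one_closed)
    then have "[F g = 1] (mod p)" unfolding cong_int_iff .
    then show ?thesis using cong_less_modulus_unique_nat F(1)[OF g(1)] prime_gt_1_nat[OF p] by blast
  qed
  have "[int (F n) = 0] (mod int p)" if "n \<in> N" for n
    using eqF[of n 0] that NS M by auto
  then show ?thesis using that[of "\<lambda>h. int (F h)"] padd Fg by simp
qed

end

section \<open>Additive characters modulo p\<close>

definition root_char :: "nat \<Rightarrow> int \<Rightarrow> complex" where
  "root_char p k = cis (2 * pi * real_of_int k / real p)"

lemma root_char_add: "root_char p (a + b) = root_char p a * root_char p b"
  by (simp add: root_char_def cis_mult add_divide_distrib distrib_left)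

lemma root_char_0 [simp]: "root_char p 0 = 1"
  by (simp add: root_char_def)

lemma root_char_nonzero [simp]: "root_char p k \<noteq> 0"
  by (simp add: root_char_def)

lemma root_char_mult_nat: "root_char p (of_nat n * k) = root_char p k ^ n"
  by (induction n) (simp_all add: root_char_add distrib_right)

lemma root_char_eq_1_iff: assumes "p > 0" shows "root_char p k = 1 \<longleftrightarrow> int p dvd k"
proof -
  have "root_char p k = 1 \<longleftrightarrow> (\<exists>n::int. 2 * pi * real_of_int k / real p = real_of_int n * (2 * pi))"
  proof
    assume "root_char p k = 1"
    then have "cos (2 * pi * real_of_int k / real p) = 1"
      by (auto simp: root_char_def complex_eq_iff)
    then obtain n :: int where "2 * pi * real_of_int k / real p = real_of_int n * 2 * pi"
      unfolding cos_one_2pi_int by auto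
    then show "\<exists>n::int. 2 * pi * real_of_int k / real p = real_of_int n * (2 * pi)" by (metis mult.assoc)
  next
    assume "\<exists>n::int. 2 * pi * real_of_int k / real p = real_of_int n * (2 * pi)"
    then obtain n :: int where n: "2 * pi * real_of_int k / real p = real_of_int n * (2 * pi)" ..
    have "cis (real_of_int n * (2 * pi)) = 1"
      by (rule complex_eqI) (use cos_int_2pin[of n] sin_int_2pin[of n] in \<open>simp_all add: mult_ac\<close>)
    then show "root_char p k = 1" using n by (simp add: root_char_def)
  qed
  also have "\<dots> \<longleftrightarrow> (\<exists>n::int. real_of_int k = real_of_int (int p * n))"
    using assms by (intro ex_cong1) (auto simp: field_simps)
  also have "\<dots> \<longleftrightarrow> int p dvd k" by (simp only: of_int_eq_iff dvd_def)
  finally show ?thesis .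
qed

lemma root_char_cong:
  assumes "p > 0" "[a = b] (mod int p)" shows "root_char p a = root_char p b"
proof -
  have "int p dvd a - b" using assms(2) by (simp add: cong_iff_dvd_diff)
  then have "root_char p (a - b) = 1" using root_char_eq_1_iff[OF assms(1)] by simp
  then show ?thesis using root_char_add[of p "a - b" b] by simp
qed

lemma root_char_power_p: "p > 0 \<Longrightarrow> root_char p k ^ p = 1"
  using root_char_mult_nat[of p p k] root_char_eq_1_iff[of p "int p * k"] by simp

lemma sum_root_char:
  assumes p: "p > 0"
  shows "(\<Sum>k\<in>{0..<int p}. root_char p (k * x)) = (if int p dvd x then of_nat p else 0)"
proof -
  have "(\<Sum>k\<in>{0..<int p}. root_char p (k * x)) = (\<Sum>k<p. root_char p (int k * x))"
    by (rule sum.reindex_bij_witness[of _ int nat]) auto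
  also have "\<dots> = (\<Sum>k<p. root_char p x ^ k)" by (simp add: root_char_mult_nat)
  also have "\<dots> = (if int p dvd x then of_nat p else 0)"
  proof (cases "int p dvd x")
    case True
    then show ?thesis using root_char_eq_1_iff[OF p, of x] by simp
  next
    case False
    then have "root_char p x \<noteq> 1" using root_char_eq_1_iff[OF p, of x] by simp
    then show ?thesis using False root_char_power_p[OF p, of x] by (simp add: geometric_sum)
  qed
  finally show ?thesis .
qed

lemma root_char_uminus: "root_char p (- a) = inverse (root_char p a)"
  using root_char_add[of p a "- a"] by (simp add: inverse_unique)

lemma root_char_sum: "finite I \<Longrightarrow> root_char p (\<Sum>i\<in>I. a i) = (\<Prod>i\<in>I. root_char p (a i))"
  by (induction I rule: finite_induct) (simp_all add: root_char_add)

section \<open>Characters, pairings and fibres in finite groups\<close>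

context group
begin

lemma subgroup_mult_bij:
  assumes S: "subgroup S G" and a: "a \<in> S"
  shows "bij_betw (\<lambda>x. a \<otimes> x) S S"
proof (rule bij_betwI)
  show "(\<lambda>x. inv a \<otimes> x) \<in> S \<rightarrow> S" "(\<lambda>x. a \<otimes> x) \<in> S \<rightarrow> S"
    using a by (auto intro: subgroup.m_closed[OF S] subgroup.m_inv_closed[OF S])
qed (use a subgroup.mem_carrier[OF S] in \<open>auto simp: inv_cancel_left\<close>)

lemma sum_character:
  fixes \<chi> :: "'a \<Rightarrow> 'c::field_char_0"
  assumes S: "subgroup S G" and mult: "\<And>x y. x \<in> S \<Longrightarrow> y \<in> S \<Longrightarrow> \<chi> (x \<otimes> y) = \<chi> x * \<chi> y"
    and a: "a \<in> S" "\<chi> a \<noteq> 1"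
  shows "(\<Sum>x\<in>S. \<chi> x) = 0"
proof -
  have "(\<Sum>x\<in>S. \<chi> x) = (\<Sum>x\<in>S. \<chi> (a \<otimes> x))"
    using sum.reindex_bij_betw[OF subgroup_mult_bij[OF S a(1)], of \<chi>] by simp
  also have "\<dots> = \<chi> a * (\<Sum>x\<in>S. \<chi> x)" using mult a by (simp add: sum_distrib_left)
  finally have "(1 - \<chi> a) * (\<Sum>x\<in>S. \<chi> x) = 0" by (simp add: algebra_simps)
  then show ?thesis using a by simp
qed

text \<open>Double count the sum of all \<open>b s t\<close>: summing over \<open>t\<close> leaves
  \<open>card T\<close> for each \<open>s\<close> in the left radical and 0 otherwise, and
  symmetrically for the other order. This is the duality of finite abelian groups modulo the
  radicals, in a form that avoids quotients.\<close>

lemma pairing_card: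
  fixes b :: "'a \<Rightarrow> 'a \<Rightarrow> complex"
  assumes S: "subgroup S G" "finite S" and T: "subgroup T G" "finite T"
    and l: "\<And>x y t. x \<in> S \<Longrightarrow> y \<in> S \<Longrightarrow> t \<in> T \<Longrightarrow> b (x \<otimes> y) t = b x t * b y t"
    and r: "\<And>s x y. s \<in> S \<Longrightarrow> x \<in> T \<Longrightarrow> y \<in> T \<Longrightarrow> b s (x \<otimes> y) = b s x * b s y"
  shows "card S * card {t \<in> T. \<forall>s\<in>S. b s t = 1} = card T * card {s \<in> S. \<forall>t\<in>T. b s t = 1}"
proof -
  have 1: "(\<Sum>t\<in>T. b s t) = (if \<forall>t\<in>T. b s t = 1 then of_nat (card T) else 0)" if "s \<in> S" for s
  proof (cases "\<forall>t\<in>T. b s t = 1")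
    case False
    then obtain a where "a \<in> T" "b s a \<noteq> 1" by auto
    then have "(\<Sum>t\<in>T. b s t) = 0" using r that by (intro sum_character[OF T(1)]) auto
    then show ?thesis unfolding if_not_P[OF False] .
  qed simp
  have 2: "(\<Sum>s\<in>S. b s t) = (if \<forall>s\<in>S. b s t = 1 then of_nat (card S) else 0)" if "t \<in> T" for t
  proof (cases "\<forall>s\<in>S. b s t = 1")
    case False
    then obtain a where "a \<in> S" "b a t \<noteq> 1" by auto
    then have "(\<Sum>s\<in>S. b s t) = 0" using l that by (intro sum_character[OF S(1)]) auto
    then show ?thesis unfolding if_not_P[OF False] .
  qed simp
  have "(\<Sum>s\<in>S. \<Sum>t\<in>T. b s t) = of_nat (card T * card {s \<in> S. \<forall>t\<in>T. b s t = 1})"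
    using sum.inter_filter[OF S(2), of "\<lambda>_. of_nat (card T) :: complex" "\<lambda>s. \<forall>t\<in>T. b s t = 1"]
    by (simp add: 1 mult.commute)
  moreover have "(\<Sum>t\<in>T. \<Sum>s\<in>S. b s t) = of_nat (card S * card {t \<in> T. \<forall>s\<in>S. b s t = 1})"
    using sum.inter_filter[OF T(2), of "\<lambda>_. of_nat (card S) :: complex" "\<lambda>t. \<forall>s\<in>S. b s t = 1"]
    by (simp add: 2 mult.commute)
  ultimately have "of_nat (card S * card {t \<in> T. \<forall>s\<in>S. b s t = 1}) =
    (of_nat (card T * card {s \<in> S. \<forall>t\<in>T. b s t = 1}) :: complex)"
    using sum.swap[of b T S] by simp
  then show ?thesis by (simp only: of_nat_eq_iff)
qed

text \<open>Stands in for the first isomorphism theorem: \<open>F\<close> may be any map whose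
  fibres are the left cosets of \<open>N\<close>.\<close>

lemma card_fibres:
  assumes S: "subgroup S G" "finite S" and N: "subgroup N G" "N \<subseteq> S"
    and ker: "\<And>g h. g \<in> S \<Longrightarrow> h \<in> S \<Longrightarrow> F g = F h \<longleftrightarrow> inv g \<otimes> h \<in> N"
  shows "card S = card (F ` S) * card N"
proof -
  have fib: "card {h \<in> S. F h = y} = card N" if y: "y \<in> F ` S" for y
  proof -
    obtain g where g: "g \<in> S" "y = F g" using y by auto
    note cl = subgroup.m_closed[OF S(1)] subgroup.m_inv_closed[OF S(1)] subgroup.mem_carrier[OF S(1)]
    have "{h \<in> S. F h = y} = (\<lambda>n. g \<otimes> n) ` N"
    proof (intro Set.set_eqI iffI)
      fix h assume "h \<in> {h \<in> S. F h = y}"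
      then have h: "h \<in> S" "inv g \<otimes> h \<in> N" using ker[OF g(1), of h] g by auto
      moreover have "h = g \<otimes> (inv g \<otimes> h)" using h g cl by (simp add: inv_cancel_left)
      ultimately show "h \<in> (\<lambda>n. g \<otimes> n) ` N" by blast
    next
      fix h assume "h \<in> (\<lambda>n. g \<otimes> n) ` N"
      then obtain n where n: "n \<in> N" "h = g \<otimes> n" by auto
      then have "n \<in> S" using N by auto
      then have "inv g \<otimes> h = n" "h \<in> S" using n g cl by (simp_all add: inv_cancel_left)
      then show "h \<in> {h \<in> S. F h = y}" using ker[OF g(1), of h] g n by auto
    qed
    moreover have "inj_on (\<lambda>n. g \<otimes> n) N"
    proof (rule inj_onI)
      fix x y assume "x \<in> N" "y \<in> N" "g \<otimes> x = g \<otimes> y"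
      then show "x = y" using g cl(3) N subgroup.mem_carrier[OF N(1)] by simp
    qed
    ultimately show ?thesis by (simp add: card_image)
  qed
  have "card S = (\<Sum>y\<in>F ` S. card {h \<in> S. F h = y})"
    using sum.group[of S "F ` S" F "\<lambda>_. 1::nat"] S(2) by simp
  also have "\<dots> = card (F ` S) * card N" using fib by simp
  finally show ?thesis .
qed

lemma padd_one: assumes "padd p G S f" "subgroup S G" shows "[f \<one> = 0] (mod int p)"
proof -
  have "[f \<one> = f \<one> + f \<one>] (mod int p)"
    using assms subgroup.one_closed[OF assms(2)] unfolding padd_def by fastforce
  then show ?thesis by (simp add: cong_iff_dvd_diff)
qed

lemma padd_pow: assumes f: "padd p G S f" and S: "subgroup S G" and x: "x \<in> S"
  shows "[f (x [^] (n::nat)) = int n * f x] (mod int p)"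
proof (induction n)
  case 0 then show ?case using padd_one[OF f S] by simp
next
  case (Suc n)
  have "x [^] n \<in> S"
    by (induction n) (use x in \<open>auto intro: subgroup.one_closed[OF S] subgroup.m_closed[OF S]\<close>)
  then have "[f (x [^] n \<otimes> x) = f (x [^] n) + f x] (mod int p)" using f x unfolding padd_def by blast
  also have "[f (x [^] n) + f x = int n * f x + f x] (mod int p)" using Suc by (intro cong_add) auto
  finally show ?case by (simp add: algebra_simps)
qed

lemma padd_inv: assumes f: "padd p G S f" and S: "subgroup S G" and x: "x \<in> S"
  shows "[f (inv x) = - f x] (mod int p)"
proof -
  have "[f (inv x \<otimes> x) = f (inv x) + f x] (mod int p)"
    using f x subgroup.m_inv_closed[OF S x] unfolding padd_def by blast
  then have "[f (inv x) + f x = 0] (mod int p)"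
    using x S padd_one[OF f S] cong_trans cong_sym by (metis l_inv subgroup.mem_carrier)
  then have "[f (inv x) + f x - f x = 0 - f x] (mod int p)" by (intro cong_diff) auto
  then show ?thesis by simp
qed

lemma padd_diff: assumes f: "padd p G S f" and S: "subgroup S G" and x: "x \<in> S" "y \<in> S"
  shows "[f (inv x \<otimes> y) = f y - f x] (mod int p)"
proof -
  have "[f (inv x \<otimes> y) = f (inv x) + f y] (mod int p)"
    using f x subgroup.m_inv_closed[OF S] unfolding padd_def by blast
  also have "[f (inv x) + f y = - f x + f y] (mod int p)" using padd_inv[OF f S x(1)] by (intro cong_add) auto
  finally show ?thesis by simp
qed

end

context elementary_section
begin

text \<open>A partial basis of \<open>S\<close> modulo \<open>N\<close> together with functionals
  dual to it modulo \<open>p\<close>. Demanding duality from the start makes independence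
  automatic.\<close>

definition dual_system :: "nat \<Rightarrow> (nat \<Rightarrow> 'a) \<Rightarrow> (nat \<Rightarrow> 'a \<Rightarrow> int) \<Rightarrow> bool" where
  "dual_system m e x \<longleftrightarrow> (\<forall>i<m. e i \<in> S \<and> padd p G S (x i) \<and> (\<forall>n\<in>N. [x i n = 0] (mod int p)) \<and>
     (\<forall>j<m. [x i (e j) = of_bool (i = j)] (mod int p)))"

lemma dual_system_element:
  assumes ds: "dual_system m e x"
  shows "\<exists>g\<in>S. (\<forall>f. padd p G S f \<longrightarrow> [f g = (\<Sum>i<m. int (k i) * f (e i))] (mod int p)) \<and>
    (\<forall>i<m. [x i g = int (k i)] (mod int p))"
proof -
  have "\<exists>g\<in>S. \<forall>f. padd p G S f \<longrightarrow> [f g = (\<Sum>i<j. int (k i) * f (e i))] (mod int p)" if "j \<le> m" for j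
    using that
  proof (induction j)
    case 0
    then show ?case using padd_one[OF _ S] by (intro bexI[of _ \<one>]) auto
  next
    case (Suc j)
    then obtain g where g: "g \<in> S" "\<And>f. padd p G S f \<Longrightarrow> [f g = (\<Sum>i<j. int (k i) * f (e i))] (mod int p)" by auto
    have ej: "e j \<in> S" using ds Suc by (auto simp: dual_system_def)
    have "[f (g \<otimes> e j [^] k j) = (\<Sum>i<Suc j. int (k i) * f (e i))] (mod int p)" if f: "padd p G S f" for f
    proof -
      have "[f (g \<otimes> e j [^] k j) = f g + f (e j [^] k j)] (mod int p)"
        using f g ej unfolding padd_def by simp
      also have "[f g + f (e j [^] k j) = (\<Sum>i<j. int (k i) * f (e i)) + int (k j) * f (e j)] (mod int p)"
        using g(2)[OF f] padd_pow[OF f S ej] by (rule cong_add)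
      finally show ?thesis by simp
    qed
    then show ?case using g ej by (intro bexI[of _ "g \<otimes> e j [^] k j"]) auto
  qed
  then obtain g where g: "g \<in> S" "\<And>f. padd p G S f \<Longrightarrow> [f g = (\<Sum>i<m. int (k i) * f (e i))] (mod int p)" by blast
  have "[x i g = int (k i)] (mod int p)" if i: "i < m" for i
  proof -
    have "[x i g = (\<Sum>j<m. int (k j) * x i (e j))] (mod int p)" using ds i by (intro g) (auto simp: dual_system_def)
    also have "[(\<Sum>j<m. int (k j) * x i (e j)) = (\<Sum>j<m. int (k j) * of_bool (i = j))] (mod int p)"
      using ds i by (intro cong_sum cong_mult) (auto simp: dual_system_def)
    also have "(\<Sum>j<m. int (k j) * of_bool (i = j)) = (\<Sum>j<m. if j = i then int (k j) else 0)"
      by (intro sum.cong) auto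
    also have "\<dots> = int (k i)" using i by simp
    finally show ?thesis .
  qed
  with g show ?thesis by blast
qed

definition coords :: "nat \<Rightarrow> (nat \<Rightarrow> 'a \<Rightarrow> int) \<Rightarrow> 'a \<Rightarrow> nat \<Rightarrow> int" where
  "coords m x g = (\<lambda>i\<in>{..<m}. x i g mod int p)"

lemma coords_image:
  assumes ds: "dual_system m e x"
  shows "coords m x ` S = {..<m} \<rightarrow>\<^sub>E {0..<int p}"
proof
  have p0: "int p > 0" using prime_gt_0_nat[OF p] by simp
  show "coords m x ` S \<subseteq> {..<m} \<rightarrow>\<^sub>E {0..<int p}"
    unfolding coords_def using p0 by (intro image_subsetI restrict_PiE_iff[THEN iffD2]) auto
  show "{..<m} \<rightarrow>\<^sub>E {0..<int p} \<subseteq> coords m x ` S"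
  proof
    fix k assume k: "k \<in> {..<m} \<rightarrow>\<^sub>E {0..<int p}"
    obtain g where g0: "g \<in> S" "(\<forall>f. padd p G S f \<longrightarrow> [f g = (\<Sum>i<m. int (nat (k i)) * f (e i))] (mod int p)) \<and>
        (\<forall>i<m. [x i g = int (nat (k i))] (mod int p))"
      using dual_system_element[OF ds, of "\<lambda>i. nat (k i)"] by (rule bexE)
    then have g: "[x i g = int (nat (k i))] (mod int p)" if "i < m" for i using that by simp
    have "coords m x g = k"
    proof (rule ext)
      fix i show "coords m x g i = k i"
      proof (cases "i < m")
        case True
        have "k i \<in> {0..<int p}" using k True by (rule PiE_mem[OF _ lessThan_iff[THEN iffD2]])
        then have ki: "0 \<le> k i" "k i < int p" by simp_all
        have "x i g mod int p = k i mod int p" using g[OF True] ki(1) unfolding cong_def by simp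
        also have "\<dots> = k i" using ki by (rule mod_pos_pos_trivial)
        finally show ?thesis using True unfolding coords_def by simp
      next
        case False
        then show ?thesis using PiE_arb[OF k, of i] unfolding coords_def by simp
      qed
    qed
    then show "k \<in> coords m x ` S" using g0(1) by auto
  qed
qed

text \<open>The size of a dual system is bounded, since all \<open>p ^ m\<close> coordinate vectors
  occur. A largest one separates the elements of \<open>S\<close> outside \<open>N\<close> from
  \<open>N\<close>: an element outside \<open>N\<close> at which all coordinates vanish would extend
  it.\<close>

lemma exists_coordinates:
  "\<exists>m e x. dual_system m e x \<and> (\<forall>g\<in>S. (\<forall>i<m. [x i g = 0] (mod int p)) \<longrightarrow> g \<in> N)"
proof -
  let ?P = "\<lambda>m. \<exists>e x. dual_system m e x"
  have "?P 0" by (auto simp: dual_system_def)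
  moreover have "m \<le> card S" if m: "?P m" for m
  proof -
    obtain e x where ds: "dual_system m e x" using m by auto
    have "m < p ^ m" using prime_gt_1_nat[OF p] by (simp add: power_gt_expt)
    also have "p ^ m = card (coords m x ` S)" unfolding coords_image[OF ds] by (simp add: card_PiE)
    also have "\<dots> \<le> card S" using finS by (rule card_image_le)
    finally show ?thesis by simp
  qed
  ultimately obtain m where m: "?P m" "\<And>m'. ?P m' \<Longrightarrow> m' \<le> m"
    using ex_has_greatest_nat[of ?P 0 "\<lambda>m. m" "Suc (card S)"] by (auto simp: less_Suc_eq_le)
  then obtain e x where ds: "dual_system m e x" by auto
  have "g \<in> N" if g: "g \<in> S" "\<And>i. i < m \<Longrightarrow> [x i g = 0] (mod int p)" for g
  proof (rule ccontr)
    assume gN: "g \<notin> N"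
    obtain f where f: "padd p G S f" "\<And>n. n \<in> N \<Longrightarrow> [f n = 0] (mod int p)" "f g = 1"
      using exists_functional[OF g(1) gN] by blast
    \<comment> \<open>A functional with \<open>f g = 1\<close> is corrected by its values on the old
      basis, so that it vanishes there; the old functionals vanish at \<open>g\<close> by
      assumption.\<close>
    define x' where "x' = (\<lambda>i. if i = m then (\<lambda>h. f h - (\<Sum>j<m. f (e j) * x j h)) else x i)"
    define e' where "e' = (\<lambda>i. if i = m then g else e i)"
    have xs: "\<And>i. i < m \<Longrightarrow> padd p G S (x i)" "\<And>i n. i < m \<Longrightarrow> n \<in> N \<Longrightarrow> [x i n = 0] (mod int p)"
      "\<And>i j. i < m \<Longrightarrow> j < m \<Longrightarrow> [x i (e j) = of_bool (i = j)] (mod int p)" "\<And>i. i < m \<Longrightarrow> e i \<in> S"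
      using ds by (auto simp: dual_system_def)
    have 1: "padd p G S (x' m)"
      unfolding padd_def
    proof (intro ballI)
      fix a b assume ab: "a \<in> S" "b \<in> S"
      have "[f (a \<otimes> b) - (\<Sum>j<m. f (e j) * x j (a \<otimes> b)) = (f a + f b) - (\<Sum>j<m. f (e j) * (x j a + x j b))] (mod int p)"
        using f(1) xs(1) ab by (intro cong_diff cong_sum cong_mult) (auto simp: padd_def)
      also have "(f a + f b) - (\<Sum>j<m. f (e j) * (x j a + x j b)) = x' m a + x' m b"
        by (simp add: x'_def sum.distrib algebra_simps)
      finally show "[x' m (a \<otimes> b) = x' m a + x' m b] (mod int p)" by (simp add: x'_def)
    qed
    have 2: "[x' m n = 0] (mod int p)" if n: "n \<in> N" for n
    proof -
      have "[f n - (\<Sum>j<m. f (e j) * x j n) = 0 - (\<Sum>j<m. f (e j) * 0)] (mod int p)"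
        using f(2)[OF n] xs(2)[OF _ n] by (intro cong_diff cong_sum cong_mult) auto
      then show ?thesis by (simp add: x'_def)
    qed
    have 3: "[x' m (e i) = 0] (mod int p)" if i: "i < m" for i
    proof -
      have "[f (e i) - (\<Sum>j<m. f (e j) * x j (e i)) = f (e i) - (\<Sum>j<m. f (e j) * of_bool (j = i))] (mod int p)"
        using xs(3) i by (intro cong_diff cong_sum cong_mult) auto
      also have "(\<Sum>j<m. f (e j) * of_bool (j = i)) = (\<Sum>j<m. if j = i then f (e j) else 0)"
        by (intro sum.cong) auto
      also have "f (e i) - \<dots> = 0" using i by simp
      finally show ?thesis by (simp add: x'_def)
    qed
    have 4: "[x' m g = 1] (mod int p)"
    proof -
      have "[f g - (\<Sum>j<m. f (e j) * x j g) = f g - (\<Sum>j<m. f (e j) * 0)] (mod int p)"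
        using g(2) by (intro cong_diff cong_sum cong_mult) auto
      then show ?thesis using f(3) by (simp add: x'_def)
    qed
    have "dual_system (Suc m) e' x'"
      unfolding dual_system_def less_Suc_eq
      using 1 2 3 4 xs g by (auto simp: e'_def x'_def[of ] simp del: of_bool_eq_iff split: if_splits)
    then have "?P (Suc m)" by blast
    then show False using m(2)[of "Suc m"] by simp
  qed
  then show ?thesis by (intro exI conjI ballI impI) (rule ds, simp)
qed

lemma card_eq_coordinates:
  assumes ds: "dual_system m e x"
    and ker: "\<And>g. g \<in> S \<Longrightarrow> (\<And>i. i < m \<Longrightarrow> [x i g = 0] (mod int p)) \<Longrightarrow> g \<in> N"
  shows "card S = p ^ m * card N"
proof -
  have "card S = card (coords m x ` S) * card N"
  proof (rule card_fibres[OF S finS N NS])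
    fix g h assume gh: "g \<in> S" "h \<in> S"
    have xs: "\<And>i. i < m \<Longrightarrow> padd p G S (x i)" "\<And>i n. i < m \<Longrightarrow> n \<in> N \<Longrightarrow> [x i n = 0] (mod int p)"
      using ds by (auto simp: dual_system_def)
    have e: "[x i g = x i h] (mod int p) \<longleftrightarrow> [x i (inv g \<otimes> h) = 0] (mod int p)" if i: "i < m" for i
    proof -
      have d: "[x i (inv g \<otimes> h) = x i h - x i g] (mod int p)" by (rule padd_diff[OF xs(1)[OF i] S gh])
      show ?thesis
      proof
        assume "[x i g = x i h] (mod int p)"
        then have "[x i h - x i g = 0] (mod int p)"
          using cong_diff[OF cong_refl[of "x i h" "int p"], of "x i g" "x i h"] by simp
        with d show "[x i (inv g \<otimes> h) = 0] (mod int p)" by (rule cong_trans)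
      next
        assume "[x i (inv g \<otimes> h) = 0] (mod int p)"
        with cong_sym[OF d] have "[x i h - x i g = 0] (mod int p)" by (rule cong_trans)
        then have "[x i h = x i g] (mod int p)" by (simp add: cong_iff_dvd_diff)
        then show "[x i g = x i h] (mod int p)" by (rule cong_sym)
      qed
    qed
    have "coords m x g = coords m x h \<longleftrightarrow> (\<forall>i<m. [x i g = x i h] (mod int p))"
      by (auto simp: coords_def restrict_def fun_eq_iff cong_def)
    also have "\<dots> \<longleftrightarrow> (\<forall>i<m. [x i (inv g \<otimes> h) = 0] (mod int p))"
      using e by auto
    also have "\<dots> \<longleftrightarrow> inv g \<otimes> h \<in> N" using ker[of "inv g \<otimes> h"] xs(2) gh by auto
    finally show "coords m x g = coords m x h \<longleftrightarrow> inv g \<otimes> h \<in> N" .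
  qed
  then show ?thesis unfolding coords_image[OF ds] by (simp add: card_PiE)
qed

text \<open>A product of powers of the \<open>e i\<close> with the same coordinates as
  \<open>g\<close> differs from \<open>g\<close> by an element of \<open>N\<close>, which
  \<open>f\<close> kills.\<close>

lemma padd_expand:
  assumes ds: "dual_system m e x"
    and ker: "\<And>g. g \<in> S \<Longrightarrow> (\<And>i. i < m \<Longrightarrow> [x i g = 0] (mod int p)) \<Longrightarrow> g \<in> N"
    and f: "padd p G S f" "\<And>n. n \<in> N \<Longrightarrow> [f n = 0] (mod int p)" and g: "g \<in> S"
  shows "[f g = (\<Sum>i<m. f (e i) * x i g)] (mod int p)"
proof -
  have p0: "int p > 0" using prime_gt_0_nat[OF p] by simp
  define k where "k i = nat (x i g mod int p)" for i
  have k: "[int (k i) = x i g] (mod int p)" for i using p0 by (simp add: k_def)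
  obtain h where "h \<in> S" "(\<forall>f. padd p G S f \<longrightarrow> [f h = (\<Sum>i<m. int (k i) * f (e i))] (mod int p)) \<and>
    (\<forall>i<m. [x i h = int (k i)] (mod int p))"
    by (rule bexE[OF dual_system_element[OF ds, of k]])
  then have h: "h \<in> S" "\<And>f. padd p G S f \<Longrightarrow> [f h = (\<Sum>i<m. int (k i) * f (e i))] (mod int p)"
    "\<And>i. i < m \<Longrightarrow> [x i h = int (k i)] (mod int p)"
    by simp_all
  have xs: "\<And>i. i < m \<Longrightarrow> padd p G S (x i)" using ds by (auto simp: dual_system_def)
  have "inv h \<otimes> g \<in> N"
  proof (rule ker)
    fix i assume i: "i < m"
    have "[x i (inv h \<otimes> g) = x i g - x i h] (mod int p)" by (rule padd_diff[OF xs[OF i] S h(1) g])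
    also have "[x i g - x i h = x i g - x i g] (mod int p)"
      by (rule cong_diff[OF cong_refl cong_trans[OF h(3)[OF i] k[of i]]])
    finally show "[x i (inv h \<otimes> g) = 0] (mod int p)" by simp
  qed (use h g in simp)
  then have "[f (inv h \<otimes> g) = 0] (mod int p)" by (rule f)
  then have "[f g - f h = 0] (mod int p)" by (rule cong_trans[OF cong_sym[OF padd_diff[OF f(1) S h(1) g]]])
  then have "[f g = f h] (mod int p)" by (simp add: cong_iff_dvd_diff)
  also have "[f h = (\<Sum>i<m. int (k i) * f (e i))] (mod int p)" by (rule h) (rule f)
  also have "[(\<Sum>i<m. int (k i) * f (e i)) = (\<Sum>i<m. x i g * f (e i))] (mod int p)"
    using k by (intro cong_sum cong_mult) auto
  finally show ?thesis by (simp add: mult.commute)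
qed

end

section \<open>Camina groups of class three\<close>

text \<open>\<open>D\<close> and \<open>U\<close> are the second and third terms of the lower central series.\<close>

locale camina3 = group +
  fixes p :: nat and D U :: "'a set"
  assumes p: "prime p" and fin: "finite (carrier G)" and ord: "\<exists>n. card (carrier G) = p ^ n"
    and D: "subgroup D G" and U: "subgroup U G" and UD: "U \<subseteq> D"
    and comm_D: "x \<in> carrier G \<Longrightarrow> y \<in> carrier G \<Longrightarrow> comm x y \<in> D"
    and comm_U: "c \<in> D \<Longrightarrow> g \<in> carrier G \<Longrightarrow> comm c g \<in> U"
    and U_central: "u \<in> U \<Longrightarrow> g \<in> carrier G \<Longrightarrow> u \<otimes> g = g \<otimes> u"
    and U_gen: "U = generate G {comm c g | c g. c \<in> D \<and> g \<in> carrier G}"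
    and camina: "g \<in> carrier G \<Longrightarrow> g \<notin> D \<Longrightarrow> d \<in> D \<Longrightarrow> \<exists>y\<in>carrier G. comm g y = d"
    and U_nontrivial: "U \<noteq> {\<one>}" and D_proper: "\<exists>g\<in>carrier G. g \<notin> D"
begin

lemma DG [simp]: "x \<in> D \<Longrightarrow> x \<in> carrier G" by (rule subgroup.mem_carrier[OF D])
lemma UDm [simp]: "x \<in> U \<Longrightarrow> x \<in> D" using UD by (rule subsetD)
lemma UG [simp]: "x \<in> U \<Longrightarrow> x \<in> carrier G" by (rule subgroup.mem_carrier[OF U])
lemmas D_closed [simp] = subgroup.m_closed[OF D] subgroup.one_closed[OF D] subgroup.m_inv_closed[OF D]
lemmas U_closed [simp] = subgroup.m_closed[OF U] subgroup.one_closed[OF U] subgroup.m_inv_closed[OF U]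

lemma D_pow [simp]: "x \<in> D \<Longrightarrow> x [^] (n::nat) \<in> D" by (induction n) auto
lemma U_pow [simp]: "x \<in> U \<Longrightarrow> x [^] (n::nat) \<in> U" by (induction n) auto

lemma finD [simp]: "finite D" by (rule finite_subset[OF subgroup.subset[OF D] fin])
lemma finU [simp]: "finite U" by (rule finite_subset[OF subgroup.subset[OF U] fin])

lemma comm_U_right [simp]: "c \<in> D \<Longrightarrow> g \<in> carrier G \<Longrightarrow> comm g c \<in> U"
  using comm_U[of c g] inv_comm[of c g] U_closed(3)[of "comm c g"] by simp

lemma comm_central [simp]: "u \<in> U \<Longrightarrow> g \<in> carrier G \<Longrightarrow> comm u g = \<one>" "u \<in> U \<Longrightarrow> g \<in> carrier G \<Longrightarrow> comm g u = \<one>"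
  using U_central by (simp_all add: comm_one_iff)

lemma comm_mult_D_left:
  "c \<in> D \<Longrightarrow> c' \<in> D \<Longrightarrow> g \<in> carrier G \<Longrightarrow> comm (c \<otimes> c') g = comm c g \<otimes> comm c' g"
  using U_central[of "comm c' g" "comm c g"] by (simp add: comm_mult_left comm_U comm_central)

lemma comm_mult_D_right:
  "c \<in> D \<Longrightarrow> g \<in> carrier G \<Longrightarrow> g' \<in> carrier G \<Longrightarrow> comm c (g \<otimes> g') = comm c g \<otimes> comm c g'"
  by (simp add: comm_mult_right comm_U comm_central)

lemma comm_inv_D: "c \<in> D \<Longrightarrow> g \<in> carrier G \<Longrightarrow> comm c (inv g) = inv (comm c g)"
proof -
  assume a: "c \<in> D" "g \<in> carrier G"
  then have "comm c (inv g) \<otimes> comm c g = \<one>" using comm_mult_D_right[of c "inv g" g] by simp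
  then show ?thesis using a by (intro inv_equality[symmetric]) auto
qed

lemma D_comm: assumes "d \<in> D" obtains g y where "g \<in> carrier G" "g \<notin> D" "y \<in> carrier G" "d = comm g y"
  using D_proper camina[OF _ _ assms] by metis

text \<open>Any \<open>d\<close> in \<open>D\<close> is a commutator of some \<open>x\<close> and
  \<open>y\<close>. Commutation with a fixed \<open>c\<close> in \<open>D\<close> is a homomorphism
  into the central, hence abelian, subgroup \<open>U\<close>, so it kills commutators.\<close>

lemma D_abelian: assumes "c \<in> D" "d \<in> D" shows "c \<otimes> d = d \<otimes> c"
proof -
  obtain x y where xy: "x \<in> carrier G" "y \<in> carrier G" "d = comm x y" using D_comm[OF assms(2)] by metis
  let ?a = "comm c x" and ?b = "comm c y"
  have ab: "?a \<in> U" "?b \<in> U" using assms xy comm_U by auto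
  have "comm c d = ?a \<otimes> ?b \<otimes> inv ?a \<otimes> inv ?b"
    unfolding xy(3) comm_def[of x y] using assms xy by (simp add: comm_mult_D_right comm_inv_D)
  also have "\<dots> = \<one>" using ab U_central[of ?a ?b] comm_central[of ?a ?b] by (simp add: comm_def)
  finally show ?thesis using assms by (simp add: comm_one_iff)
qed

lemma comm_D_D [simp]: "c \<in> D \<Longrightarrow> d \<in> D \<Longrightarrow> comm c d = \<one>"
  using D_abelian by (simp add: comm_one_iff)

lemma comm_pow_D_left: "c \<in> D \<Longrightarrow> g \<in> carrier G \<Longrightarrow> comm (c [^] (n::nat)) g = comm c g [^] n"
  by (induction n) (simp_all add: comm_mult_D_left)

lemma comm_pow_D_right: "c \<in> D \<Longrightarrow> g \<in> carrier G \<Longrightarrow> comm g c [^] (n::nat) = comm (g [^] n) c"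
proof (induction n)
  case (Suc n)
  have "comm (g [^] n \<otimes> g) c = comm (g [^] n) (comm g c) \<otimes> comm g c \<otimes> comm (g [^] n) c"
    using Suc.prems by (intro comm_mult_left) auto
  also have "\<dots> = comm (g [^] n) c \<otimes> comm g c"
    using Suc.prems U_central[of "comm g c" "comm (g [^] n) c"] by simp
  finally show ?case using Suc by simp
qed simp

lemma D_not_U: "\<exists>d\<in>D. d \<notin> U"
proof (rule ccontr)
  assume "\<not> ?thesis"
  then have "{comm c g |c g. c \<in> D \<and> g \<in> carrier G} \<subseteq> {\<one>}" using comm_central(1) by auto
  then have "generate G {comm c g |c g. c \<in> D \<and> g \<in> carrier G} \<subseteq> {\<one>}"
    by (rule generate_subgroup_incl[OF _ triv_subgroup])
  then show False using U_nontrivial U_closed(2) U_gen by blast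
qed

lemma comm_pow_mod_U:
  assumes "x \<in> carrier G" "y \<in> carrier G"
  shows "\<exists>u\<in>U. comm (x [^] (n::nat)) y = u \<otimes> comm x y [^] n"
proof (induction n)
  case 0
  then show ?case using assms by (intro bexI[of _ \<one>]) auto
next
  case (Suc n)
  then obtain u where u: "u \<in> U" "comm (x [^] n) y = u \<otimes> comm x y [^] n" by blast
  let ?c = "comm x y" and ?v = "comm (x [^] n) (comm x y)"
  have c: "?c \<in> D" using comm_D assms by blast
  have v: "?v \<in> U" using c assms by simp
  have "comm (x [^] n \<otimes> x) y = ?v \<otimes> ?c \<otimes> comm (x [^] n) y" using assms by (intro comm_mult_left) auto
  also have "\<dots> = ?v \<otimes> (?c \<otimes> u) \<otimes> ?c [^] n" using u c v assms by (simp add: m_assoc)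
  also have "?c \<otimes> u = u \<otimes> ?c" using U_central[OF u(1)] c by simp
  also have "?v \<otimes> (u \<otimes> ?c) \<otimes> ?c [^] n = (?v \<otimes> u) \<otimes> (?c \<otimes> ?c [^] n)" using u c v assms by (simp add: m_assoc)
  also have "?c \<otimes> ?c [^] n = ?c [^] Suc n" using assms by (metis nat_pow_Suc2 comm_closed)
  finally show ?case using u v by (intro bexI[of _ "?v \<otimes> u"]) auto
qed

text \<open>If \<open>x [^] p\<close> were outside \<open>D\<close>, its commutators would fill
  \<open>D\<close>, while each of them is a \<open>p\<close>-th power of an element of
  \<open>D\<close> up to \<open>U\<close>. Iterating, every element of \<open>D\<close> is a
  \<open>p ^ n\<close>-th power up to \<open>U\<close>, and with \<open>p ^ n\<close> the order of
  \<open>G\<close> this puts \<open>D\<close> inside \<open>U\<close>.\<close>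

lemma pow_p_D: assumes x: "x \<in> carrier G" shows "x [^] p \<in> D"
proof (rule ccontr)
  assume n: "x [^] p \<notin> D"
  have step: "\<exists>c\<in>D. \<exists>u\<in>U. d = u \<otimes> c [^] p" if d: "d \<in> D" for d
  proof -
    obtain y where y: "y \<in> carrier G" "comm (x [^] p) y = d" using camina[OF _ n d] x by auto
    then show ?thesis using comm_pow_mod_U[OF x y(1), of p] comm_D[OF x y(1)] by metis
  qed
  have all: "\<exists>c\<in>D. \<exists>u\<in>U. d = u \<otimes> c [^] (p ^ k)" if "d \<in> D" for d k
    using that
  proof (induction k arbitrary: d)
    case 0
    then show ?case by (intro bexI[of _ d] bexI[of _ \<one>]) auto
  next
    case (Suc k)
    obtain c u where c: "c \<in> D" "u \<in> U" "d = u \<otimes> c [^] p" using step[OF Suc.prems] by blast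
    obtain c' u' where c': "c' \<in> D" "u' \<in> U" "c = u' \<otimes> c' [^] (p ^ k)" using Suc.IH[OF c(1)] by blast
    have "c [^] p = u' [^] p \<otimes> (c' [^] (p ^ k)) [^] p"
      unfolding c'(3) using c' U_central[of u' "c' [^] (p ^ k)"] by (intro pow_mult_distrib) auto
    then have "d = (u \<otimes> u' [^] p) \<otimes> c' [^] (p ^ Suc k)"
      using c c' by (simp add: m_assoc nat_pow_pow mult.commute)
    then show ?case using c c' by (intro bexI[of _ c'] bexI[of _ "u \<otimes> u' [^] p"]) auto
  qed
  obtain n where n: "card (carrier G) = p ^ n" using ord by blast
  obtain d where d: "d \<in> D" "d \<notin> U" using D_not_U by blast
  obtain c u where c: "c \<in> D" "u \<in> U" "d = u \<otimes> c [^] (p ^ n)" using all[OF d(1)] by blast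
  have "c [^] (p ^ n) = \<one>" using pow_order_eq_1[of c] c n by (simp add: Coset.order_def)
  then show False using c d by simp
qed

text \<open>With \<open>d = comm g y\<close>, the power \<open>d [^] p\<close> agrees modulo
  \<open>U\<close> with \<open>comm (g [^] p) y\<close>, and \<open>g [^] p\<close> lies in
  \<open>D\<close>.\<close>

lemma pow_p_U: assumes d: "d \<in> D" shows "d [^] p \<in> U"
proof -
  obtain g y where g: "g \<in> carrier G" "y \<in> carrier G" "d = comm g y" using D_comm[OF d] by metis
  obtain u where u: "u \<in> U" "comm (g [^] p) y = u \<otimes> d [^] p" using comm_pow_mod_U[OF g(1,2), of p] g by blast
  have "comm (g [^] p) y \<in> U" using pow_p_D[OF g(1)] g comm_U by blast
  then have "inv u \<otimes> (u \<otimes> d [^] p) \<in> U" using u by simp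
  then show ?thesis using u d by (simp add: inv_cancel_left)
qed

text \<open>On generators, \<open>comm c g [^] p = comm (c [^] p) g\<close>, which is trivial
  because \<open>c [^] p\<close> is central.\<close>

lemma pow_p_one: assumes "u \<in> U" shows "u [^] p = \<one>"
proof -
  let ?H = "{u \<in> U. u [^] p = \<one>}"
  have H: "subgroup ?H G"
  proof (rule finite_subgroupI)
    fix x y assume xy: "x \<in> ?H" "y \<in> ?H"
    then have "(x \<otimes> y) [^] p = x [^] p \<otimes> y [^] p" using U_central[of x y] by (intro pow_mult_distrib) auto
    then show "x \<otimes> y \<in> ?H" using xy by simp
  next
    have "\<one> \<in> ?H" by simp
    then show "?H \<noteq> {}" by blast
  qed auto
  have "{comm c g |c g. c \<in> D \<and> g \<in> carrier G} \<subseteq> ?H"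
    using pow_p_U comm_U by (auto simp flip: comm_pow_D_left)
  then have "generate G {comm c g |c g. c \<in> D \<and> g \<in> carrier G} \<subseteq> ?H" using H by (rule generate_subgroup_incl)
  then show ?thesis using assms U_gen by blast
qed

sublocale GD: elementary_section G "carrier G" D p
  by unfold_locales (use subgroup_self D p fin comm_D pow_p_D in auto)

sublocale DU: elementary_section G D U p
  by unfold_locales (use U D UD p pow_p_U in auto)

sublocale U1: elementary_section G U "{\<one>}" p
  by unfold_locales (use U triv_subgroup p pow_p_one in auto)

lemma padd_mult3:
  assumes "padd p G D \<phi>" "\<And>u. u \<in> U \<Longrightarrow> [\<phi> u = 0] (mod int p)" "u \<in> U" "a \<in> D" "b \<in> D"
  shows "[\<phi> (u \<otimes> a \<otimes> b) = \<phi> a + \<phi> b] (mod int p)" "[\<phi> (a \<otimes> u \<otimes> b) = \<phi> a + \<phi> b] (mod int p)"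
proof -
  have ad: "[\<phi> (x \<otimes> y) = \<phi> x + \<phi> y] (mod int p)" if "x \<in> D" "y \<in> D" for x y
    using assms(1) that unfolding padd_def by simp
  have "[\<phi> (u \<otimes> a) = 0 + \<phi> a] (mod int p)"
    by (rule cong_trans[OF ad cong_add[OF assms(2) cong_refl]]) (use assms in auto)
  then have "[\<phi> (u \<otimes> a) + \<phi> b = 0 + \<phi> a + \<phi> b] (mod int p)" by (rule cong_add[OF _ cong_refl])
  moreover have "[\<phi> (u \<otimes> a \<otimes> b) = \<phi> (u \<otimes> a) + \<phi> b] (mod int p)" by (rule ad) (use assms in auto)
  ultimately show 1: "[\<phi> (u \<otimes> a \<otimes> b) = \<phi> a + \<phi> b] (mod int p)" using cong_trans by fastforce
  have "a \<otimes> u = u \<otimes> a" using U_central[of u a] assms by simp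
  then show "[\<phi> (a \<otimes> u \<otimes> b) = \<phi> a + \<phi> b] (mod int p)" using 1 by simp
qed

lemma padd_comm:
  assumes "padd p G D \<phi>" "\<And>u. u \<in> U \<Longrightarrow> [\<phi> u = 0] (mod int p)" "g \<in> carrier G"
  shows "padd p G (carrier G) (\<lambda>z. \<phi> (comm z g))" "padd p G (carrier G) (\<lambda>z. \<phi> (comm g z))"
proof -
  show "padd p G (carrier G) (\<lambda>z. \<phi> (comm z g))"
    unfolding padd_def
  proof (intro ballI)
    fix x y assume xy: "x \<in> carrier G" "y \<in> carrier G"
    have "[\<phi> (comm x (comm y g) \<otimes> comm y g \<otimes> comm x g) = \<phi> (comm y g) + \<phi> (comm x g)] (mod int p)"
      by (rule padd_mult3) (use assms xy comm_D in auto)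
    then show "[\<phi> (comm (x \<otimes> y) g) = \<phi> (comm x g) + \<phi> (comm y g)] (mod int p)"
      using assms xy by (simp add: comm_mult_left add.commute)
  qed
  show "padd p G (carrier G) (\<lambda>z. \<phi> (comm g z))"
    unfolding padd_def
  proof (intro ballI)
    fix x y assume xy: "x \<in> carrier G" "y \<in> carrier G"
    have "[\<phi> (comm g x \<otimes> comm x (comm g y) \<otimes> comm g y) = \<phi> (comm g x) + \<phi> (comm g y)] (mod int p)"
      by (rule padd_mult3) (use assms xy comm_D in auto)
    then show "[\<phi> (comm g (x \<otimes> y)) = \<phi> (comm g x) + \<phi> (comm g y)] (mod int p)"
      using assms xy by (simp add: comm_mult_right)
  qed
qed

text \<open>With \<open>p ^ m\<close> and \<open>p ^ r\<close> the indices of \<open>D\<close> in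
  \<open>G\<close> and of \<open>U\<close> in \<open>D\<close>, the claim is
  \<open>2 * r \<le> m\<close>. A functional on \<open>D\<close> modulo \<open>U\<close>, evaluated
  at commutators, is an alternating form on \<open>G\<close> modulo \<open>D\<close>; a nonzero one
  is nondegenerate, since any \<open>g\<close> outside \<open>D\<close> has all of \<open>D\<close>
  as its commutators.\<close>

lemma card_bound_odd:
  assumes odd: "odd p"
  shows "card D ^ 3 \<le> card (carrier G) * card U ^ 2"
proof -
  have p0: "int p > 0" using prime_gt_0_nat[OF p] by simp
  obtain m e x where dsk: "GD.dual_system m e x \<and> (\<forall>g\<in>carrier G. (\<forall>i<m. [x i g = 0] (mod int p)) \<longrightarrow> g \<in> D)"
    using GD.exists_coordinates by (elim exE)
  obtain r e' y where dsk': "DU.dual_system r e' y \<and> (\<forall>g\<in>D. (\<forall>i<r. [y i g = 0] (mod int p)) \<longrightarrow> g \<in> U)"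
    using DU.exists_coordinates by (elim exE)
  note ds = conjunct1[OF dsk] and ds' = conjunct1[OF dsk']
  have ker: "g \<in> D" if "g \<in> carrier G" "\<And>i. i < m \<Longrightarrow> [x i g = 0] (mod int p)" for g
    by (rule conjunct2[OF dsk, rule_format, OF that(1)]) (rule that(2))
  have ker': "g \<in> U" if "g \<in> D" "\<And>i. i < r \<Longrightarrow> [y i g = 0] (mod int p)" for g
    by (rule conjunct2[OF dsk', rule_format, OF that(1)]) (rule that(2))
  have xs: "\<And>i. i < m \<Longrightarrow> padd p G (carrier G) (x i)" "\<And>i. i < m \<Longrightarrow> e i \<in> carrier G"
    "\<And>i n. i < m \<Longrightarrow> n \<in> D \<Longrightarrow> [x i n = 0] (mod int p)"
    using ds by (simp_all add: GD.dual_system_def)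
  have ys: "\<And>i. i < r \<Longrightarrow> padd p G D (y i)" "\<And>i. i < r \<Longrightarrow> e' i \<in> D"
    "\<And>i n. i < r \<Longrightarrow> n \<in> U \<Longrightarrow> [y i n = 0] (mod int p)"
    "\<And>i j. i < r \<Longrightarrow> j < r \<Longrightarrow> [y i (e' j) = of_bool (i = j)] (mod int p)"
    using ds' by (simp_all add: DU.dual_system_def)
  have cG: "card (carrier G) = p ^ m * card D" using GD.card_eq_coordinates[OF ds] ker by blast
  have cD: "card D = p ^ r * card U" using DU.card_eq_coordinates[OF ds'] ker' by blast
  have m: "m > 0"
  proof (rule ccontr)
    assume "\<not> m > 0"
    then have "card D = card (carrier G)" using cG by simp
    then have "D = carrier G" using card_subset_eq[OF fin subgroup.subset[OF D]] by simp
    then show False using D_proper by blast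
  qed
  \<comment> \<open>The values of \<open>y l\<close> are additive only modulo \<open>p\<close>;
    defining the lower half by negation makes the integer matrices exactly skew.\<close>
  define A where "A l i j = (if i < j then y l (comm (e i) (e j)) else if j < i then - y l (comm (e j) (e i)) else 0)" for l i j
  have A: "[A l i j = y l (comm (e i) (e j))] (mod int p)" if l: "l < r" and ij: "i < m" "j < m" for l i j
  proof -
    consider "i < j" | "i = j" | "j < i" by linarith
    then show ?thesis
    proof cases
      case 1 then show ?thesis by (simp add: A_def)
    next
      case 2
      then show ?thesis using padd_one[OF ys(1)[OF l] D] xs(2) ij by (simp add: A_def cong_sym)
    next
      case 3
      have "[y l (inv (comm (e j) (e i))) = - y l (comm (e j) (e i))] (mod int p)"
        by (rule padd_inv[OF ys(1)[OF l] D comm_D]) (use xs ij in auto)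
      then have "[y l (comm (e i) (e j)) = - y l (comm (e j) (e i))] (mod int p)"
        using xs(2) ij by (simp add: inv_comm)
      then show ?thesis using 3 cong_sym by (simp add: A_def)
    qed
  qed
  have "2 * r \<le> m"
  proof (rule alternating_family_bound[OF p odd m])
    show "A l j i = - A l i j" for l i j by (simp add: A_def)
    fix c k assume c: "c \<in> {..<r} \<rightarrow>\<^sub>E {0..<int p}" "\<exists>l<r. c l \<noteq> 0" and k: "k \<in> {..<m} \<rightarrow>\<^sub>E {0..<int p}"
      and z: "\<And>i. i < m \<Longrightarrow> [(\<Sum>j<m. (\<Sum>l<r. c l * A l i j) * k j) = 0] (mod int p)"
    define \<phi> where "\<phi> d = (\<Sum>l<r. c l * y l d)" for d
    have \<phi>: "padd p G D \<phi>"
      unfolding padd_def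
    proof (intro ballI)
      fix a b assume ab: "a \<in> D" "b \<in> D"
      have "[\<phi> (a \<otimes> b) = (\<Sum>l<r. c l * (y l a + y l b))] (mod int p)"
        unfolding \<phi>_def
      proof (intro cong_sum cong_mult cong_refl)
        fix l assume "l \<in> {..<r}"
        then show "[y l (a \<otimes> b) = y l a + y l b] (mod int p)" using ys(1)[of l] ab unfolding padd_def by simp
      qed
      then show "[\<phi> (a \<otimes> b) = \<phi> a + \<phi> b] (mod int p)"
        by (simp add: \<phi>_def distrib_left sum.distrib)
    qed
    have \<phi>U: "[\<phi> u = 0] (mod int p)" if u: "u \<in> U" for u
    proof -
      have "[\<phi> u = (\<Sum>l<r. c l * 0)] (mod int p)"
        unfolding \<phi>_def
      proof (intro cong_sum cong_mult cong_refl)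
        fix l assume "l \<in> {..<r}"
        then show "[y l u = 0] (mod int p)" using ys(3)[of l u] u by simp
      qed
      then show ?thesis by simp
    qed
    obtain g where g: "g \<in> carrier G" "(\<forall>f. padd p G (carrier G) f \<longrightarrow> [f g = (\<Sum>i<m. int (nat (k i)) * f (e i))] (mod int p)) \<and>
      (\<forall>i<m. [x i g = int (nat (k i))] (mod int p))"
      by (rule bexE[OF GD.dual_system_element[OF ds, of "\<lambda>i. nat (k i)"]])
    have kr: "k j \<in> {0..<int p}" if "j < m" for j using PiE_mem[OF k, of j] that by simp
    then have xg: "[x j g = k j] (mod int p)" if "j < m" for j
      using g(2) that by simp
    have kill: "[\<phi> (comm z d) = 0] (mod int p)" "[\<phi> (comm d z) = 0] (mod int p)" if "z \<in> carrier G" "d \<in> D" for z d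
      using \<phi>U comm_U that by auto
    have e0: "[\<phi> (comm (e i) g) = 0] (mod int p)" if i: "i < m" for i
    proof -
      have "[\<phi> (comm (e i) g) = (\<Sum>j<m. \<phi> (comm (e i) (e j)) * x j g)] (mod int p)"
        by (rule GD.padd_expand[OF ds ker padd_comm(2)[OF \<phi> \<phi>U xs(2)[OF i]] _ g(1)])
          (use kill(1)[OF xs(2)[OF i]] in auto)
      also have "[(\<Sum>j<m. \<phi> (comm (e i) (e j)) * x j g) = (\<Sum>j<m. (\<Sum>l<r. c l * A l i j) * k j)] (mod int p)"
      proof (intro cong_sum cong_mult)
        fix j assume "j \<in> {..<m}"
        then have j: "j < m" by simp
        show "[x j g = k j] (mod int p)" by (rule xg[OF j])
        show "[\<phi> (comm (e i) (e j)) = (\<Sum>l<r. c l * A l i j)] (mod int p)"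
          unfolding \<phi>_def
        proof (intro cong_sum cong_mult cong_refl)
          fix l assume "l \<in> {..<r}"
          then show "[y l (comm (e i) (e j)) = A l i j] (mod int p)" by (intro cong_sym[OF A] i j) simp
        qed
      qed
      also have "[(\<Sum>j<m. (\<Sum>l<r. c l * A l i j) * k j) = 0] (mod int p)" by (rule z[OF i])
      finally show ?thesis .
    qed
    have all0: "[\<phi> (comm h g) = 0] (mod int p)" if h: "h \<in> carrier G" for h
    proof -
      have "[\<phi> (comm h g) = (\<Sum>i<m. \<phi> (comm (e i) g) * x i h)] (mod int p)"
        by (rule GD.padd_expand[OF ds ker padd_comm(1)[OF \<phi> \<phi>U g(1)] _ h])
          (use kill(2)[OF g(1)] in auto)
      also have "[(\<Sum>i<m. \<phi> (comm (e i) g) * x i h) = (\<Sum>i<m. 0 * x i h)] (mod int p)"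
        by (intro cong_sum cong_mult cong_refl) (use e0 in auto)
      finally show ?thesis by simp
    qed
    obtain l where l: "l < r" "c l \<noteq> 0" using c(2) by blast
    have cl: "c l \<in> {0..<int p}" using PiE_mem[OF c(1), of l] l by simp
    have "[\<phi> (e' l) = c l] (mod int p)"
    proof -
      have "[\<phi> (e' l) = (\<Sum>i<r. c i * of_bool (i = l))] (mod int p)"
        unfolding \<phi>_def
      proof (intro cong_sum cong_mult cong_refl)
        fix i assume "i \<in> {..<r}"
        then show "[y i (e' l) = of_bool (i = l)] (mod int p)" using ys(4)[of i l] l by simp
      qed
      also have "(\<Sum>i<r. c i * of_bool (i = l)) = (\<Sum>i<r. if i = l then c i else 0)"
        by (intro sum.cong) auto
      finally show ?thesis using l by simp
    qed
    moreover have "\<not> [c l = 0] (mod int p)" using cl l by (simp add: cong_def)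
    ultimately have nz: "\<not> [\<phi> (e' l) = 0] (mod int p)" using cong_sym cong_trans by blast
    have "g \<in> D"
    proof (rule ccontr)
      assume "g \<notin> D"
      then obtain h where h: "h \<in> carrier G" "comm g h = e' l" using camina[OF g(1) _ ys(2)[OF l(1)]] by blast
      have "[\<phi> (inv (comm h g)) = - \<phi> (comm h g)] (mod int p)"
        by (rule padd_inv[OF \<phi> D comm_D[OF h(1) g(1)]])
      also have "[- \<phi> (comm h g) = - 0] (mod int p)" using all0[OF h(1)] by (subst cong_minus_minus_iff)
      finally show False using nz h g by (simp add: inv_comm)
    qed
    then have "[k j = 0] (mod int p)" if "j < m" for j
      using cong_trans[OF cong_sym[OF xg[OF that]] xs(3)[OF that]] by simp
    then show "\<forall>j<m. k j = 0" using kr by (auto simp: cong_def)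
  qed
  then have "p ^ (2 * r) \<le> p ^ m" using prime_gt_0_nat[OF p] by (intro power_increasing) auto
  then have le: "p ^ r * p ^ r \<le> p ^ m" by (simp add: mult_2 power_add)
  have "card D ^ 3 = (p ^ r * p ^ r) * (card D * card U ^ 2)"
    by (simp add: cD power3_eq_cube power2_eq_square mult_ac)
  also have "\<dots> \<le> p ^ m * (card D * card U ^ 2)" using le by (intro mult_right_mono) auto
  also have "\<dots> = card (carrier G) * card U ^ 2" by (simp add: cG)
  finally show ?thesis .
qed

declare GD.SG [simp del] GD.S_closed [simp del] GD.pow_closed [simp del] GD.M_closed [simp del] GD.M_S [simp del]
  DU.SG [simp del] DU.S_closed [simp del] DU.pow_closed [simp del] DU.M_closed [simp del] DU.M_S [simp del]
  U1.SG [simp del] U1.S_closed [simp del] U1.pow_closed [simp del] U1.M_closed [simp del] U1.M_S [simp del]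
declare m_closed [simp] one_closed [simp] inv_closed [simp] nat_pow_closed [simp]
  D_closed [simp] U_closed [simp] DG [simp] UG [simp] D_pow [simp] U_pow [simp]

end

section \<open>The pairing defined by a nontrivial character of U\<close>

locale camina3_char = camina3 +
  fixes \<chi> :: "'a \<Rightarrow> complex"
  assumes \<chi>_mult [simp]: "u \<in> U \<Longrightarrow> v \<in> U \<Longrightarrow> \<chi> (u \<otimes> v) = \<chi> u * \<chi> v"
    and \<chi>_nonzero [simp]: "u \<in> U \<Longrightarrow> \<chi> u \<noteq> 0"
    and \<chi>_nontrivial: "\<exists>u\<in>U. \<chi> u \<noteq> 1"
begin

lemma \<chi>_one [simp]: "\<chi> \<one> = 1"
  using \<chi>_mult[of \<one> \<one>] \<chi>_nonzero[of \<one>] by simp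

lemma \<chi>_inv [simp]: "u \<in> U \<Longrightarrow> \<chi> (inv u) = inverse (\<chi> u)"
  using \<chi>_mult[of "inv u" u] by (simp add: field_simps)

lemma \<chi>_pow [simp]: "u \<in> U \<Longrightarrow> \<chi> (u [^] (n::nat)) = \<chi> u ^ n"
  by (induction n) auto

text \<open>\<open>C\<close> and \<open>Z0\<close> are the right and left radicals of the pairing
  \<open>\<chi> (comm c g)\<close> of \<open>D\<close> with \<open>G\<close>.\<close>

definition C :: "'a set" where "C = {g \<in> carrier G. \<forall>c\<in>D. \<chi> (comm c g) = 1}"
definition Z0 :: "'a set" where "Z0 = {c \<in> D. \<forall>g\<in>carrier G. \<chi> (comm c g) = 1}"

lemma CG: "x \<in> C \<Longrightarrow> x \<in> carrier G" and Z0D: "x \<in> Z0 \<Longrightarrow> x \<in> D"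
  unfolding C_def Z0_def by blast+

lemma DC: assumes "x \<in> D" shows "x \<in> C"
  unfolding C_def using assms comm_D_D[OF _ assms] DG[OF assms] by simp

lemma UZ0: assumes "x \<in> U" shows "x \<in> Z0"
  unfolding Z0_def using assms comm_central(1)[OF assms] UDm[OF assms] by simp

lemma C_kills [simp]:
  assumes "y \<in> C" "d \<in> D"
  shows "\<chi> (comm d y) = 1" "\<chi> (comm y d) = 1"
proof -
  show 1: "\<chi> (comm d y) = 1" using assms unfolding C_def by blast
  have "comm y d = inv (comm d y)" using inv_comm[OF DG[OF assms(2)] CG[OF assms(1)]] by simp
  then show "\<chi> (comm y d) = 1" using \<chi>_inv[OF comm_U[OF assms(2) CG[OF assms(1)]]] 1 by simp
qed

lemma Z0_kills [simp]: "c \<in> Z0 \<Longrightarrow> g \<in> carrier G \<Longrightarrow> \<chi> (comm c g) = 1"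
  unfolding Z0_def by blast

lemma finC [simp]: "finite C" and finZ0 [simp]: "finite Z0"
  unfolding C_def Z0_def using fin finD by simp_all

lemma C_subgroup: "subgroup C G"
proof (rule finite_subgroupI)
  show "C \<subseteq> carrier G" using CG by blast
  show "C \<noteq> {}" using DC[OF D_closed(2)] by blast
  fix x y assume xy: "x \<in> C" "y \<in> C"
  have "\<chi> (comm c (x \<otimes> y)) = 1" if c: "c \<in> D" for c
    using comm_mult_D_right[OF c CG[OF xy(1)] CG[OF xy(2)]] comm_U[OF c CG[OF xy(1)]] comm_U[OF c CG[OF xy(2)]] xy c
    by simp
  then show "x \<otimes> y \<in> C" using CG[OF xy(1)] CG[OF xy(2)] unfolding C_def by simp
qed simp

lemma Z0_subgroup: "subgroup Z0 G"
proof (rule finite_subgroupI)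
  show "Z0 \<subseteq> carrier G" using Z0D DG by blast
  show "Z0 \<noteq> {}" using UZ0[OF U_closed(2)] by blast
  fix x y assume xy: "x \<in> Z0" "y \<in> Z0"
  have "\<chi> (comm (x \<otimes> y) g) = 1" if g: "g \<in> carrier G" for g
    using comm_mult_D_left[OF Z0D[OF xy(1)] Z0D[OF xy(2)] g] comm_U[OF Z0D[OF xy(1)] g] comm_U[OF Z0D[OF xy(2)] g] xy g
    by simp
  then show "x \<otimes> y \<in> Z0" using Z0D[OF xy(1)] Z0D[OF xy(2)] unfolding Z0_def by simp
qed simp

lemmas C_closed = subgroup.m_closed[OF C_subgroup] subgroup.m_inv_closed[OF C_subgroup]
lemmas Z0_closed = subgroup.m_closed[OF Z0_subgroup] subgroup.m_inv_closed[OF Z0_subgroup]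

lemma card_GZ0: "card (carrier G) * card Z0 = card D * card C"
  unfolding C_def Z0_def
  by (rule pairing_card[OF D finD subgroup_self fin, of "\<lambda>c g. \<chi> (comm c g)", symmetric])
    (simp_all add: comm_mult_D_left comm_mult_D_right comm_U)

text \<open>The product x z equals [x, z] z x. Expanding the commutator of \<open>y\<close> with
  both expressions produces [y, x] and [y, z] with central corrections, and the additional factor
  [y, [x, z]] is killed by \<open>\<chi>\<close> because \<open>y\<close> lies in
  \<open>C\<close>.\<close>

lemma symm:
  assumes y: "y \<in> C" and x: "x \<in> carrier G" and z: "z \<in> carrier G"
  shows "\<chi> (comm (comm y z) x) = \<chi> (comm (comm y x) z)"
proof -
  have yG: "y \<in> carrier G" using y by (rule CG)
  let ?a = "comm y x" and ?b = "comm y z"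
  let ?s = "comm x ?b" and ?t = "comm z ?a" and ?d = "comm x z"
  let ?k = "comm y ?d"
  have mem: "?a \<in> D" "?b \<in> D" "?d \<in> D" "?s \<in> U" "?t \<in> U" "?k \<in> U"
    by (intro comm_D comm_U_right yG x z)+
  have memG: "?a \<in> carrier G" "?b \<in> carrier G" "?s \<in> carrier G" "?t \<in> carrier G" "?k \<in> carrier G"
    using mem by simp_all
  have zx: "comm y (z \<otimes> x) \<in> D" by (intro comm_D yG m_closed z x)
  have 1: "comm y (x \<otimes> z) = ?s \<otimes> (?a \<otimes> ?b)"
    unfolding comm_mult_right[OF yG x z] U_central[OF mem(4) memG(1), symmetric] using memG by (simp add: m_assoc)
  have 2: "comm y (z \<otimes> x) = ?t \<otimes> (?a \<otimes> ?b)"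
    unfolding comm_mult_right[OF yG z x] U_central[OF mem(5) memG(2), symmetric] D_abelian[OF mem(1,2)] using memG by (simp add: m_assoc)
  have "comm y (x \<otimes> z) = comm y (?d \<otimes> (z \<otimes> x))" using comm_swap[OF x z] by (rule arg_cong)
  also have "\<dots> = ?k \<otimes> comm ?d (comm y (z \<otimes> x)) \<otimes> comm y (z \<otimes> x)"
    by (intro comm_mult_right yG m_closed z x DG[OF mem(3)])
  also have "\<dots> = ?k \<otimes> comm y (z \<otimes> x)"
    unfolding comm_D_D[OF mem(3) zx] using memG by simp
  finally have "?s \<otimes> (?a \<otimes> ?b) = (?k \<otimes> ?t) \<otimes> (?a \<otimes> ?b)" unfolding 1 2 using memG by (simp add: m_assoc)
  then have "?s = ?k \<otimes> ?t" using memG by (simp add: right_cancel)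
  then have "\<chi> ?s = \<chi> ?k * \<chi> ?t" using \<chi>_mult[OF mem(6,5)] by (rule trans[OF arg_cong])
  then have "\<chi> ?s = \<chi> ?t" using C_kills(2)[OF y mem(3)] by simp
  then have "\<chi> (inv ?s) = \<chi> (inv ?t)" using mem by simp
  then show ?thesis by (simp add: inv_comm memG x z)
qed

text \<open>The symmetry moves \<open>x\<close> into the last place, and as \<open>z\<close> varies
  \<open>comm y z\<close> runs through all of \<open>D\<close>, since \<open>y\<close> is outside
  \<open>D\<close>. What remains is the definition of \<open>C\<close>.\<close>

lemma comm_Z0_iff:
  assumes y: "y \<in> C" "y \<notin> D" and x: "x \<in> carrier G"
  shows "comm y x \<in> Z0 \<longleftrightarrow> x \<in> C"
proof -
  have "comm y x \<in> Z0 \<longleftrightarrow> (\<forall>z\<in>carrier G. \<chi> (comm (comm y x) z) = 1)"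
    unfolding Z0_def using comm_D[OF CG[OF y(1)] x] by simp
  also have "\<dots> \<longleftrightarrow> (\<forall>z\<in>carrier G. \<chi> (comm (comm y z) x) = 1)"
    using symm[OF y(1) x] by simp
  also have "\<dots> \<longleftrightarrow> (\<forall>d\<in>D. \<chi> (comm d x) = 1)"
  proof
    assume h: "\<forall>z\<in>carrier G. \<chi> (comm (comm y z) x) = 1"
    show "\<forall>d\<in>D. \<chi> (comm d x) = 1"
    proof
      fix d assume "d \<in> D"
      then obtain z where "z \<in> carrier G" "comm y z = d" using camina[OF CG[OF y(1)] y(2)] by blast
      then show "\<chi> (comm d x) = 1" using h by blast
    qed
  next
    assume h: "\<forall>d\<in>D. \<chi> (comm d x) = 1"
    show "\<forall>z\<in>carrier G. \<chi> (comm (comm y z) x) = 1"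
    proof
      fix z assume "z \<in> carrier G"
      then show "\<chi> (comm (comm y z) x) = 1" by (rule bspec[OF h comm_D[OF CG[OF y(1)]]])
    qed
  qed
  finally show ?thesis using x unfolding C_def by simp
qed

lemma comm_left_mod:
  assumes "y \<in> carrier G" "y' \<in> carrier G" "x \<in> carrier G" "z \<in> carrier G"
  shows "\<chi> (comm (comm (y \<otimes> y') x) z) = \<chi> (comm (comm y x) z) * \<chi> (comm (comm y' x) z)"
proof -
  have "comm (y \<otimes> y') x = comm y (comm y' x) \<otimes> comm y' x \<otimes> comm y x"
    using assms by (intro comm_mult_left) auto
  moreover have m: "comm y (comm y' x) \<in> U" "comm y' x \<in> D" "comm y x \<in> D" by (intro comm_D comm_U_right assms)+
  moreover have "comm (comm y (comm y' x) \<otimes> comm y' x \<otimes> comm y x) z = comm (comm y' x) z \<otimes> comm (comm y x) z"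
    unfolding comm_mult_D_left[OF D_closed(1)[OF UDm[OF m(1)] m(2)] m(3) assms(4)] comm_mult_D_left[OF UDm[OF m(1)] m(2) assms(4)]
      comm_central(1)[OF m(1) assms(4)] using m assms by simp
  ultimately have "comm (comm (y \<otimes> y') x) z = comm (comm y' x) z \<otimes> comm (comm y x) z" by (simp only:)
  then show ?thesis using \<chi>_mult[OF comm_U[OF m(2) assms(4)] comm_U[OF m(3) assms(4)]] by (simp only: mult.commute)
qed

lemma exists_not_C: "\<exists>x\<in>carrier G. x \<notin> C"
proof (rule ccontr)
  assume "\<not> ?thesis"
  then have all: "\<chi> (comm c g) = 1" if "c \<in> D" "g \<in> carrier G" for c g
    using that unfolding C_def by blast
  let ?H = "{u \<in> U. \<chi> u = 1}"
  have "subgroup ?H G"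
  proof (rule finite_subgroupI)
    have "\<one> \<in> ?H" by simp
    then show "?H \<noteq> {}" by blast
  qed auto
  moreover have "{comm c g |c g. c \<in> D \<and> g \<in> carrier G} \<subseteq> ?H" using all comm_U by auto
  ultimately have "generate G {comm c g |c g. c \<in> D \<and> g \<in> carrier G} \<subseteq> ?H" by (intro generate_subgroup_incl)
  then show False using U_gen \<chi>_nontrivial by blast
qed

text \<open>For fixed \<open>x\<close> outside \<open>C\<close> the expression
  \<open>\<chi> (comm (comm y x) z)\<close> is a pairing of \<open>C\<close> with \<open>G\<close>.
  Its left radical is exactly \<open>D\<close>: for \<open>y\<close> in \<open>C\<close> but outside
  \<open>D\<close> the commutator with \<open>x\<close> avoids \<open>Z0\<close>. That its right
  radical contains \<open>C\<close> is what bounds \<open>card C\<close>.\<close>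

lemma pairing_x:
  assumes x: "x \<in> carrier G" "x \<notin> C"
  shows "card C * card {z \<in> carrier G. \<forall>y\<in>C. \<chi> (comm (comm y x) z) = 1} = card (carrier G) * card D"
    and "C \<subseteq> {z \<in> carrier G. \<forall>y\<in>C. \<chi> (comm (comm y x) z) = 1}"
proof -
  have "{y \<in> C. \<forall>z\<in>carrier G. \<chi> (comm (comm y x) z) = 1} = D"
  proof (intro Set.set_eqI iffI)
    fix y assume "y \<in> {y \<in> C. \<forall>z\<in>carrier G. \<chi> (comm (comm y x) z) = 1}"
    then have y: "y \<in> C" "\<forall>z\<in>carrier G. \<chi> (comm (comm y x) z) = 1" by blast+
    then have "comm y x \<in> Z0" unfolding Z0_def using comm_D[OF CG[OF y(1)] x(1)] by blast
    then show "y \<in> D" using comm_Z0_iff[OF y(1) _ x(1)] x(2) by blast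
  next
    fix y assume y: "y \<in> D"
    then show "y \<in> {y \<in> C. \<forall>z\<in>carrier G. \<chi> (comm (comm y x) z) = 1}"
      using DC[OF y] comm_central(1)[OF comm_U[OF y x(1)]] by simp
  qed
  then show "card C * card {z \<in> carrier G. \<forall>y\<in>C. \<chi> (comm (comm y x) z) = 1} = card (carrier G) * card D"
    using pairing_card[OF C_subgroup finC subgroup_self fin, of "\<lambda>y z. \<chi> (comm (comm y x) z)"]
    by (simp add: comm_left_mod comm_mult_D_right comm_U comm_D CG x)
  show "C \<subseteq> {z \<in> carrier G. \<forall>y\<in>C. \<chi> (comm (comm y x) z) = 1}"
  proof
    fix z assume z: "z \<in> C"
    have "\<chi> (comm (comm y x) z) = 1" if "y \<in> C" for y
      by (rule C_kills(1)[OF z comm_D[OF CG[OF that] x(1)]])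
    then show "z \<in> {z \<in> carrier G. \<forall>y\<in>C. \<chi> (comm (comm y x) z) = 1}" using CG[OF z] by blast
  qed
qed

lemma card_C_le: "card C * card C \<le> card (carrier G) * card D"
proof -
  obtain x where x: "x \<in> carrier G" "x \<notin> C" using exists_not_C by blast
  have "card C \<le> card {z \<in> carrier G. \<forall>y\<in>C. \<chi> (comm (comm y x) z) = 1}"
    using pairing_x(2)[OF x] fin by (intro card_mono) auto
  then show ?thesis using mult_le_mono2[of "card C" _ "card C"] unfolding pairing_x(1)[OF x, symmetric] by blast
qed

lemma card_pos [simp]: "card D > 0" "card U > 0" "card C > 0" "card Z0 > 0" "card (carrier G) > 0"
  using D_closed(2) U_closed(2) DC[OF D_closed(2)] UZ0[OF U_closed(2)] fin finC finZ0 finD finU one_closed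
  by (metis card_gt_0_iff empty_iff)+

text \<open>Squaring |G| |Z0| = |D| |C| and inserting the bound on |C| gives |G| |Z0|^2 \<le> |D|^3.
  The bound from alternating forms closes the chain, so all inequalities in it become
  equalities.\<close>

lemma odd_structure:
  assumes odd: "odd p"
  shows "Z0 = U" "card C * card D = card (carrier G) * card U" "card D ^ 3 = card (carrier G) * card U ^ 2"
proof -
  let ?g = "card (carrier G)"
  have "(?g * card Z0) * (?g * card Z0) = (card D * card D) * (card C * card C)"
    unfolding card_GZ0 by simp
  also have "\<dots> \<le> (card D * card D) * (?g * card D)" using card_C_le by (rule mult_le_mono2)
  finally have "?g * (?g * card Z0 ^ 2) \<le> ?g * card D ^ 3"
    by (simp add: power2_eq_square power3_eq_cube mult_ac)
  then have 1: "?g * card Z0 ^ 2 \<le> card D ^ 3" by (simp del: card_pos add: card_pos(5))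
  then have "?g * card Z0 ^ 2 \<le> ?g * card U ^ 2" using card_bound_odd[OF odd] by (rule le_trans)
  then have "card Z0 \<le> card U" using card_pos(5) by (metis mult_le_cancel1 power2_nat_le_eq_le)
  then show Z: "Z0 = U" using UZ0 finZ0 by (metis card_seteq subsetI)
  show "card C * card D = ?g * card U" using card_GZ0 Z by (simp add: mult.commute)
  show "card D ^ 3 = ?g * card U ^ 2" using 1 card_bound_odd[OF odd] Z by simp
qed

lemma odd_exists_C_not_D:
  assumes odd: "odd p"
  shows "\<exists>y\<in>C. y \<notin> D"
proof (rule ccontr)
  assume "\<not> ?thesis"
  then have "C = D" using DC by blast
  note s = odd_structure[OF odd, unfolded this]
  have "card D * (card D * card D) = card U * (card D * card D)"
    using s(2,3) by (simp add: power3_eq_cube power2_eq_square mult_ac)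
  then have "card D = card U" using card_pos(1) by (metis mult_cancel2 mult_is_0 less_irrefl)
  then have "U = D" using UD finD by (metis card_subset_eq)
  then show False using D_not_U by blast
qed

text \<open>The step from \<open>n\<close> to \<open>n + 1\<close> moves \<open>x [^] n\<close> past
  \<open>comm y x\<close> and so contributes the \<open>n\<close>-th power of the central element
  \<open>comm x (comm y x)\<close>; hence the triangular number.\<close>

lemma comm_pow_right:
  assumes "y \<in> carrier G" "x \<in> carrier G"
  shows "comm y (x [^] (n::nat)) = comm y x [^] n \<otimes> comm x (comm y x) [^] (n * (n - 1) div 2)"
proof (induction n)
  case (Suc n)
  let ?f = "comm y x" and ?v = "comm x (comm y x)"
  have f: "?f \<in> D" "?v \<in> U" using assms comm_D by auto
  have "comm y (x [^] n \<otimes> x) = comm y (x [^] n) \<otimes> comm (x [^] n) ?f \<otimes> ?f"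
    using assms by (intro comm_mult_right) auto
  also have "comm (x [^] n) ?f = ?v [^] n" using f assms by (simp add: comm_pow_D_right)
  also have "comm y (x [^] n) \<otimes> ?v [^] n \<otimes> ?f = ?f [^] n \<otimes> (?v [^] (n * (n - 1) div 2) \<otimes> ?v [^] n \<otimes> ?f)"
    unfolding Suc using f assms by (simp add: m_assoc)
  also have "?v [^] (n * (n - 1) div 2) \<otimes> ?v [^] n = ?v [^] (n * (n - 1) div 2 + n)"
    using f by (simp add: nat_pow_mult)
  also have "n * (n - 1) div 2 + n = Suc n * (Suc n - 1) div 2" by (cases n) (auto simp: algebra_simps)
  also have "?v [^] (Suc n * (Suc n - 1) div 2) \<otimes> ?f = ?f \<otimes> ?v [^] (Suc n * (Suc n - 1) div 2)"
    using f by (intro U_central) auto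
  also have "?f [^] n \<otimes> (?f \<otimes> ?v [^] (Suc n * (Suc n - 1) div 2)) = ?f [^] Suc n \<otimes> ?v [^] (Suc n * (Suc n - 1) div 2)"
    using f by (simp add: m_assoc)
  finally show ?case by simp
qed (use assms in simp)

text \<open>Write \<open>d = comm y x\<close> with \<open>y\<close> in \<open>C\<close> outside
  \<open>D\<close> and expand \<open>comm y (x [^] p)\<close>. For odd \<open>p\<close> the
  triangular number is divisible by \<open>p\<close>, so only \<open>d [^] p\<close> remains, while
  \<open>x [^] p\<close> lies in \<open>D\<close> and its commutator with \<open>y\<close> is killed
  by \<open>\<chi>\<close>.\<close>

lemma odd_D_pow:
  assumes odd: "odd p" and d: "d \<in> D"
  shows "\<chi> (d [^] p) = 1"
proof -
  obtain y where y: "y \<in> C" "y \<notin> D" using odd_exists_C_not_D[OF odd] by blast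
  have yG: "y \<in> carrier G" by (rule CG[OF y(1)])
  obtain x where x: "x \<in> carrier G" "d = comm y x" using camina[OF CG[OF y(1)] y(2) d] by blast
  let ?v = "comm x d"
  have v: "?v \<in> U" using d x by simp
  have "p * (p - 1) div 2 = p * ((p - 1) div 2)" using odd by (simp add: div_mult_swap)
  then have "?v [^] (p * (p - 1) div 2) = \<one>" using v pow_p_one[OF v] by (simp flip: nat_pow_pow)
  then have "comm y (x [^] p) = d [^] p" using comm_pow_right[OF yG x(1), of p] x d by simp
  moreover have "\<chi> (comm y (x [^] p)) = 1" by (rule C_kills(2)[OF y(1) pow_p_D[OF x(1)]])
  ultimately show ?thesis by simp
qed

end

context group
begin

text \<open>Left cosets of \<open>H\<close> partition \<open>A\<close>. For
  \<open>A = carrier G\<close> this is Lagrange's theorem; the general form also counts level sets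
  that are stable under right multiplication.\<close>

lemma card_dvd_of_right_closed:
  assumes H: "subgroup H G" and fin: "finite A" "A \<subseteq> carrier G"
    and cl: "\<And>x h. x \<in> A \<Longrightarrow> h \<in> H \<Longrightarrow> x \<otimes> h \<in> A"
  shows "card H dvd card A"
proof (cases "A = {}")
  case False
  let ?P = "(\<lambda>x. (\<lambda>h. x \<otimes> h) ` H) ` A"
  note HG = subgroup.mem_carrier[OF H]
  have un: "\<Union> ?P = A"
  proof
    show "\<Union> ?P \<subseteq> A" using cl by blast
    show "A \<subseteq> \<Union> ?P"
    proof
      fix x assume x: "x \<in> A"
      then have "x = x \<otimes> \<one>" using fin by auto
      then show "x \<in> \<Union> ?P" using x subgroup.one_closed[OF H] by blast
    qed
  qed
  have "card H * card ?P = card (\<Union> ?P)"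
  proof (rule card_partition)
    show "finite ?P" using fin by simp
    show "finite (\<Union> ?P)" unfolding un by (rule fin)
    show "card c = card H" if "c \<in> ?P" for c
    proof -
      have "\<exists>x\<in>A. c = (\<lambda>h. x \<otimes> h) ` H" using that by blast
      then obtain x where x: "x \<in> A" "c = (\<lambda>h. x \<otimes> h) ` H" by (rule bexE)
      have "inj_on (\<lambda>h. x \<otimes> h) H"
        using x fin HG by (intro inj_onI) (metis l_cancel_one inv_cancel_left(2) subsetD)
      then show ?thesis using x by (simp add: card_image)
    qed
    show "c1 \<inter> c2 = {}" if c: "c1 \<in> ?P" "c2 \<in> ?P" "c1 \<noteq> c2" for c1 c2
    proof (rule ccontr)
      assume "c1 \<inter> c2 \<noteq> {}"
      moreover have "\<exists>x\<in>A. c1 = (\<lambda>h. x \<otimes> h) ` H" "\<exists>y\<in>A. c2 = (\<lambda>h. y \<otimes> h) ` H" using c by blast+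
      ultimately obtain x y h k where xy: "x \<in> A" "c1 = (\<lambda>h. x \<otimes> h) ` H" "y \<in> A" "c2 = (\<lambda>h. y \<otimes> h) ` H"
        and hk: "h \<in> H" "k \<in> H" "x \<otimes> h = y \<otimes> k" by blast
      have G: "x \<in> carrier G" "y \<in> carrier G" "h \<in> carrier G" "k \<in> carrier G" using xy hk fin HG by auto
      have x: "x = y \<otimes> (k \<otimes> inv h)" using hk(3) G by (metis inv_closed inv_solve_right m_assoc m_closed)
      have y: "y = x \<otimes> (h \<otimes> inv k)" using hk(3) G by (metis inv_closed inv_solve_right m_assoc m_closed)
      have sub1: "(\<lambda>h. x \<otimes> h) ` H \<subseteq> (\<lambda>h. y \<otimes> h) ` H"
      proof
        fix z assume "z \<in> (\<lambda>h. x \<otimes> h) ` H"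
        then obtain l where l: "l \<in> H" "z = x \<otimes> l" by blast
        then have "z = y \<otimes> (k \<otimes> inv h \<otimes> l)" using x G HG by (simp add: m_assoc)
        moreover have "k \<otimes> inv h \<otimes> l \<in> H"
          by (intro subgroup.m_closed[OF H] subgroup.m_inv_closed[OF H] l hk)
        ultimately show "z \<in> (\<lambda>h. y \<otimes> h) ` H" by (rule image_eqI)
      qed
      have sub2: "(\<lambda>h. y \<otimes> h) ` H \<subseteq> (\<lambda>h. x \<otimes> h) ` H"
      proof
        fix z assume "z \<in> (\<lambda>h. y \<otimes> h) ` H"
        then obtain l where l: "l \<in> H" "z = y \<otimes> l" by blast
        then have "z = x \<otimes> (h \<otimes> inv k \<otimes> l)" using y G HG by (simp add: m_assoc)
        moreover have "h \<otimes> inv k \<otimes> l \<in> H"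
          by (intro subgroup.m_closed[OF H] subgroup.m_inv_closed[OF H] l hk)
        ultimately show "z \<in> (\<lambda>h. x \<otimes> h) ` H" by (rule image_eqI)
      qed
      have "c1 = c2" unfolding xy(2,4) by (rule Set.equalityI[OF sub1 sub2])
      then show False using c(3) by simp
    qed
  qed
  then have "card A = card H * card ?P" unfolding un by (rule sym)
  then show ?thesis by (rule dvdI)
qed simp

end

context camina3
begin

lemma subgroup_card_power: assumes "subgroup H G" shows "\<exists>k. card H = p ^ k"
proof -
  have "finite H" by (rule finite_subset[OF subgroup.subset[OF assms] fin])
  have "card H dvd card (carrier G)"
    by (rule card_dvd_of_right_closed[OF assms fin subset_refl]) (use subgroup.mem_carrier[OF assms] in auto)
  then show ?thesis using ord divides_primepow_nat[OF p] by auto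
qed

end

lemma power_of_two_lt_dvd:
  assumes "a = (2::nat) ^ i" "b = 2 ^ j" "a < b" shows "2 * a dvd b"
proof -
  have "i < j" using assms by simp
  then have "(2::nat) ^ Suc i dvd 2 ^ j" by (intro le_imp_power_dvd) simp
  then show ?thesis using assms by simp
qed

section \<open>Exclusion of the prime 2\<close>

context camina3_char
begin

text \<open>For \<open>p = 2\<close> the triangular exponent is 1, so the correction term in
  \<open>comm y (x [^] p)\<close> survives, and the square of \<open>comm y x\<close> is measured by
  a commutator.\<close>

lemma even_square:
  assumes p2: "p = 2" and y: "y \<in> C" and x: "x \<in> carrier G"
  shows "\<chi> (comm y x [^] p) = \<chi> (comm (comm y x) x)"
proof -
  have yG: "y \<in> carrier G" by (rule CG[OF y])
  have d: "comm y x \<in> D" by (rule comm_D[OF yG x])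
  have v: "comm x (comm y x) \<in> U" by (rule comm_U_right[OF d x])
  have "comm y (x [^] p) = comm y x [^] p \<otimes> comm x (comm y x)"
    using comm_pow_right[OF yG x, of p] v unfolding p2 by simp
  moreover have "\<chi> (comm y (x [^] p)) = 1" by (rule C_kills(2)[OF y pow_p_D[OF x]])
  ultimately have "\<chi> (comm y x [^] p) * \<chi> (comm x (comm y x)) = 1"
    using \<chi>_mult[OF pow_p_U[OF d] v] by simp
  moreover have "\<chi> (comm x (comm y x)) = inverse (\<chi> (comm (comm y x) x))"
    using \<chi>_inv[OF comm_U[OF d x]] inv_comm[OF DG[OF d] x] by simp
  moreover have "\<chi> (comm (comm y x) x) \<noteq> 0" using comm_U[OF d x] by simp
  ultimately show ?thesis by (simp add: field_simps)
qed

lemma even_sign: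
  assumes p2: "p = 2" and u: "u \<in> U"
  shows "\<chi> u = 1 \<or> \<chi> u = -1"
proof -
  have "\<chi> u ^ 2 = 1" using \<chi>_pow[OF u, of 2] pow_p_one[OF u] unfolding p2 by simp
  then show ?thesis by (simp add: power2_eq_1_iff)
qed

text \<open>A quadratic Gauss sum: for \<open>p = 2\<close> and fixed \<open>z\<close> the summand
  is a sign and a quadratic function of \<open>x\<close> modulo \<open>D\<close>.\<close>

definition gauss :: "'a \<Rightarrow> complex" where
  "gauss z = (\<Sum>x\<in>carrier G. \<chi> (comm (x [^] p) z))"

text \<open>The polarisation of \<open>\<phi> (x [^] p)\<close> is
  \<open>\<phi> (comm (inv x) h)\<close>. Substituting x h for the second variable of the double sum
  leaves a character sum over \<open>x\<close>; it vanishes for \<open>h\<close> outside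
  \<open>D\<close>, because the commutators of \<open>h\<close> fill \<open>D\<close> and
  \<open>\<phi>\<close> is nontrivial there. For \<open>h\<close> in \<open>D\<close> every summand
  is 1.\<close>

lemma gauss_square:
  assumes p2: "p = 2" and z: "z \<in> carrier G" "z \<notin> C"
  shows "gauss z ^ 2 = of_nat (card D * card (carrier G))"
proof -
  define \<phi> where "\<phi> c = \<chi> (comm c z)" for c
  have \<phi>m: "\<phi> (c \<otimes> d) = \<phi> c * \<phi> d" if "c \<in> D" "d \<in> D" for c d
    unfolding \<phi>_def comm_mult_D_left[OF that z(1)] by (rule \<chi>_mult[OF comm_U[OF that(1) z(1)] comm_U[OF that(2) z(1)]])
  have \<phi>U: "\<phi> u = 1" if "u \<in> U" for u unfolding \<phi>_def comm_central(1)[OF that z(1)] by simp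
  have \<phi>2: "\<phi> c * \<phi> c = 1" if "c \<in> D" for c
    using even_sign[OF p2 comm_U[OF that z(1)]] unfolding \<phi>_def by auto
  have sq: "\<phi> ((x \<otimes> h) [^] p) = \<phi> (x [^] p) * \<phi> (comm (inv x) h) * \<phi> (h [^] p)"
    if "x \<in> carrier G" "h \<in> carrier G" for x h
  proof -
    have "(x \<otimes> h) [^] p = x [^] p \<otimes> comm (inv x) h \<otimes> h [^] p"
      unfolding p2 comm_def using that by (simp add: numeral_2_eq_2 word_simps)
    then show ?thesis using pow_p_D that comm_D \<phi>m by simp
  qed
  have inner: "(\<Sum>x\<in>carrier G. \<phi> (comm (inv x) h)) = (if h \<in> D then of_nat (card (carrier G)) else 0)"
    if h: "h \<in> carrier G" for h
  proof (cases "h \<in> D")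
    case True
    have "\<phi> (comm (inv x) h) = 1" if "x \<in> carrier G" for x
      by (rule \<phi>U[OF comm_U_right[OF True]]) (use that in simp)
    then show ?thesis using True by simp
  next
    case False
    obtain d where d: "d \<in> D" "\<phi> d \<noteq> 1" using z unfolding C_def \<phi>_def by blast
    obtain w where w: "w \<in> carrier G" "comm h w = inv d" using camina[OF h False, of "inv d"] d by auto
    then have "comm w h = d" using inv_comm[OF h w(1)] d by simp
    have "(\<Sum>x\<in>carrier G. \<phi> (comm (inv x) h)) = 0"
    proof (rule sum_character[OF subgroup_self])
      show "inv w \<in> carrier G" using w by simp
      show "\<phi> (comm (inv (inv w)) h) \<noteq> 1" using d w \<open>comm w h = d\<close> by simp
      fix x y assume xy: "x \<in> carrier G" "y \<in> carrier G"
      have m: "comm (inv y) (comm (inv x) h) \<in> U" "comm (inv x) h \<in> D" "comm (inv y) h \<in> D"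
        using xy h comm_D comm_U_right by simp_all
      have "comm (inv (x \<otimes> y)) h = comm (inv y) (comm (inv x) h) \<otimes> comm (inv x) h \<otimes> comm (inv y) h"
        using xy h by (simp add: inv_mult_group comm_mult_left)
      then show "\<phi> (comm (inv (x \<otimes> y)) h) = \<phi> (comm (inv x) h) * \<phi> (comm (inv y) h)"
        using \<phi>m[OF D_closed(1)[OF UDm[OF m(1)] m(2)] m(3)] \<phi>m[OF UDm[OF m(1)] m(2)] \<phi>U[OF m(1)] by simp
    qed
    then show ?thesis using False by simp
  qed
  have g: "gauss z = (\<Sum>x\<in>carrier G. \<phi> (x [^] p))" by (simp add: gauss_def \<phi>_def)
  have "gauss z ^ 2 = (\<Sum>x\<in>carrier G. \<Sum>y\<in>carrier G. \<phi> (x [^] p) * \<phi> (y [^] p))"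
    unfolding g power2_eq_square by (rule sum_product)
  also have "\<dots> = (\<Sum>x\<in>carrier G. \<Sum>h\<in>carrier G. \<phi> (x [^] p) * \<phi> ((x \<otimes> h) [^] p))"
  proof (rule sum.cong[OF refl])
    fix x assume x: "x \<in> carrier G"
    show "(\<Sum>y\<in>carrier G. \<phi> (x [^] p) * \<phi> (y [^] p)) = (\<Sum>h\<in>carrier G. \<phi> (x [^] p) * \<phi> ((x \<otimes> h) [^] p))"
      using sum.reindex_bij_betw[OF subgroup_mult_bij[OF subgroup_self x], of "\<lambda>y. \<phi> (x [^] p) * \<phi> (y [^] p)"] by simp
  qed
  also have "\<dots> = (\<Sum>x\<in>carrier G. \<Sum>h\<in>carrier G. \<phi> (h [^] p) * \<phi> (comm (inv x) h))"
  proof (intro sum.cong refl)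
    fix x h assume xh: "x \<in> carrier G" "h \<in> carrier G"
    have "\<phi> (x [^] p) * \<phi> ((x \<otimes> h) [^] p) = (\<phi> (x [^] p) * \<phi> (x [^] p)) * (\<phi> (h [^] p) * \<phi> (comm (inv x) h))"
      unfolding sq[OF xh] by (simp add: mult_ac)
    then show "\<phi> (x [^] p) * \<phi> ((x \<otimes> h) [^] p) = \<phi> (h [^] p) * \<phi> (comm (inv x) h)"
      unfolding \<phi>2[OF pow_p_D[OF xh(1)]] by simp
  qed
  also have "\<dots> = (\<Sum>h\<in>carrier G. \<phi> (h [^] p) * (\<Sum>x\<in>carrier G. \<phi> (comm (inv x) h)))"
    by (subst sum.swap) (simp add: sum_distrib_left)
  also have "\<dots> = (\<Sum>h\<in>carrier G. if h \<in> D then of_nat (card (carrier G)) else 0)"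
  proof (rule sum.cong[OF refl])
    fix h assume h: "h \<in> carrier G"
    have "\<phi> (h [^] p) = 1" if "h \<in> D" by (rule \<phi>U[OF pow_p_U[OF that]])
    then show "\<phi> (h [^] p) * (\<Sum>x\<in>carrier G. \<phi> (comm (inv x) h)) = (if h \<in> D then of_nat (card (carrier G)) else 0)"
      unfolding inner[OF h] by simp
  qed
  also have "\<dots> = (\<Sum>h\<in>D. of_nat (card (carrier G)))"
    by (rule sum.mono_neutral_cong_right) (use fin subgroup.subset[OF D] in auto)
  finally show ?thesis by simp
qed

text \<open>Summation over \<open>z\<close> before \<open>x\<close> is a character sum that detects
  whether \<open>x [^] p\<close> lies in \<open>Z0\<close>.\<close>

lemma gauss_total: "(\<Sum>z\<in>carrier G. gauss z) = of_nat (card (carrier G) * card {x \<in> carrier G. x [^] p \<in> Z0})"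
proof -
  have inner: "(\<Sum>z\<in>carrier G. \<chi> (comm c z)) = (if c \<in> Z0 then of_nat (card (carrier G)) else 0)" if c: "c \<in> D" for c
  proof (cases "c \<in> Z0")
    case False
    then obtain g where "g \<in> carrier G" "\<chi> (comm c g) \<noteq> 1" using c unfolding Z0_def by blast
    then have "(\<Sum>z\<in>carrier G. \<chi> (comm c z)) = 0"
      by (intro sum_character[OF subgroup_self]) (simp_all add: comm_mult_D_right comm_U c)
    then show ?thesis using False by simp
  qed simp
  have "(\<Sum>z\<in>carrier G. gauss z) = (\<Sum>x\<in>carrier G. \<Sum>z\<in>carrier G. \<chi> (comm (x [^] p) z))"
    unfolding gauss_def by (rule sum.swap)
  also have "\<dots> = (\<Sum>x\<in>carrier G. if x [^] p \<in> Z0 then of_nat (card (carrier G)) else 0)"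
    by (rule sum.cong[OF refl]) (rule inner[OF pow_p_D])
  also have "\<dots> = (\<Sum>x\<in>{x \<in> carrier G. x [^] p \<in> Z0}. of_nat (card (carrier G)))"
    by (rule sum.inter_filter[OF fin, symmetric])
  finally show ?thesis by (simp add: mult.commute)
qed

text \<open>A parity argument. Outside \<open>C\<close> the Gauss sum is M or -M with M^2 = |D| |G|,
  and it is constant on cosets of \<open>C\<close>, of which \<open>a\<close> and \<open>b\<close>
  carry the two signs. If the claim failed, 2 |C| would divide M and 2 M would divide |G|, and the
  total of the Gauss sums would force \<open>a + b\<close> to be even. But |G| / |C| = 1 + a + b is
  even too.\<close>

lemma even_bound:
  assumes p2: "p = 2"
  shows "card (carrier G) * card D \<le> card C * card C"
proof (rule ccontr)
  assume neg: "\<not> ?thesis"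
  let ?g = "card (carrier G)"
  obtain i j k where pw: "?g = 2 ^ i" "card D = 2 ^ j" "card C = 2 ^ k"
    using subgroup_card_power[OF subgroup_self] subgroup_card_power[OF D] subgroup_card_power[OF C_subgroup] unfolding p2 by metis
  have cl: "\<chi> (comm c (z \<otimes> y)) = \<chi> (comm c z)" if "c \<in> D" "z \<in> carrier G" "y \<in> C" for c z y
    using that comm_mult_D_right[OF that(1,2) CG[OF that(3)]] comm_U CG by simp
  have gcl: "gauss (z \<otimes> y) = gauss z" if "z \<in> carrier G" "y \<in> C" for z y
    unfolding gauss_def by (intro sum.cong refl cl pow_p_D that)
  have gC: "gauss z = of_nat ?g" if "z \<in> C" for z
    unfolding gauss_def using C_kills(1)[OF that pow_p_D] by simp
  have int: "\<exists>n::int. gauss z = of_int n" if z: "z \<in> carrier G" for z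
  proof -
    have "\<exists>n::int. \<chi> (comm (x [^] p) z) = of_int n" if "x \<in> carrier G" for x
      using even_sign[OF p2 comm_U[OF pow_p_D[OF that] z]] by (metis of_int_1 of_int_minus)
    then obtain n where "\<And>x. x \<in> carrier G \<Longrightarrow> \<chi> (comm (x [^] p) z) = of_int (n x)" by metis
    then have "gauss z = of_int (\<Sum>x\<in>carrier G. n x)" unfolding gauss_def by simp
    then show ?thesis by blast
  qed
  obtain x0 where x0: "x0 \<in> carrier G" "x0 \<notin> C" using exists_not_C by blast
  obtain m :: int where m: "gauss x0 = of_int m" using int[OF x0(1)] by blast
  define M where "M = nat \<bar>m\<bar>"
  have "of_int (m ^ 2) = (of_int (int (card D * ?g)) :: complex)"
    using gauss_square[OF p2 x0] unfolding m by simp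
  then have m2: "m ^ 2 = int (card D * ?g)" by (simp only: of_int_eq_iff)
  have "int (M ^ 2) = m ^ 2" by (simp add: M_def)
  then have M2: "M ^ 2 = card D * ?g" unfolding m2 by (simp only: of_nat_eq_iff)
  then have "M ^ 2 = 2 ^ (j + i)" using pw by (simp add: power_add)
  then have "M dvd 2 ^ (j + i)" by (metis dvd_triv_left power2_eq_square)
  then obtain l where l: "M = 2 ^ l" using divides_primepow_nat[of 2 M "j + i"] two_is_prime_nat by auto
  define P where "P = {z \<in> carrier G. z \<notin> C \<and> gauss z = of_nat M}"
  define Q where "Q = {z \<in> carrier G. z \<notin> C \<and> gauss z = - of_nat M}"
  have val: "gauss z = of_nat M \<or> gauss z = - of_nat M" if "z \<in> carrier G" "z \<notin> C" for z
  proof -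
    have "gauss z ^ 2 = (of_nat M) ^ 2"
      using gauss_square[OF p2 that] M2 by (simp flip: of_nat_power)
    then show ?thesis by (simp only: power2_eq_iff)
  qed
  have M0: "M > 0" using l by simp
  have notC: "z \<otimes> y \<notin> C" if "z \<in> carrier G" "z \<notin> C" "y \<in> C" for z y
  proof
    assume "z \<otimes> y \<in> C"
    then have "z \<otimes> y \<otimes> inv y \<in> C" using C_closed that by blast
    then show False using that CG by (simp add: m_assoc)
  qed
  have "card C dvd card P" "card C dvd card Q"
    by (rule card_dvd_of_right_closed[OF C_subgroup], use fin CG notC gcl in \<open>auto simp: P_def Q_def\<close>)+
  then obtain a b where ab: "card P = card C * a" "card Q = card C * b" by (elim dvdE)
  have PQ: "carrier G = C \<union> (P \<union> Q)" "C \<inter> (P \<union> Q) = {}" "P \<inter> Q = {}"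
    using val CG M0 unfolding P_def Q_def by auto
  have finPQ: "finite P" "finite Q" using fin unfolding P_def Q_def by auto
  have cardG: "?g = card C + (card P + card Q)"
    using PQ finPQ finC by (metis card_Un_disjoint finite_Un)
  define T where "T = {x \<in> carrier G. x [^] p \<in> Z0}"
  \<comment> \<open>\<open>T\<close> is stable under \<open>D\<close>, because the extra factors in
    the square of x d lie in \<open>U\<close>. The factor \<open>card D\<close> gained here combines
    with |G| to \<open>M ^ 2\<close>.\<close>
  have "card D dvd card T"
  proof (rule card_dvd_of_right_closed[OF D])
    show "finite T" using fin unfolding T_def by simp
    show "T \<subseteq> carrier G" unfolding T_def by blast
    fix x d assume x: "x \<in> T" and d: "d \<in> D"
    have xG: "x \<in> carrier G" "x [^] p \<in> Z0" using x unfolding T_def by auto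
    have "(x \<otimes> d) [^] p = x [^] p \<otimes> comm (inv x) d \<otimes> d [^] p"
      unfolding p2 comm_def using xG d by (simp add: numeral_2_eq_2 word_simps)
    then have "(x \<otimes> d) [^] p \<in> Z0"
      using Z0_closed(1) xG UZ0[OF comm_U_right[OF d, of "inv x"]] UZ0[OF pow_p_U[OF d]] by simp
    then show "x \<otimes> d \<in> T" using xG d unfolding T_def by simp
  qed
  then obtain t where t: "card T = card D * t" by (elim dvdE)
  have "(\<Sum>z\<in>carrier G. gauss z) = (\<Sum>z\<in>C. gauss z) + ((\<Sum>z\<in>P. gauss z) + (\<Sum>z\<in>Q. gauss z))"
    by (subst PQ(1)) (use PQ finPQ in \<open>simp add: sum.union_disjoint\<close>)
  also have "(\<Sum>z\<in>C. gauss z) = of_nat (card C * ?g)" using gC by simp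
  also have "(\<Sum>z\<in>P. gauss z) = of_nat (card C * a * M)" unfolding ab(1)[symmetric] by (simp add: P_def)
  also have "(\<Sum>z\<in>Q. gauss z) = - of_nat (card C * b * M)" unfolding ab(2)[symmetric] by (simp add: Q_def)
  finally have "of_nat (?g * (card D * t)) + of_nat (card C * b * M) = (of_nat (card C * ?g) + of_nat (card C * a * M) :: complex)"
    unfolding gauss_total T_def[symmetric] t by (simp add: algebra_simps)
  then have "?g * (card D * t) + card C * b * M = card C * ?g + card C * a * M"
    by (simp only: of_nat_add[symmetric] of_nat_eq_iff)
  then have eq: "M * M * t + card C * (b * M) = card C * (?g + a * M)"
    using M2 by (simp add: power2_eq_square algebra_simps)
  have CM: "2 * card C dvd M"
  proof (rule power_of_two_lt_dvd[OF pw(3) l])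
    have "card C ^ 2 < M ^ 2" using neg M2 by (simp add: power2_eq_square mult.commute)
    then show "card C < M" by (rule power2_less_imp_less) simp
  qed
  then obtain q where q: "M = 2 * card C * q" by (elim dvdE)
  \<comment> \<open>One factor \<open>M\<close> of \<open>M * M\<close> is replaced by
    \<open>2 * card C * q\<close>, so that \<open>card C\<close> cancels throughout.\<close>
  have "card C * (2 * M * q * t + b * M) = card C * (?g + a * M)"
    unfolding eq[symmetric] by (subst (2) q) (simp add: algebra_simps)
  then have e2: "2 * M * q * t + b * M = ?g + a * M" by (simp only: nat_mult_eq_cancel1[OF card_pos(3)])
  have "2 * M dvd ?g"
  proof (rule power_of_two_lt_dvd[OF l pw(1)])
    have "card D < ?g" using D_proper fin subgroup.subset[OF D] by (metis psubsetI psubset_card_mono)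
    then have "M ^ 2 < ?g ^ 2" unfolding M2 using card_pos(5) by (simp add: power2_eq_square)
    then show "M < ?g" by (rule power2_less_imp_less) simp
  qed
  then obtain w where w: "?g = 2 * M * w" by (elim dvdE)
  have "M * (2 * (q * t) + b) = M * (2 * w + a)" using e2 w by (simp add: algebra_simps)
  then have "2 * (q * t) + b = 2 * w + a" using M0 by simp
  then have even: "even (a + b)" by presburger
  have "2 * card C dvd ?g"
  proof (rule power_of_two_lt_dvd[OF pw(3) pw(1)])
    show "card C < ?g" using x0 fin CG by (metis psubset_card_mono psubsetI subsetI)
  qed
  then obtain v where "?g = 2 * card C * v" by (elim dvdE)
  then have "card C * (2 * v) = card C * (1 + (a + b))" using cardG ab by (simp add: algebra_simps)
  then have "2 * v = 1 + (a + b)" by (simp only: nat_mult_eq_cancel1[OF card_pos(3)])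
  then show False using even by presburger
qed

text \<open>Now |C|^2 = |G| |D|, so for \<open>x\<close> outside \<open>C\<close> the right radical
  in \<open>pairing_x\<close> is \<open>C\<close> itself, and the commutators of \<open>C\<close>
  with \<open>x\<close> together with \<open>Z0\<close> make up \<open>D\<close>. This gives
  \<open>\<chi> (c [^] p) = \<chi> (comm c x)\<close> for all such \<open>x\<close>. Hence the
  product of two elements outside \<open>C\<close> lies in \<open>C\<close>, the index of
  \<open>C\<close> is 2, and |C| \<le> 2 |D|: a quotient of order at most 2, too small for the
  nontrivial alternating form it carries.\<close>

lemma p_not_2: "p \<noteq> 2"
proof
  assume p2: "p = 2"
  let ?g = "card (carrier G)"
  have cc: "card C * card C = ?g * card D" using card_C_le even_bound[OF p2] by simp
  have DltG: "card D < ?g" using D_proper fin subgroup.subset[OF D] by (metis psubsetI psubset_card_mono)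
  have "card D * card D < card C * card C" unfolding cc using DltG card_pos(1) by simp
  then have "D \<noteq> C" by auto
  then obtain y where y: "y \<in> C" "y \<notin> D" using DC by blast
  have yG: "y \<in> carrier G" by (rule CG[OF y(1)])
  have key: "\<chi> (c [^] p) = \<chi> (comm c x)" if x: "x \<in> carrier G" "x \<notin> C" and c: "c \<in> D" for c x
  proof -
    \<comment> \<open>That this subgroup is all of \<open>D\<close> follows by comparing its
      radicals with those of \<open>D\<close> in the pairing with \<open>G\<close>.\<close>
    let ?H = "{comm y x \<otimes> z |y z. y \<in> C \<and> z \<in> Z0}"
    have HD: "?H \<subseteq> D" using comm_D CG x(1) Z0D by auto
    have Hs: "subgroup ?H G"
    proof (rule finite_subgroupI)
      show "finite ?H" by (rule finite_subset[OF HD finD])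
      show "?H \<subseteq> carrier G" by (rule subset_trans[OF HD subgroup.subset[OF D]])
      have "comm \<one> x \<otimes> \<one> \<in> ?H" using DC[OF D_closed(2)] UZ0[OF U_closed(2)] by blast
      then show "?H \<noteq> {}" by blast
      fix a b assume "a \<in> ?H" "b \<in> ?H"
      then obtain y1 z1 y2 z2 where ab: "y1 \<in> C" "z1 \<in> Z0" "a = comm y1 x \<otimes> z1" "y2 \<in> C" "z2 \<in> Z0" "b = comm y2 x \<otimes> z2" by blast
      have m: "comm y1 x \<in> D" "comm y2 x \<in> D" "z1 \<in> D" "z2 \<in> D" using ab comm_D CG x(1) Z0D by auto
      let ?u = "comm y1 (comm y2 x)"
      have u: "?u \<in> U" by (rule comm_U_right[OF m(2) CG[OF ab(1)]])
      have "comm (y1 \<otimes> y2) x = ?u \<otimes> comm y2 x \<otimes> comm y1 x"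
        by (rule comm_mult_left[OF CG[OF ab(1)] CG[OF ab(4)] x(1)])
      then have "a \<otimes> b = comm (y1 \<otimes> y2) x \<otimes> (inv ?u \<otimes> (z1 \<otimes> z2))"
      proof -
        have "comm (y1 \<otimes> y2) x \<otimes> (inv ?u \<otimes> (z1 \<otimes> z2)) = (?u \<otimes> (comm y2 x \<otimes> comm y1 x)) \<otimes> (inv ?u \<otimes> (z1 \<otimes> z2))"
          unfolding comm_mult_left[OF CG[OF ab(1)] CG[OF ab(4)] x(1)] using m u by (simp add: m_assoc)
        also have "\<dots> = ((comm y2 x \<otimes> comm y1 x) \<otimes> ?u) \<otimes> (inv ?u \<otimes> (z1 \<otimes> z2))"
          using U_central[OF u, of "comm y2 x \<otimes> comm y1 x"] m by simp
        also have "\<dots> = (comm y2 x \<otimes> comm y1 x) \<otimes> (z1 \<otimes> z2)" using m u by (simp add: m_assoc inv_cancel_left)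
        also have "\<dots> = (comm y1 x \<otimes> comm y2 x) \<otimes> (z1 \<otimes> z2)" using D_abelian[OF m(1,2)] by simp
        also have "\<dots> = comm y1 x \<otimes> (comm y2 x \<otimes> z1) \<otimes> z2" using m by (simp add: m_assoc)
        also have "comm y2 x \<otimes> z1 = z1 \<otimes> comm y2 x" by (rule D_abelian[OF m(2,3)])
        finally show ?thesis using ab m by (simp add: m_assoc)
      qed
      moreover have "y1 \<otimes> y2 \<in> C" "inv ?u \<otimes> (z1 \<otimes> z2) \<in> Z0"
        using C_closed(1)[OF ab(1,4)] Z0_closed(1)[OF UZ0[OF U_closed(3)[OF u]] Z0_closed(1)[OF ab(2,5)]] by simp_all
      ultimately show "a \<otimes> b \<in> ?H" by blast
    qed
    have finH: "finite ?H" by (rule finite_subset[OF HD finD])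
    have Z0H: "Z0 \<subseteq> ?H"
    proof
      fix z assume z: "z \<in> Z0"
      have "z = comm \<one> x \<otimes> z" using x(1) Z0D[OF z] by simp
      then show "z \<in> ?H" using z DC[OF D_closed(2)] by blast
    qed
    have left: "{h \<in> ?H. \<forall>g\<in>carrier G. \<chi> (comm h g) = 1} = Z0"
    proof
      show "{h \<in> ?H. \<forall>g\<in>carrier G. \<chi> (comm h g) = 1} \<subseteq> Z0" using HD unfolding Z0_def by blast
      show "Z0 \<subseteq> {h \<in> ?H. \<forall>g\<in>carrier G. \<chi> (comm h g) = 1}" using Z0H Z0_kills by blast
    qed
    have R: "{z \<in> carrier G. \<forall>y\<in>C. \<chi> (comm (comm y x) z) = 1} = C"
    proof (rule card_seteq[symmetric])
      show "finite {z \<in> carrier G. \<forall>y\<in>C. \<chi> (comm (comm y x) z) = 1}" using fin by simp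
      show "C \<subseteq> {z \<in> carrier G. \<forall>y\<in>C. \<chi> (comm (comm y x) z) = 1}" by (rule pairing_x(2)[OF x])
      show "card {z \<in> carrier G. \<forall>y\<in>C. \<chi> (comm (comm y x) z) = 1} \<le> card C"
        using pairing_x(1)[OF x] unfolding cc[symmetric] by (simp only: nat_mult_eq_cancel1[OF card_pos(3)])
    qed
    have right: "{g \<in> carrier G. \<forall>h\<in>?H. \<chi> (comm h g) = 1} = C"
    proof
      show "C \<subseteq> {g \<in> carrier G. \<forall>h\<in>?H. \<chi> (comm h g) = 1}" using HD C_kills(1) CG by blast
      show "{g \<in> carrier G. \<forall>h\<in>?H. \<chi> (comm h g) = 1} \<subseteq> C"
      proof
        fix g assume g: "g \<in> {g \<in> carrier G. \<forall>h\<in>?H. \<chi> (comm h g) = 1}"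
        have "\<chi> (comm (comm y x) g) = 1" if "y \<in> C" for y
        proof -
          have "comm y x \<otimes> \<one> \<in> ?H" using that UZ0[OF U_closed(2)] by blast
          moreover have "comm y x \<otimes> \<one> = comm y x" using CG[OF that] x(1) by simp
          ultimately show ?thesis using g by force
        qed
        then have "g \<in> {z \<in> carrier G. \<forall>y\<in>C. \<chi> (comm (comm y x) z) = 1}" using g by simp
        then show "g \<in> C" by (simp only: R)
      qed
    qed
    have "card ?H * card {g \<in> carrier G. \<forall>h\<in>?H. \<chi> (comm h g) = 1} = ?g * card {h \<in> ?H. \<forall>g\<in>carrier G. \<chi> (comm h g) = 1}"
    proof (rule pairing_card[OF Hs finH subgroup_self fin])
      fix a b t assume abt: "a \<in> ?H" "b \<in> ?H" "t \<in> carrier G"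
      then have ab: "a \<in> D" "b \<in> D" using HD by blast+
      show "\<chi> (comm (a \<otimes> b) t) = \<chi> (comm a t) * \<chi> (comm b t)"
        unfolding comm_mult_D_left[OF ab abt(3)] by (rule \<chi>_mult) (rule comm_U[OF ab(1) abt(3)] comm_U[OF ab(2) abt(3)])+
    next
      fix a s t assume abt: "a \<in> ?H" "s \<in> carrier G" "t \<in> carrier G"
      then have a: "a \<in> D" using HD by blast
      show "\<chi> (comm a (s \<otimes> t)) = \<chi> (comm a s) * \<chi> (comm a t)"
        unfolding comm_mult_D_right[OF a abt(2,3)] by (rule \<chi>_mult) (rule comm_U[OF a abt(2)] comm_U[OF a abt(3)])+
    qed
    then have "card ?H * card C = card D * card C" unfolding left right card_GZ0 .
    then have cH: "card ?H = card D" by (simp only: mult_cancel2) (use card_pos(3) in linarith)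
    have "?H = D" by (rule card_subset_eq[OF finD HD cH])
    then have "c \<in> ?H" using c by simp
    then obtain y1 z where yz: "y1 \<in> C" "z \<in> Z0" "c = comm y1 x \<otimes> z" by blast
    have m: "comm y1 x \<in> D" "z \<in> D" using yz comm_D CG x(1) Z0D by auto
    obtain w where w: "w \<in> carrier G" "comm y w = z" using camina[OF yG y(2) m(2)] by blast
    \<comment> \<open>An element of \<open>Z0\<close> is itself a commutator with \<open>y\<close>
      in \<open>C\<close>, so \<open>\<chi>\<close> of its square is measured by a commutator that
      \<open>\<chi>\<close> kills.\<close>
    have "\<chi> (z [^] p) = 1" using even_square[OF p2 y(1) w(1)] Z0_kills[OF yz(2) w(1)] unfolding w(2) by simp
    moreover have "c [^] p = comm y1 x [^] p \<otimes> z [^] p"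
      unfolding yz(3) using D_abelian[OF m] m by (intro pow_mult_distrib) auto
    ultimately have 1: "\<chi> (c [^] p) = \<chi> (comm y1 x [^] p)" using pow_p_U[OF m(1)] pow_p_U[OF m(2)] by simp
    have "comm c x = comm (comm y1 x) x \<otimes> comm z x" unfolding yz(3) by (rule comm_mult_D_left[OF m x(1)])
    then have "\<chi> (comm c x) = \<chi> (comm (comm y1 x) x)"
      using Z0_kills[OF yz(2) x(1)] comm_U[OF m(1) x(1)] comm_U[OF m(2) x(1)] by simp
    then show ?thesis using 1 even_square[OF p2 yz(1) x(1)] by simp
  qed
  obtain x where x: "x \<in> carrier G" "x \<notin> C" using exists_not_C by blast
  have inC: "x \<otimes> x' \<in> C" if x': "x' \<in> carrier G - C" for x'
  proof -
    have "\<chi> (comm c (x \<otimes> x')) = 1" if c: "c \<in> D" for c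
    proof -
      have x'': "x' \<in> carrier G" "x' \<notin> C" using x' by auto
      have "\<chi> (comm c (x \<otimes> x')) = \<chi> (c [^] p) * \<chi> (c [^] p)"
        unfolding comm_mult_D_right[OF c x(1) x''(1)] \<chi>_mult[OF comm_U[OF c x(1)] comm_U[OF c x''(1)]]
          key[OF x c, symmetric] key[OF x'' c, symmetric] ..
      then show ?thesis using even_sign[OF p2 pow_p_U[OF c]] by auto
    qed
    then show ?thesis using x(1) x' unfolding C_def by simp
  qed
  have "card (carrier G - C) \<le> card C"
  proof (rule card_inj_on_le)
    show "inj_on (\<lambda>x'. x \<otimes> x') (carrier G - C)"
      by (rule inj_onI) (use x in \<open>metis DiffD1 inv_cancel_left(2)\<close>)
    show "(\<lambda>x'. x \<otimes> x') ` (carrier G - C) \<subseteq> C" using inC by blast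
  qed simp
  moreover have "card (carrier G - C) = ?g - card C" using CG by (intro card_Diff_subset) auto
  ultimately have "?g \<le> 2 * card C" by simp
  then have "card C * card C \<le> (2 * card C) * card D" unfolding cc by (rule mult_le_mono1)
  then have "card C * card C \<le> card C * (2 * card D)" by (simp only: mult_ac)
  then have C2: "card C \<le> 2 * card D" using card_pos(3) by (metis mult_le_cancel1)
  obtain u where u: "u \<in> U" "\<chi> u \<noteq> 1" using \<chi>_nontrivial by blast
  \<comment> \<open>A partner \<open>w\<close> at which the form with \<open>y\<close> is nontrivial
    lies in \<open>C\<close>, yet in neither of the cosets of \<open>D\<close> that now exhaust
    \<open>C\<close>.\<close>
  obtain w where w: "w \<in> carrier G" "comm y w = u" using camina[OF yG y(2) UDm[OF u(1)]] by blast
  have wC: "w \<in> C" using comm_Z0_iff[OF y w(1)] w(2) UZ0[OF u(1)] by simp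
  have wD: "w \<notin> D" using C_kills(2)[OF y(1), of w] w(2) u(2) by metis
  have wyD: "w \<noteq> y \<otimes> d" if d: "d \<in> D" for d
  proof
    assume "w = y \<otimes> d"
    then have "comm y w = comm y d" using yG d comm_mult_right[OF yG yG, of d] by simp
    then show False using C_kills(2)[OF y(1) d] w(2) u(2) by simp
  qed
  let ?yD = "(\<lambda>d. y \<otimes> d) ` D"
  have "D \<inter> ?yD = {}"
  proof (rule ccontr)
    assume "D \<inter> ?yD \<noteq> {}"
    then obtain d where d: "d \<in> D" "y \<otimes> d \<in> D" by blast
    then have "(y \<otimes> d) \<otimes> inv d \<in> D" by simp
    then show False using y d yG by (simp add: m_assoc)
  qed
  then have cU: "card (D \<union> ?yD) = card D + card ?yD" by (intro card_Un_disjoint) auto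
  have "inj_on (\<lambda>d. y \<otimes> d) D" by (rule inj_onI) (use yG DG in \<open>metis inv_cancel_left(2)\<close>)
  then have "card ?yD = card D" by (rule card_image)
  then have "card C \<le> card (D \<union> ?yD)" using cU C2 by simp
  moreover have "D \<union> ?yD \<subseteq> C" using DC C_closed(1)[OF y(1)] by blast
  ultimately have "D \<union> ?yD = C" by (intro card_seteq) auto
  then show False using wC wD wyD by blast
qed

section \<open>The alternating form on C for odd p\<close>

lemma p_odd: "odd p"
  using p p_not_2 by (metis primes_dvd_imp_eq two_is_prime_nat)

lemma Z0_U: "Z0 = U" by (rule odd_structure(1)[OF p_odd])

text \<open>For \<open>a\<close> outside \<open>D\<close>, \<open>comm_Z0_iff\<close> puts the
  commutator in \<open>Z0\<close>, now known to be \<open>U\<close>. Thus \<open>C\<close> has class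
  at most 2 although \<open>G\<close> has class 3.\<close>

lemma comm_C: assumes "a \<in> C" "b \<in> C" shows "comm a b \<in> U"
proof (cases "a \<in> D")
  case True
  then show ?thesis using comm_U CG[OF assms(2)] by blast
next
  case False
  then show ?thesis using comm_Z0_iff[OF assms(1) False CG[OF assms(2)]] assms(2) Z0_U by simp
qed

lemma comm_C_mult_left:
  assumes "a \<in> C" "a' \<in> C" "b \<in> C"
  shows "comm (a \<otimes> a') b = comm a b \<otimes> comm a' b"
proof -
  have u: "comm a' b \<in> U" "comm a b \<in> U" using comm_C assms by auto
  have "comm (a \<otimes> a') b = comm a (comm a' b) \<otimes> comm a' b \<otimes> comm a b"
    by (rule comm_mult_left) (use assms CG in auto)
  also have "comm a (comm a' b) = \<one>" by (rule comm_central(2)[OF u(1) CG[OF assms(1)]])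
  finally show ?thesis using U_central[OF u(1), of "comm a b"] u by simp
qed

lemma comm_C_mult_right:
  assumes "a \<in> C" "b \<in> C" "b' \<in> C"
  shows "comm a (b \<otimes> b') = comm a b \<otimes> comm a b'"
proof -
  have u: "comm a b' \<in> U" "comm a b \<in> U" using comm_C assms by auto
  have "comm a (b \<otimes> b') = comm a b \<otimes> comm b (comm a b') \<otimes> comm a b'"
    by (rule comm_mult_right) (use assms CG in auto)
  also have "comm b (comm a b') = \<one>" by (rule comm_central(2)[OF u(1) CG[OF assms(2)]])
  finally show ?thesis using u by simp
qed

lemma C_pow: "a \<in> C \<Longrightarrow> a [^] (n::nat) \<in> C"
  by (induction n) (use DC[OF D_closed(2)] C_closed(1) in auto)

lemma C_form_mult:
  assumes "a \<in> C" "a' \<in> C" "b \<in> C"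
  shows "\<chi> (comm (a \<otimes> a') b) = \<chi> (comm a b) * \<chi> (comm a' b)"
    and "\<chi> (comm b (a \<otimes> a')) = \<chi> (comm b a) * \<chi> (comm b a')"
  using comm_C_mult_left[OF assms] comm_C_mult_right[OF assms(3,1,2)]
    \<chi>_mult[OF comm_C[OF assms(1,3)] comm_C[OF assms(2,3)]] \<chi>_mult[OF comm_C[OF assms(3,1)] comm_C[OF assms(3,2)]]
  by simp_all

lemma C_form_swap: "a \<in> C \<Longrightarrow> b \<in> C \<Longrightarrow> \<chi> (comm b a) = inverse (\<chi> (comm a b))"
  using \<chi>_inv[OF comm_C[of a b]] inv_comm[of a b] CG by simp

text \<open>Nondegeneracy of the form on \<open>C\<close> modulo \<open>D\<close>: the Camina
  condition provides \<open>b\<close> with \<open>comm a b = u\<close> in \<open>U\<close>, and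
  since \<open>U\<close> lies in \<open>Z0\<close> this \<open>b\<close> belongs to
  \<open>C\<close>.\<close>

lemma C_radical:
  assumes "a \<in> C" "a \<notin> D" shows "\<exists>b\<in>C. \<chi> (comm a b) \<noteq> 1"
proof -
  obtain u where u: "u \<in> U" "\<chi> u \<noteq> 1" using \<chi>_nontrivial by blast
  obtain b where b: "b \<in> carrier G" "comm a b = u" using camina[OF CG[OF assms(1)] assms(2) UDm[OF u(1)]] by blast
  then have "b \<in> C" using comm_Z0_iff[OF assms b(1)] UZ0[OF u(1)] by simp
  then show ?thesis using b u by blast
qed

text \<open>Collection in class 2. For \<open>n = p\<close> odd the last factor disappears, so
  \<open>\<chi>\<close> of the \<open>p\<close>-th power is multiplicative on
  \<open>C\<close>.\<close>

lemma pow_mult_C: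
  assumes "a \<in> C" "b \<in> C"
  shows "(a \<otimes> b) [^] (n::nat) = a [^] n \<otimes> b [^] n \<otimes> comm b a [^] (n * (n - 1) div 2)"
proof (induction n)
  case (Suc n)
  let ?z = "comm b a" and ?N = "n * (n - 1) div 2"
  have z: "?z \<in> U" by (rule comm_C[OF assms(2,1)])
  have G: "a \<in> carrier G" "b \<in> carrier G" "?z \<in> carrier G" using assms CG z by auto
  have zc: "?z [^] k \<otimes> x = x \<otimes> ?z [^] k" if "x \<in> carrier G" for x and k :: nat
    using U_central[OF U_pow[OF z] that] .
  have "comm (b [^] m) a = ?z [^] m" for m :: nat
  proof (induction m)
    case (Suc m)
    have "comm (b [^] m \<otimes> b) a = comm (b [^] m) a \<otimes> comm b a"
      by (rule comm_C_mult_left[OF C_pow[OF assms(2)] assms(2,1)])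
    then show ?case using Suc by simp
  qed (use G in simp)
  then have sw: "b [^] n \<otimes> a = ?z [^] n \<otimes> (a \<otimes> b [^] n)"
    using comm_swap[of "b [^] n" a] G by simp
  have "(a \<otimes> b) [^] Suc n = a [^] n \<otimes> b [^] n \<otimes> ?z [^] ?N \<otimes> (a \<otimes> b)" using Suc by simp
  also have "\<dots> = a [^] n \<otimes> b [^] n \<otimes> (?z [^] ?N \<otimes> (a \<otimes> b))" using G by (simp add: m_assoc)
  also have "?z [^] ?N \<otimes> (a \<otimes> b) = (a \<otimes> b) \<otimes> ?z [^] ?N" by (rule zc) (use G in simp)
  also have "a [^] n \<otimes> b [^] n \<otimes> ((a \<otimes> b) \<otimes> ?z [^] ?N) = a [^] n \<otimes> (b [^] n \<otimes> a) \<otimes> (b \<otimes> ?z [^] ?N)"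
    using G by (simp add: m_assoc)
  also have "\<dots> = a [^] n \<otimes> (?z [^] n \<otimes> (a \<otimes> b [^] n \<otimes> b)) \<otimes> ?z [^] ?N"
    unfolding sw using G by (simp add: m_assoc)
  also have "?z [^] n \<otimes> (a \<otimes> b [^] n \<otimes> b) = (a \<otimes> b [^] n \<otimes> b) \<otimes> ?z [^] n" by (rule zc) (use G in simp)
  also have "a [^] n \<otimes> ((a \<otimes> b [^] n \<otimes> b) \<otimes> ?z [^] n) \<otimes> ?z [^] ?N
      = a [^] Suc n \<otimes> b [^] Suc n \<otimes> (?z [^] n \<otimes> ?z [^] ?N)"
    using G by (simp add: m_assoc)
  also have "?z [^] n \<otimes> ?z [^] ?N = ?z [^] (n + ?N)" by (rule nat_pow_mult[OF G(3)])
  also have "n + ?N = Suc n * (Suc n - 1) div 2" by (cases n) (auto simp: algebra_simps)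
  finally show ?case .
qed simp

lemma p_triangle: "u \<in> U \<Longrightarrow> u [^] (p * (p - 1) div 2) = \<one>"
proof -
  assume u: "u \<in> U"
  have "p * (p - 1) div 2 = p * ((p - 1) div 2)" using p_odd by (simp add: div_mult_swap)
  then show ?thesis using u pow_p_one[OF u] by (simp flip: nat_pow_pow)
qed

text \<open>Since \<open>Z0 = U\<close>, it suffices that \<open>\<chi>\<close> kills
  \<open>comm (y [^] p) x\<close>. Up to a factor in the kernel of \<open>\<chi>\<close> this is the
  \<open>p\<close>-th power of \<open>comm y x\<close>, an element of \<open>D\<close>, and
  \<open>\<chi>\<close> is trivial on such powers.\<close>

lemma pow_p_C: assumes y: "y \<in> C" shows "y [^] p \<in> U"
proof -
  have yG: "y \<in> carrier G" by (rule CG[OF y])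
  have "\<chi> (comm (y [^] p) x) = 1" if x: "x \<in> carrier G" for x
  proof -
    let ?d = "comm y x"
    have d: "?d \<in> D" by (rule comm_D[OF yG x])
    have ex: "\<exists>k\<in>U. \<chi> k = 1 \<and> comm (y [^] n) x = k \<otimes> ?d [^] n" for n :: nat
    proof (induction n)
      case 0
      show ?case using x by (intro bexI[of _ \<one>]) auto
    next
      case (Suc n)
      then obtain k where k: "k \<in> U" "\<chi> k = 1" "comm (y [^] n) x = k \<otimes> ?d [^] n" by blast
      let ?l = "comm (y [^] n) ?d"
      have l: "?l \<in> U" "\<chi> ?l = 1" by (rule comm_U_right[OF d], use yG in simp) (rule C_kills(2)[OF C_pow[OF y] d])
      have "comm (y [^] n \<otimes> y) x = ?l \<otimes> ?d \<otimes> comm (y [^] n) x" by (rule comm_mult_left) (use yG x in auto)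
      also have "\<dots> = ?l \<otimes> (?d \<otimes> k) \<otimes> ?d [^] n" unfolding k(3) using k(1) l(1) d by (simp add: m_assoc)
      also have "?d \<otimes> k = k \<otimes> ?d" using U_central[OF k(1)] d by simp
      also have "?l \<otimes> (k \<otimes> ?d) \<otimes> ?d [^] n = (?l \<otimes> k) \<otimes> (?d \<otimes> ?d [^] n)" using k(1) l(1) d by (simp add: m_assoc)
      also have "?d \<otimes> ?d [^] n = ?d [^] Suc n" using nat_pow_Suc2[of ?d n] d by simp
      finally show ?case using k l by (intro bexI[of _ "?l \<otimes> k"]) auto
    qed
    obtain k where k: "k \<in> U" "\<chi> k = 1" "comm (y [^] p) x = k \<otimes> ?d [^] p" using ex by blast
    then show ?thesis using pow_p_U[OF d] odd_D_pow[OF p_odd d] by simp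
  qed
  then have "y [^] p \<in> Z0" unfolding Z0_def using pow_p_D[OF yG] by simp
  then show ?thesis using Z0_U by simp
qed

lemma \<chi>_pow_mult:
  assumes "a \<in> C" "b \<in> C" shows "\<chi> ((a \<otimes> b) [^] p) = \<chi> (a [^] p) * \<chi> (b [^] p)"
  using pow_mult_C[OF assms, of p] p_triangle[OF comm_C[OF assms(2,1)]] pow_p_C[OF assms(1)] pow_p_C[OF assms(2)]
  by simp

sublocale CD: elementary_section G C D p
proof (intro elementary_section.intro elementary_section_axioms.intro)
  show "D \<subseteq> C" using DC by blast
  show "comm x y \<in> D" if "x \<in> C" "y \<in> C" for x y by (rule UDm[OF comm_C[OF that]])
  show "x [^] p \<in> D" if "x \<in> C" for x by (rule UDm[OF pow_p_C[OF that]])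
qed (rule group_axioms C_subgroup D finC p)+

declare CD.SG [simp del] CD.S_closed [simp del] CD.pow_closed [simp del] CD.M_closed [simp del] CD.M_S [simp del]
declare D_closed [simp] DG [simp]

section \<open>Isotropic subgroups\<close>

definition perp :: "'a set \<Rightarrow> 'a set" where
  "perp A = {y \<in> C. \<forall>a\<in>A. \<chi> (comm a y) = 1}"

definition isotropic :: "'a set \<Rightarrow> bool" where
  "isotropic A \<longleftrightarrow> subgroup A G \<and> D \<subseteq> A \<and> A \<subseteq> C \<and> (\<forall>a\<in>A. \<forall>b\<in>A. \<chi> (comm a b) = 1)"

text \<open>In the pairing of \<open>A\<close> with \<open>C\<close> the left radical is
  \<open>D\<close>, by nondegeneracy, and the right radical is \<open>perp A\<close>.\<close>

lemma perp_card:
  assumes A: "isotropic A"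
  shows "card A * card (perp A) = card C * card D"
proof -
  have AC: "A \<subseteq> C" "D \<subseteq> A" and As: "subgroup A G" using A unfolding isotropic_def by auto
  have "{a \<in> A. \<forall>y\<in>C. \<chi> (comm a y) = 1} = D"
  proof
    show "D \<subseteq> {a \<in> A. \<forall>y\<in>C. \<chi> (comm a y) = 1}" using AC C_kills(1) by blast
    show "{a \<in> A. \<forall>y\<in>C. \<chi> (comm a y) = 1} \<subseteq> D" using C_radical AC by blast
  qed
  moreover have "card A * card {y \<in> C. \<forall>a\<in>A. \<chi> (comm a y) = 1} = card C * card {a \<in> A. \<forall>y\<in>C. \<chi> (comm a y) = 1}"
  proof (rule pairing_card[OF As finite_subset[OF AC(1) finC] C_subgroup finC])
    show "\<chi> (comm (x \<otimes> y) t) = \<chi> (comm x t) * \<chi> (comm y t)" if "x \<in> A" "y \<in> A" "t \<in> C" for x y t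
      by (rule C_form_mult(1)[OF subsetD[OF AC(1) that(1)] subsetD[OF AC(1) that(2)] that(3)])
    show "\<chi> (comm s (x \<otimes> y)) = \<chi> (comm s x) * \<chi> (comm s y)" if "s \<in> A" "x \<in> C" "y \<in> C" for s x y
      by (rule C_form_mult(2)[OF that(2,3) subsetD[OF AC(1) that(1)]])
  qed
  ultimately show ?thesis unfolding perp_def by simp
qed

lemma perp_subgroup: assumes "A \<subseteq> C" shows "subgroup (perp A) G"
proof (rule finite_subgroupI)
  show "finite (perp A)" unfolding perp_def by simp
  show "perp A \<subseteq> carrier G" unfolding perp_def using CG by blast
  have "\<one> \<in> perp A" unfolding perp_def using DC[OF D_closed(2)] assms CG by auto
  then show "perp A \<noteq> {}" by blast
  fix x y assume "x \<in> perp A" "y \<in> perp A"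
  then show "x \<otimes> y \<in> perp A" using C_closed(1)[of x y] C_form_mult(2) assms unfolding perp_def by auto
qed

text \<open>Take an isotropic subgroup of \<open>W\<close> of largest order. An element
  \<open>y\<close> of \<open>perp A\<close> in \<open>W\<close> but outside \<open>A\<close> could
  be adjoined, since the form vanishes between any two powers of \<open>y\<close>.\<close>

lemma maximal_isotropic:
  assumes W: "subgroup W G" "D \<subseteq> W" "W \<subseteq> C"
  obtains A where "isotropic A" "A \<subseteq> W" "perp A \<inter> W = A"
proof -
  let ?P = "\<lambda>A. isotropic A \<and> A \<subseteq> W"
  have "?P D" unfolding isotropic_def using D W DC by auto
  moreover have "card A < Suc (card C)" if "?P A" for A
    using card_mono[OF finC] that unfolding isotropic_def by (simp add: less_Suc_eq_le)
  ultimately obtain A where A: "isotropic A" "A \<subseteq> W" and Amax: "\<And>A'. ?P A' \<Longrightarrow> card A' \<le> card A"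
    using ex_has_greatest_nat[of ?P D card "Suc (card C)"] by blast
  have As: "subgroup A G" "D \<subseteq> A" "A \<subseteq> C" and iso: "\<And>a b. a \<in> A \<Longrightarrow> b \<in> A \<Longrightarrow> \<chi> (comm a b) = 1"
    using A(1) unfolding isotropic_def by auto
  have "y \<in> A" if y: "y \<in> perp A" "y \<in> W" for y
  proof (rule ccontr)
    assume yA: "y \<notin> A"
    have yC: "y \<in> C" and yp: "\<And>a. a \<in> A \<Longrightarrow> \<chi> (comm a y) = 1" using y(1) unfolding perp_def by auto
    let ?A' = "{x \<in> C. \<exists>i::nat. x \<otimes> inv (y [^] i) \<in> A}"
    have rep: "\<exists>a\<in>A. \<exists>i::nat. x = a \<otimes> y [^] i" if xA': "x \<in> ?A'" for x
    proof -
      obtain i :: nat where i: "x \<in> C" "x \<otimes> inv (y [^] i) \<in> A" using xA' by blast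
      have "x = (x \<otimes> inv (y [^] i)) \<otimes> y [^] i" using CG[OF i(1)] CG[OF yC] by (simp add: m_assoc)
      then show ?thesis using i(2) by blast
    qed
    have "subgroup ?A' G"
    proof (rule finite_subgroupI)
      show "finite ?A'" by simp
      show "?A' \<subseteq> carrier G" using CG by blast
      have "\<one> \<otimes> inv (y [^] (0::nat)) \<in> A" using subgroup.one_closed[OF As(1)] by simp
      then show "?A' \<noteq> {}" using DC[OF D_closed(2)] by blast
      fix x x' assume "x \<in> ?A'" "x' \<in> ?A'"
      then obtain i j :: nat where x: "x \<in> C" "x' \<in> C" "x \<otimes> inv (y [^] i) \<in> A" "x' \<otimes> inv (y [^] j) \<in> A" by blast
      have "x \<otimes> x' \<otimes> inv (y [^] i \<otimes> y [^] j) \<in> A"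
        by (rule CD.coset_mult[OF As x(1,2) C_pow[OF yC] C_pow[OF yC] x(3,4)])
      then have "x \<otimes> x' \<otimes> inv (y [^] (i + j)) \<in> A" using CG[OF yC] by (simp add: nat_pow_mult)
      then show "x \<otimes> x' \<in> ?A'" using C_closed(1)[OF x(1,2)] by blast
    qed
    moreover have AA': "A \<subseteq> ?A'"
    proof
      fix a assume a: "a \<in> A"
      then have "a \<otimes> inv (y [^] (0::nat)) \<in> A" using subgroup.mem_carrier[OF As(1)] by simp
      then show "a \<in> ?A'" using a As(3) by blast
    qed
    moreover have yA': "y \<in> ?A'"
    proof -
      have "y \<otimes> inv (y [^] (1::nat)) \<in> A" using CG[OF yC] subgroup.one_closed[OF As(1)] by simp
      then show ?thesis using yC by blast
    qed
    moreover have "\<chi> (comm x x') = 1" if xx': "x \<in> ?A'" "x' \<in> ?A'" for x x'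
    proof -
      obtain a i a' j where x: "a \<in> A" "x = a \<otimes> y [^] (i::nat)" "a' \<in> A" "x' = a' \<otimes> y [^] (j::nat)"
        using rep[OF xx'(1)] rep[OF xx'(2)] by blast
      have aC: "a \<in> C" "a' \<in> C" using x As(3) by auto
      have yy: "\<chi> (comm c (y [^] k)) = 1" if "c \<in> C" "\<chi> (comm c y) = 1" for c and k :: nat
      proof (induction k)
        case (Suc k)
        then show ?case using C_form_mult(2)[OF C_pow[OF yC] yC that(1)] that(2) by simp
      qed (use CG[OF that(1)] in simp)
      have 1: "\<chi> (comm a (y [^] j)) = 1" by (rule yy[OF aC(1) yp[OF x(1)]])
      have "\<chi> (comm a' (y [^] i)) = 1" by (rule yy[OF aC(2) yp[OF x(3)]])
      then have 2: "\<chi> (comm (y [^] i) a') = 1" using C_form_swap[OF aC(2) C_pow[OF yC]] by simp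
      have "\<chi> (comm y (y [^] i)) = 1" by (rule yy[OF yC]) (use CG[OF yC] in simp)
      then have "\<chi> (comm (y [^] i) y) = 1" using C_form_swap[OF yC C_pow[OF yC]] by simp
      then have 3: "\<chi> (comm (y [^] i) (y [^] j)) = 1" by (rule yy[OF C_pow[OF yC]])
      show ?thesis unfolding x(2,4)
        using C_form_mult(1)[OF aC(1) C_pow[OF yC] C_closed(1)[OF aC(2) C_pow[OF yC]]]
          C_form_mult(2)[OF aC(2) C_pow[OF yC] aC(1)] C_form_mult(2)[OF aC(2) C_pow[OF yC] C_pow[OF yC]]
          1 2 3 iso[OF x(1,3)] by simp
    qed
    moreover have "?A' \<subseteq> W"
    proof
      fix x assume "x \<in> ?A'"
      then obtain a i where x: "a \<in> A" "x = a \<otimes> y [^] (i::nat)" using rep by blast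
      have "y [^] i \<in> W" by (induction i) (use y(2) subgroup.one_closed[OF W(1)] subgroup.m_closed[OF W(1)] in auto)
      then show "x \<in> W" unfolding x(2) using A(2) x(1) subgroup.m_closed[OF W(1)] by blast
    qed
    ultimately have "?P ?A'" unfolding isotropic_def using As(2) by blast
    then have "card ?A' \<le> card A" by (rule Amax)
    moreover have "card A < card ?A'" by (rule psubset_card_mono) (use AA' yA' yA in auto)
    ultimately show False by simp
  qed
  moreover have "A \<subseteq> perp A" unfolding perp_def using As(3) iso by blast
  ultimately have "perp A \<inter> W = A" using A(2) by blast
  then show ?thesis using that A by blast
qed

lemma roots_image: "finite (\<chi> ` U)" "\<chi> ` U \<subseteq> {z. z ^ p = 1}"
  using finU \<chi>_pow[of _ p] pow_p_one by auto

text \<open>Two demands compete: \<open>A\<close> should be its own perpendicular, and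
  \<open>\<chi>\<close> should be trivial on its \<open>p\<close>-th powers. A maximal isotropic
  \<open>A\<close> inside the kernel of \<open>\<chi> (y [^] p)\<close> loses at most a factor
  \<open>p\<close>, since \<open>perp A\<close> modulo \<open>A\<close> embeds in the
  \<open>p\<close>-th roots of unity. But |A| |perp A| is an even power of \<open>p\<close>, so the
  index of \<open>A\<close> in \<open>perp A\<close> cannot be \<open>p\<close>, and nothing is
  lost.\<close>

lemma half_order:
  "\<exists>A. isotropic A \<and> (\<forall>a\<in>A. \<chi> (a [^] p) = 1) \<and> card A * card A = card (carrier G) * card U"
proof -
  let ?W = "{y \<in> C. \<chi> (y [^] p) = 1}"
  have Ws: "subgroup ?W G"
  proof (rule finite_subgroupI)
    show "?W \<subseteq> carrier G" using CG by blast
    have "\<one> \<in> ?W" using DC[OF D_closed(2)] by simp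
    then show "?W \<noteq> {}" by blast
  qed (use finC C_closed(1) \<chi>_pow_mult in auto)
  have DW: "D \<subseteq> ?W" using DC odd_D_pow[OF p_odd] by blast
  obtain A where A: "isotropic A" "A \<subseteq> ?W" "perp A \<inter> ?W = A" using maximal_isotropic[OF Ws DW] by blast
  have DC': "D \<subseteq> C" using DC by blast
  \<comment> \<open>A maximal isotropic subgroup of all of \<open>C\<close> serves to show that
    \<open>card C * card D\<close> is a perfect square.\<close>
  obtain B where B: "isotropic B" "B \<subseteq> C" "perp B \<inter> C = B" using maximal_isotropic[OF C_subgroup DC' subset_refl] by blast
  have "perp B = B" using B(3) unfolding perp_def by blast
  then have cB: "card B * card B = card C * card D" using perp_card[OF B(1)] by simp
  have As: "subgroup A G" "A \<subseteq> C" and Bs: "subgroup B G" using A(1) B(1) unfolding isotropic_def by auto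
  have Ps: "subgroup (perp A) G" by (rule perp_subgroup[OF As(2)])
  have PC: "perp A \<subseteq> C" unfolding perp_def by blast
  have "card (perp A) = card ((\<lambda>y. \<chi> (y [^] p)) ` perp A) * card A"
  proof (rule card_fibres[OF Ps finite_subset[OF PC finC] As(1)])
    show "A \<subseteq> perp A" using A(3) by blast
    fix g h assume gh: "g \<in> perp A" "h \<in> perp A"
    then have gC: "g \<in> C" "h \<in> C" using PC by auto
    have e: "\<chi> ((inv g \<otimes> h) [^] p) = inverse (\<chi> (g [^] p)) * \<chi> (h [^] p)"
    proof -
      have "(inv g) [^] p = inv (g [^] p)" using CG[OF gC(1)] by (simp add: nat_pow_inv)
      then show ?thesis using \<chi>_pow_mult[OF C_closed(2)[OF gC(1)] gC(2)] pow_p_C[OF gC(1)] by simp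
    qed
    have nz: "\<chi> (g [^] p) \<noteq> 0" using pow_p_C[OF gC(1)] by simp
    have m: "inv g \<otimes> h \<in> perp A" "inv g \<otimes> h \<in> C"
      using subgroup.m_closed[OF Ps subgroup.m_inv_closed[OF Ps gh(1)] gh(2)] PC by auto
    have "\<chi> (g [^] p) = \<chi> (h [^] p) \<longleftrightarrow> \<chi> ((inv g \<otimes> h) [^] p) = 1"
      unfolding e using nz by (auto simp: field_simps)
    also have "\<dots> \<longleftrightarrow> inv g \<otimes> h \<in> A"
    proof
      assume "\<chi> ((inv g \<otimes> h) [^] p) = 1"
      then have "inv g \<otimes> h \<in> perp A \<inter> ?W" using m by blast
      then show "inv g \<otimes> h \<in> A" using A(3) by blast
    qed (use A(2) in blast)
    finally show "\<chi> (g [^] p) = \<chi> (h [^] p) \<longleftrightarrow> inv g \<otimes> h \<in> A" .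
  qed
  moreover have "card ((\<lambda>y. \<chi> (y [^] p)) ` perp A) \<le> p"
  proof -
    have "(\<lambda>y. \<chi> (y [^] p)) ` perp A \<subseteq> {z. z ^ p = 1}" using pow_p_C PC roots_image(2) by blast
    moreover have "finite {z :: complex. z ^ p = 1}" "card {z :: complex. z ^ p = 1} = p"
      using finite_roots_unity[of p, where ?'a=complex] card_roots_unity_eq[of p] prime_gt_0_nat[OF p] by simp_all
    ultimately show ?thesis by (metis card_mono)
  qed
  ultimately have le: "card (perp A) \<le> p * card A" by simp
  have ge: "card A \<le> card (perp A)" using A(3) finite_subset[OF PC finC] by (intro card_mono) auto
  obtain a b q where pw: "card A = p ^ a" "card B = p ^ b" "card (perp A) = p ^ q"
    using subgroup_card_power[OF As(1)] subgroup_card_power[OF Bs] subgroup_card_power[OF Ps] by metis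
  have p1: "1 < p" by (rule prime_gt_1_nat[OF p])
  have "p ^ (a + q) = p ^ (b + b)" using perp_card[OF A(1)] cB pw by (simp add: power_add)
  then have e: "a + q = b + b" using p1 by (simp only: power_inject_exp)
  have "p ^ q \<le> p ^ Suc a" using le pw by simp
  then have "q \<le> Suc a" using p1 by (simp only: power_increasing_iff)
  moreover have "a \<le> q" using ge pw p1 by simp
  ultimately have "a = q" using e by presburger
  then have "card A * card A = card C * card D" using perp_card[OF A(1)] pw by simp
  then have "card A * card A = card (carrier G) * card U" using odd_structure(2)[OF p_odd] by simp
  then show ?thesis using A by blast
qed

text \<open>Modulo the kernel of \<open>\<chi>\<close> in \<open>U\<close>, the subgroup
  \<open>A\<close> of \<open>half_order\<close> is elementary abelian and the image of
  \<open>U\<close> has order \<open>p\<close>. A functional that is nonzero on this image has a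
  kernel \<open>H\<close> of index \<open>p\<close> in \<open>A\<close>, meeting \<open>U\<close>
  only in the kernel of \<open>\<chi>\<close>. The number \<open>s\<close> is the index of
  \<open>U\<close> in \<open>A\<close>, equal to that of \<open>A\<close> in
  \<open>G\<close>.\<close>

lemma complement_subgroup:
  "\<exists>H s. subgroup H G \<and> (\<forall>u\<in>H \<inter> U. \<chi> u = 1) \<and> card (carrier G) = s * s * card U \<and> card (carrier G) = p * s * card H"
proof -
  obtain A where A: "isotropic A" "\<forall>a\<in>A. \<chi> (a [^] p) = 1" "card A * card A = card (carrier G) * card U"
    using half_order by blast
  have As: "subgroup A G" "D \<subseteq> A" "A \<subseteq> C" and iso: "\<And>a b. a \<in> A \<Longrightarrow> b \<in> A \<Longrightarrow> \<chi> (comm a b) = 1"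
    using A(1) unfolding isotropic_def by auto
  have finA: "finite A" by (rule finite_subset[OF As(3) finC])
  let ?K = "{u \<in> U. \<chi> u = 1}"
  have Ks: "subgroup ?K G"
  proof (rule finite_subgroupI)
    have "\<one> \<in> ?K" by simp
    then show "?K \<noteq> {}" by blast
  qed auto
  have KA: "?K \<subseteq> A" using As(2) by auto
  interpret AK: elementary_section G A ?K p
  proof (intro elementary_section.intro elementary_section_axioms.intro)
    show "comm x y \<in> ?K" if "x \<in> A" "y \<in> A" for x y using comm_C[of x y] iso[OF that] that As(3) by auto
    show "x [^] p \<in> ?K" if "x \<in> A" for x using pow_p_C[of x] A(2) that As(3) by auto
  qed (rule group_axioms As Ks KA finA p)+
  obtain u where u: "u \<in> U" "\<chi> u \<noteq> 1" using \<chi>_nontrivial by blast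
  have uA: "u \<in> A" using u As(2) by auto
  obtain f where f: "padd p G A f" "\<And>n. n \<in> ?K \<Longrightarrow> [f n = 0] (mod int p)" "f u = 1"
    using AK.exists_functional[of u] uA u by blast
  let ?H = "{a \<in> A. [f a = 0] (mod int p)}"
  have f_mult: "[f (x \<otimes> y) = f x + f y] (mod int p)" if "x \<in> A" "y \<in> A" for x y
    using f(1) that unfolding padd_def by blast
  have Hs: "subgroup ?H G"
  proof (rule finite_subgroupI)
    show "finite ?H" using finA by simp
    show "?H \<subseteq> carrier G" using subgroup.subset[OF As(1)] by blast
    have "\<one> \<in> ?H" using subgroup.one_closed[OF As(1)] padd_one[OF f(1) As(1)] by simp
    then show "?H \<noteq> {}" by blast
    fix x y assume xy: "x \<in> ?H" "y \<in> ?H"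
    then have "[f x + f y = 0 + 0] (mod int p)" by (intro cong_add) auto
    then have "[f (x \<otimes> y) = 0] (mod int p)" using f_mult[of x y] xy cong_trans by fastforce
    then show "x \<otimes> y \<in> ?H" using xy subgroup.m_closed[OF As(1)] by simp
  qed
  have p0: "int p > 0" using prime_gt_0_nat[OF p] by simp
  have img: "(\<lambda>a. f a mod int p) ` A = {0..<int p}"
  proof
    show "(\<lambda>a. f a mod int p) ` A \<subseteq> {0..<int p}" using p0 by auto
    show "{0..<int p} \<subseteq> (\<lambda>a. f a mod int p) ` A"
    proof
      fix k assume k: "k \<in> {0..<int p}"
      have "[f (u [^] nat k) = int (nat k) * f u] (mod int p)" by (rule padd_pow[OF f(1) As(1) uA])
      then have "f (u [^] nat k) mod int p = k" using k f(3) by (simp add: cong_def)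
      moreover have "u [^] nat k \<in> A" using U_pow[OF u(1)] As(2) by auto
      ultimately show "k \<in> (\<lambda>a. f a mod int p) ` A" by (metis image_eqI)
    qed
  qed
  have "card A = card ((\<lambda>a. f a mod int p) ` A) * card ?H"
  proof (rule card_fibres[OF As(1) finA Hs])
    fix g h assume gh: "g \<in> A" "h \<in> A"
    have m: "inv g \<otimes> h \<in> A" using gh subgroup.m_closed[OF As(1)] subgroup.m_inv_closed[OF As(1)] by blast
    have d: "[f (inv g \<otimes> h) = f h - f g] (mod int p)" by (rule padd_diff[OF f(1) As(1) gh])
    have "f g mod int p = f h mod int p \<longleftrightarrow> int p dvd f h - f g"
      by (metis mod_eq_dvd_iff)
    also have "\<dots> \<longleftrightarrow> [f h - f g = 0] (mod int p)" by (simp add: cong_0_iff)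
    also have "\<dots> \<longleftrightarrow> [f (inv g \<otimes> h) = 0] (mod int p)" using d unfolding cong_def by simp
    finally show "f g mod int p = f h mod int p \<longleftrightarrow> inv g \<otimes> h \<in> ?H" using m by simp
  qed simp
  then have cA: "card A = p * card ?H" unfolding img by simp
  have HU: "\<chi> v = 1" if v: "v \<in> ?H \<inter> U" for v
  proof (rule ccontr)
    assume nv: "\<chi> v \<noteq> 1"
    text \<open>Both \<^term>\<open>\<chi>\<close> and \<^term>\<open>f\<close> are nontrivial on \<^term>\<open>U\<close>; values of \<^term>\<open>\<chi>\<close> form the group of \<open>p\<close>-th roots of unity, so some power of \<^term>\<open>v\<close> times the inverse of \<^term>\<open>u\<close> lies in the kernel of \<^term>\<open>\<chi>\<close>.\<close>
    have img\<chi>: "(\<lambda>k. \<chi> v ^ k) ` {..<p} = {z. z ^ p = 1}"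
    proof (rule card_subset_eq)
      show "finite {z :: complex. z ^ p = 1}" using finite_roots_unity[of p, where ?'a=complex] prime_gt_0_nat[OF p] by simp
      have vp: "\<chi> v ^ p = 1" using roots_image(2) v by blast
      show "(\<lambda>k. \<chi> v ^ k) ` {..<p} \<subseteq> {z. z ^ p = 1}"
        using vp by (auto simp: power_mult[symmetric] mult.commute[of _ p] power_mult)
      have "inj_on (\<lambda>k. \<chi> v ^ k) {..<p}"
      proof (rule inj_onI)
        have *: "i = j" if "i \<le> j" "j < p" "\<chi> v ^ i = \<chi> v ^ j" for i j
        proof (rule ccontr)
          assume "i \<noteq> j"
          have "\<chi> v \<noteq> 0" using v by simp
          then have k1: "\<chi> v ^ (j - i) = 1" using that by (simp add: power_diff)
          have "\<not> p dvd j - i" using that \<open>i \<noteq> j\<close> by (auto dest: dvd_imp_le)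
          then obtain l where l: "[(j - i) * l = 1] (mod p)" using prime_inverse_mod[OF p] by blast
          have "\<chi> v ^ ((j - i) * l) = 1" using k1 by (simp add: power_mult)
          moreover have "\<chi> v ^ n = \<chi> v ^ (n mod p)" for n
            using vp by (metis div_mult_mod_eq mult.commute mult_1 power_add power_mult power_one)
          ultimately have "\<chi> v ^ (1 mod p) = 1" using l unfolding cong_def by metis
          then show False using nv prime_gt_1_nat[OF p] by simp
        qed
        fix i j assume "i \<in> {..<p}" "j \<in> {..<p}" "\<chi> v ^ i = \<chi> v ^ j"
        then show "i = j" using *[of i j] *[of j i] by (cases "i \<le> j") auto
      qed
      then show "card ((\<lambda>k. \<chi> v ^ k) ` {..<p}) = card {z :: complex. z ^ p = 1}"
        using card_roots_unity_eq[of p] prime_gt_0_nat[OF p] by (simp add: card_image)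
    qed
    have "\<chi> u \<in> {z. z ^ p = 1}" using roots_image(2) u by blast
    then obtain k where k: "\<chi> u = \<chi> v ^ k" unfolding img\<chi>[symmetric] by blast
    have vU: "v \<in> U" "v \<in> A" "[f v = 0] (mod int p)" using v by auto
    have "v [^] k \<in> U" using vU by simp
    then have "inv (v [^] k) \<otimes> u \<in> ?K" using u(1) k vU by simp
    then have "[f (inv (v [^] k) \<otimes> u) = 0] (mod int p)" by (rule f(2))
    moreover have "[f (inv (v [^] k) \<otimes> u) = f u - f (v [^] k)] (mod int p)"
      by (rule padd_diff[OF f(1) As(1)]) (use vU As(2) uA in auto)
    ultimately have "[f u - f (v [^] k) = 0] (mod int p)" using cong_sym cong_trans by blast
    moreover have "[f (v [^] k) = 0] (mod int p)"
    proof -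
      have "[f (v [^] k) = int k * f v] (mod int p)" by (rule padd_pow[OF f(1) As(1) vU(2)])
      also have "[int k * f v = int k * 0] (mod int p)" by (rule cong_mult[OF cong_refl vU(3)])
      finally show ?thesis by simp
    qed
    ultimately have "[f u - f (v [^] k) + f (v [^] k) = 0 + 0] (mod int p)" by (rule cong_add)
    then have "int p dvd 1" using f(3) by (simp add: cong_0_iff)
    then show False using prime_gt_1_nat[OF p] by simp
  qed
  have "card U dvd card A"
    by (rule card_dvd_of_right_closed[OF U finA subgroup.subset[OF As(1)]])
      (use As(2) UD subgroup.m_closed[OF As(1)] in blast)
  then obtain s where s: "card A = card U * s" by (elim dvdE)
  have "card U * (s * s * card U) = card U * card (carrier G)" using A(3) s by (simp add: mult_ac)
  then have 1: "card (carrier G) = s * s * card U" by (simp only: nat_mult_eq_cancel1[OF card_pos(2)])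
  have "p * s * card ?H = s * card A" using cA by (simp add: mult_ac)
  also have "\<dots> = card (carrier G)" unfolding 1 s by (simp add: mult_ac)
  finally have 2: "card (carrier G) = p * s * card ?H" by simp
  show ?thesis using Hs HU 1 2 by blast
qed

text \<open>Inside \<open>D\<close> this is the equality \<open>Z0 = U\<close>, outside
  \<open>D\<close> the Camina condition.\<close>

lemma not_U_moves:
  assumes g: "g \<in> carrier G" "g \<notin> U"
  shows "\<exists>x\<in>carrier G. comm g x \<in> U \<and> \<chi> (comm g x) \<noteq> 1"
proof (cases "g \<in> D")
  case True
  then show ?thesis using g comm_U Z0_U unfolding Z0_def by blast
next
  case False
  obtain u where u: "u \<in> U" "\<chi> u \<noteq> 1" using \<chi>_nontrivial by blast
  then show ?thesis using camina[OF g(1) False UDm[OF u(1)]] by metis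
qed

end

section \<open>A lower bound for the degree\<close>

text \<open>Exactly what the degree bound takes from a central elementary abelian subgroup. It
  applies to \<open>G\<close> with its centre and also to the centre itself with
  \<open>s = 1\<close>, so one bound serves both sides of the formula.\<close>

locale central_rep = elementary_section G Z "{\<one>\<^bsub>G\<^esub>}" p for G (structure) and Z :: "'a set" and p :: nat +
  fixes n s :: nat and \<rho> :: "'a \<Rightarrow> complex mat"
  assumes finG: "finite (carrier G)" and central: "z \<in> Z \<Longrightarrow> g \<in> carrier G \<Longrightarrow> z \<otimes> g = g \<otimes> z"
    and \<rho>_carrier: "g \<in> carrier G \<Longrightarrow> \<rho> g \<in> carrier_mat n n"
    and \<rho>_mult: "g \<in> carrier G \<Longrightarrow> h \<in> carrier G \<Longrightarrow> \<rho> (g \<otimes> h) = \<rho> g * \<rho> h"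
    and \<rho>_faithful: "z \<in> Z \<Longrightarrow> \<rho> z = 1\<^sub>m n \<Longrightarrow> z = \<one>"
    and \<rho>_one: "\<rho> \<one> = 1\<^sub>m n"
    and trace_Nat: "z \<in> Z \<Longrightarrow> mat_trace (\<rho> z) \<in> \<nat>"
    and moves: "padd p G Z f \<Longrightarrow> \<exists>z\<in>Z. \<not> int p dvd f z \<Longrightarrow> g \<in> carrier G \<Longrightarrow> g \<notin> Z \<Longrightarrow>
      \<exists>x\<in>carrier G. comm g x \<in> Z \<and> \<not> int p dvd f (comm g x)"
    and index: "card (carrier G) = s * s * card Z"
begin

lemma p0: "p > 0" and p1: "p > 1"
  using prime_gt_0_nat[OF p] prime_gt_1_nat[OF p] .

lemma card_Z_pos: "card Z > 0"
proof -
  have "\<one> \<in> Z" by (rule subgroup.one_closed[OF S])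
  then have "Z \<noteq> {}" by blast
  then show ?thesis using finS by (simp only: card_gt_0_iff simp_thms)
qed

definition tr :: "'a \<Rightarrow> complex" where "tr g = mat_trace (\<rho> g)"

lemma tr_one: "tr \<one> = of_nat n"
  by (simp add: tr_def \<rho>_one mat_trace_def)

lemma tr_conj: assumes "g \<in> carrier G" "x \<in> carrier G" shows "tr (x \<otimes> g \<otimes> inv x) = tr g"
proof -
  have c: "\<rho> x \<in> carrier_mat n n" "\<rho> g \<in> carrier_mat n n" "\<rho> (inv x) \<in> carrier_mat n n"
    using assms \<rho>_carrier by auto
  have "\<rho> (x \<otimes> g \<otimes> inv x) = (\<rho> x * \<rho> g) * \<rho> (inv x)" using assms by (simp add: \<rho>_mult)
  then have "tr (x \<otimes> g \<otimes> inv x) = mat_trace (\<rho> (inv x) * (\<rho> x * \<rho> g))"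
    unfolding tr_def \<open>\<rho> (x \<otimes> g \<otimes> inv x) = (\<rho> x * \<rho> g) * \<rho> (inv x)\<close> by (intro mat_trace_comm[of _ n n] mult_carrier_mat[of _ n n] c)
  also have "\<rho> (inv x) * (\<rho> x * \<rho> g) = \<rho> (inv x \<otimes> (x \<otimes> g))" using assms by (simp add: \<rho>_mult)
  also have "inv x \<otimes> (x \<otimes> g) = g" using assms by (simp add: inv_cancel_left)
  finally show ?thesis unfolding tr_def .
qed

lemma ZG: "z \<in> Z \<Longrightarrow> z \<in> carrier G" by (rule subgroup.mem_carrier[OF S])
lemmas Zc = subgroup.m_closed[OF S] subgroup.m_inv_closed[OF S] subgroup.one_closed[OF S]

context
  fixes f :: "'a \<Rightarrow> int" assumes f: "padd p G Z f"
begin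

definition chr :: "'a \<Rightarrow> complex" where "chr z = root_char p (f z)"

lemma chr_mult: "y \<in> Z \<Longrightarrow> z \<in> Z \<Longrightarrow> chr (y \<otimes> z) = chr y * chr z"
  unfolding chr_def using root_char_cong[OF p0, of "f (y \<otimes> z)" "f y + f z"] f
  by (simp add: padd_def root_char_add)

lemma chr_nonzero: "chr z \<noteq> 0" by (simp add: chr_def)

lemma chr_one: "chr \<one> = 1"
  using chr_mult[OF Zc(3) Zc(3)] chr_nonzero[of \<one>] by simp

lemma chr_inv: "z \<in> Z \<Longrightarrow> chr (inv z) = inverse (chr z)"
  using chr_mult[of "inv z" z] chr_one chr_nonzero[of z] Zc(2)[of z] ZG[of z] by (simp add: field_simps)

text \<open>Up to the factor \<open>card Z\<close>, the trace of \<open>\<rho> g\<close> on the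
  isotypic component of \<open>chr\<close>.\<close>

definition X :: "'a \<Rightarrow> complex" where "X g = (\<Sum>z\<in>Z. inverse (chr z) * tr (g \<otimes> z))"

lemma X_shift: assumes g: "g \<in> carrier G" and u: "u \<in> Z" shows "X (g \<otimes> u) = chr u * X g"
proof -
  have "X g = (\<Sum>z\<in>Z. inverse (chr (u \<otimes> z)) * tr (g \<otimes> (u \<otimes> z)))"
    unfolding X_def using sum.reindex_bij_betw[OF subgroup_mult_bij[OF S u], of "\<lambda>z. inverse (chr z) * tr (g \<otimes> z)"] by simp
  also have "\<dots> = (\<Sum>z\<in>Z. inverse (chr u) * (inverse (chr z) * tr (g \<otimes> u \<otimes> z)))"
  proof (rule sum.cong[OF refl])
    fix z assume z: "z \<in> Z"
    show "inverse (chr (u \<otimes> z)) * tr (g \<otimes> (u \<otimes> z)) = inverse (chr u) * (inverse (chr z) * tr (g \<otimes> u \<otimes> z))"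
      using chr_mult[OF u z] m_assoc[OF g ZG[OF u] ZG[OF z]] by simp
  qed
  also have "\<dots> = inverse (chr u) * X (g \<otimes> u)" unfolding X_def by (rule sum_distrib_left[symmetric])
  finally show ?thesis using chr_nonzero[of u] by (simp add: field_simps)
qed

text \<open>Some conjugate of \<open>g\<close> is \<open>g\<close> times a central element at which
  \<open>chr\<close> is not 1. Conjugation leaves \<open>X g\<close> unchanged, while the central
  factor multiplies it by that value.\<close>

lemma X_zero:
  assumes nt: "\<exists>z\<in>Z. \<not> int p dvd f z" and g: "g \<in> carrier G" "g \<notin> Z" shows "X g = 0"
proof -
  obtain x where x: "x \<in> carrier G" "comm g x \<in> Z" "\<not> int p dvd f (comm g x)"
    using moves[OF f nt g] by blast
  let ?u = "comm g x"
  have iu: "inv ?u \<in> Z" by (rule Zc(2)[OF x(2)])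
  have cj: "x \<otimes> g \<otimes> inv x = g \<otimes> inv ?u"
  proof -
    have "x \<otimes> g \<otimes> inv x = inv ?u \<otimes> g" using g(1) x(1) by (simp add: comm_def word_simps)
    then show ?thesis using central[OF iu g(1)] by simp
  qed
  have "X g = X (g \<otimes> inv ?u)"
    unfolding X_def
  proof (rule sum.cong[OF refl])
    fix z assume z: "z \<in> Z"
    have zG: "z \<in> carrier G" by (rule ZG[OF z])
    have "x \<otimes> (g \<otimes> z) \<otimes> inv x = (x \<otimes> g \<otimes> inv x) \<otimes> z"
      using g(1) x(1) zG central[OF z, of "inv x"] by (simp add: m_assoc)
    then have "tr (g \<otimes> z) = tr (g \<otimes> inv ?u \<otimes> z)" using tr_conj[of "g \<otimes> z" x] g(1) x(1) zG cj by simp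
    then show "inverse (chr z) * tr (g \<otimes> z) = inverse (chr z) * tr (g \<otimes> inv ?u \<otimes> z)" by simp
  qed
  also have "\<dots> = chr (inv ?u) * X g" by (rule X_shift[OF g(1) iu])
  finally have "(1 - chr (inv ?u)) * X g = 0" by (simp add: algebra_simps)
  moreover have "chr ?u \<noteq> 1" using x(3) root_char_eq_1_iff[OF p0] unfolding chr_def by simp
  then have "chr (inv ?u) \<noteq> 1" unfolding chr_inv[OF x(2)] by simp
  ultimately show ?thesis by simp
qed

text \<open>The average of \<open>\<rho>\<close> twisted by the inverse character is the projection
  onto the isotypic component, and \<open>m\<close> is its dimension.\<close>

lemma multiplicity_exists: "\<exists>m::nat. X \<one> = of_nat m * of_nat (card Z)"
proof -
  interpret mat_action n Z "\<lambda>y z. y \<otimes> z" "\<lambda>z. inverse (chr z) \<cdot>\<^sub>m \<rho> z"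
  proof
    show "finite Z" "Z \<noteq> {}" using finS Zc(3) by blast+
    show "bij_betw ((\<otimes>) s) Z Z" if "s \<in> Z" for s by (rule subgroup_mult_bij[OF S that])
    show "inverse (chr s) \<cdot>\<^sub>m \<rho> s \<in> carrier_mat n n" if "s \<in> Z" for s using \<rho>_carrier[OF ZG[OF that]] by simp
    fix y z assume yz: "y \<in> Z" "z \<in> Z"
    have c: "\<rho> y \<in> carrier_mat n n" "\<rho> z \<in> carrier_mat n n" using \<rho>_carrier ZG yz by auto
    show "inverse (chr (y \<otimes> z)) \<cdot>\<^sub>m \<rho> (y \<otimes> z) = inverse (chr y) \<cdot>\<^sub>m \<rho> y * (inverse (chr z) \<cdot>\<^sub>m \<rho> z)"
      unfolding chr_mult[OF yz] \<rho>_mult[OF ZG[OF yz(1)] ZG[OF yz(2)]] using c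
      by (simp add: mult_smult_assoc_mat[of _ n n _ n] mult_smult_distrib[of _ n n _ n] smult_smult mult.commute)
  qed
  obtain k where "(\<Sum>z\<in>Z. mat_trace (inverse (chr z) \<cdot>\<^sub>m \<rho> z)) = of_nat k * of_nat (card Z)"
    using trace_sum by blast
  moreover have "(\<Sum>z\<in>Z. mat_trace (inverse (chr z) \<cdot>\<^sub>m \<rho> z)) = X \<one>"
    unfolding X_def
  proof (rule sum.cong[OF refl])
    fix z assume z: "z \<in> Z"
    show "mat_trace (inverse (chr z) \<cdot>\<^sub>m \<rho> z) = inverse (chr z) * tr (\<one> \<otimes> z)"
      using mat_trace_smult[OF \<rho>_carrier[OF ZG[OF z]]] ZG[OF z] by (simp add: tr_def)
  qed
  ultimately show ?thesis by auto
qed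

text \<open>A norm computation. \<open>X\<close> is supported on \<open>Z\<close>, so the sum of all
  \<open>X g * X (inv g)\<close> is \<open>card Z * (m * card Z) ^ 2\<close>. It is also the sum of
  the traces of a representation of the product of \<open>G\<close>, \<open>Z\<close> and
  \<open>Z\<close>, hence \<open>k\<close> times |G| |Z|^2 for a natural number \<open>k\<close>. So
  \<open>m * m = k * (s * s)\<close>, and \<open>k\<close> is positive because \<open>m\<close>
  is.\<close>

lemma multiplicity_bound:
  assumes nt: "\<exists>z\<in>Z. \<not> int p dvd f z" and m: "X \<one> = of_nat m * of_nat (card Z)" "m > 0"
  shows "s \<le> m"
proof -
  let ?S = "carrier G \<times> Z \<times> Z"
  let ?op = "\<lambda>(g, z, w) (g', z', w'). (g \<otimes> g', z \<otimes> z', w \<otimes> w')"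
  \<comment> \<open>Transpose and inverse together make the second factor multiplicative in
    \<open>g\<close>; averaging over the two copies of \<open>Z\<close> projects both tensor factors
    onto the component of \<open>chr\<close>.\<close>
  let ?R = "\<lambda>(g, z, w). (inverse (chr z) * inverse (chr w)) \<cdot>\<^sub>m kronecker n (\<rho> (g \<otimes> z)) (transpose_mat (\<rho> (inv g \<otimes> w)))"
  interpret mat_action "n * n" ?S ?op ?R
  proof
    show "finite ?S" using finS finG by simp
    have "(\<one>, \<one>, \<one>) \<in> ?S" using Zc(3) by simp
    then show "?S \<noteq> {}" by blast
    show "bij_betw (?op s) ?S ?S" if s: "s \<in> ?S" for s
    proof -
      obtain g z w where gzw: "s = (g, z, w)" "g \<in> carrier G" "z \<in> Z" "w \<in> Z" using s by auto
      have "bij_betw (map_prod (\<lambda>x. g \<otimes> x) (map_prod (\<lambda>x. z \<otimes> x) (\<lambda>x. w \<otimes> x))) ?S ?S"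
        by (intro bij_betw_map_prod subgroup_mult_bij subgroup_self S gzw)
      moreover have "map_prod (\<lambda>x. g \<otimes> x) (map_prod (\<lambda>x. z \<otimes> x) (\<lambda>x. w \<otimes> x)) = ?op s"
        unfolding gzw(1) by auto
      ultimately show ?thesis by simp
    qed
    show "?R s \<in> carrier_mat (n * n) (n * n)" if "s \<in> ?S" for s by (cases s) simp
    fix a b assume ab: "a \<in> ?S" "b \<in> ?S"
    obtain g z w g' z' w' where e: "a = (g, z, w)" "b = (g', z', w')"
      and G: "g \<in> carrier G" "g' \<in> carrier G" and Zs: "z \<in> Z" "w \<in> Z" "z' \<in> Z" "w' \<in> Z"
      using ab by auto
    note zG = Zs[THEN ZG]
    have c: "\<rho> (g \<otimes> z) \<in> carrier_mat n n" "\<rho> (g' \<otimes> z') \<in> carrier_mat n n"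
      "\<rho> (inv g \<otimes> w) \<in> carrier_mat n n" "\<rho> (inv g' \<otimes> w') \<in> carrier_mat n n"
      using \<rho>_carrier G zG by auto
    have 1: "\<rho> (g \<otimes> g' \<otimes> (z \<otimes> z')) = \<rho> (g \<otimes> z) * \<rho> (g' \<otimes> z')"
    proof -
      have "g \<otimes> g' \<otimes> (z \<otimes> z') = g \<otimes> (g' \<otimes> z) \<otimes> z'" using G zG by (simp add: m_assoc)
      also have "g' \<otimes> z = z \<otimes> g'" using central[OF Zs(1) G(2)] by simp
      also have "g \<otimes> (z \<otimes> g') \<otimes> z' = (g \<otimes> z) \<otimes> (g' \<otimes> z')" using G zG by (simp add: m_assoc)
      finally show ?thesis using G zG by (simp add: \<rho>_mult)
    qed
    have 2: "transpose_mat (\<rho> (inv (g \<otimes> g') \<otimes> (w \<otimes> w'))) = transpose_mat (\<rho> (inv g \<otimes> w)) * transpose_mat (\<rho> (inv g' \<otimes> w'))"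
    proof -
      have "inv (g \<otimes> g') \<otimes> (w \<otimes> w') = inv g' \<otimes> (inv g \<otimes> (w \<otimes> w'))" using G zG by (simp add: m_assoc inv_mult_group)
      also have "inv g \<otimes> (w \<otimes> w') = w' \<otimes> (inv g \<otimes> w)"
        using central[OF Zs(4), of "inv g \<otimes> w"] G zG by (simp add: m_assoc)
      also have "inv g' \<otimes> (w' \<otimes> (inv g \<otimes> w)) = (inv g' \<otimes> w') \<otimes> (inv g \<otimes> w)" using G zG by (simp add: m_assoc)
      finally have "\<rho> (inv (g \<otimes> g') \<otimes> (w \<otimes> w')) = \<rho> (inv g' \<otimes> w') * \<rho> (inv g \<otimes> w)" using G zG by (simp add: \<rho>_mult)
      then show ?thesis using transpose_mult[OF c(4,3)] by simp
    qed
    have "kronecker n (\<rho> (g \<otimes> g' \<otimes> (z \<otimes> z'))) (transpose_mat (\<rho> (inv (g \<otimes> g') \<otimes> (w \<otimes> w')))) =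
      kronecker n (\<rho> (g \<otimes> z)) (transpose_mat (\<rho> (inv g \<otimes> w))) * kronecker n (\<rho> (g' \<otimes> z')) (transpose_mat (\<rho> (inv g' \<otimes> w')))"
      unfolding 1 2 by (rule kronecker_mult) (use c in auto)
    then show "?R (?op a b) = ?R a * ?R b"
      unfolding e using chr_mult[OF Zs(1,3)] chr_mult[OF Zs(2,4)]
      by (simp add: smult_mult_smult[OF kronecker_carrier kronecker_carrier] mult_ac)
  qed
  obtain k where k: "(\<Sum>t\<in>?S. mat_trace (?R t)) = of_nat k * of_nat (card ?S)"
    using trace_sum by blast
  have "(\<Sum>t\<in>?S. mat_trace (?R t)) = (\<Sum>g\<in>carrier G. \<Sum>z\<in>Z. \<Sum>w\<in>Z. (inverse (chr z) * tr (g \<otimes> z)) * (inverse (chr w) * tr (inv g \<otimes> w)))"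
    unfolding sum.cartesian_product
  proof (rule sum.cong)
    fix t assume t: "t \<in> ?S"
    obtain g z w where e: "t = (g, z, w)" "g \<in> carrier G" "z \<in> Z" "w \<in> Z" using t by auto
    have c: "\<rho> (g \<otimes> z) \<in> carrier_mat n n" "\<rho> (inv g \<otimes> w) \<in> carrier_mat n n" using \<rho>_carrier e ZG by auto
    have "mat_trace (kronecker n (\<rho> (g \<otimes> z)) (transpose_mat (\<rho> (inv g \<otimes> w)))) = tr (g \<otimes> z) * tr (inv g \<otimes> w)"
      unfolding tr_def using c by (subst mat_trace_kronecker) (auto simp: mat_trace_transpose)
    then show "mat_trace (?R t) = (case t of (g, z, w) \<Rightarrow> inverse (chr z) * tr (g \<otimes> z) * (inverse (chr w) * tr (inv g \<otimes> w)))"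
      unfolding e(1) by (simp add: mat_trace_smult[OF kronecker_carrier])
  qed auto
  also have "\<dots> = (\<Sum>g\<in>carrier G. X g * X (inv g))"
    unfolding X_def by (simp add: sum_product)
  also have "\<dots> = (\<Sum>g\<in>Z. X g * X (inv g))"
    by (rule sum.mono_neutral_right) (use finG ZG X_zero[OF nt] in auto)
  also have "\<dots> = (\<Sum>g\<in>Z. X \<one> * X \<one>)"
  proof (rule sum.cong[OF refl])
    fix z assume z: "z \<in> Z"
    have "X z = chr z * X \<one>" "X (inv z) = chr (inv z) * X \<one>"
      using X_shift[OF one_closed z] X_shift[OF one_closed Zc(2)[OF z]] ZG[OF z] by simp_all
    then show "X z * X (inv z) = X \<one> * X \<one>" using chr_inv[OF z] chr_nonzero[of z] by simp
  qed
  finally have "of_nat (card Z * (m * card Z * (m * card Z))) = (of_nat (k * card ?S) :: complex)"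
    unfolding k m(1) by simp
  then have "card Z * (m * card Z * (m * card Z)) = k * card ?S" by (simp only: of_nat_eq_iff)
  also have "card ?S = s * s * card Z * (card Z * card Z)" by (simp add: card_cartesian_product index)
  finally have "(card Z * card Z * card Z) * (m * m) = (card Z * card Z * card Z) * (k * (s * s))" by (simp only: mult_ac)
  then have mk: "m * m = k * (s * s)" using card_Z_pos by simp
  then have "k > 0" using m(2) by (cases k) auto
  then have "s * s \<le> m * m" unfolding mk by simp
  then show ?thesis by (metis mult_le_mono linorder_not_le mult_strict_mono' zero_le le_eq_less_or_eq leD)
qed

end

section \<open>Fourier analysis on the central subgroup\<close>

context
  fixes d :: nat and e :: "nat \<Rightarrow> 'a" and x :: "nat \<Rightarrow> 'a \<Rightarrow> int"
  assumes ds: "dual_system d e x" and ker: "\<forall>g\<in>Z. (\<forall>i<d. [x i g = 0] (mod int p)) \<longrightarrow> g \<in> {\<one>}"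
begin

text \<open>For \<open>c\<close> in \<open>K\<close> the functionals \<open>L c\<close> represent
  the whole dual of \<open>Z\<close>, so \<open>root_char p (L c z)\<close> lists the characters of
  \<open>Z\<close>.\<close>

definition L :: "(nat \<Rightarrow> int) \<Rightarrow> 'a \<Rightarrow> int" where "L c z = (\<Sum>i<d. c i * x i z)"
definition K :: "(nat \<Rightarrow> int) set" where "K = {..<d} \<rightarrow>\<^sub>E {0..<int p}"

lemma finK: "finite K" unfolding K_def by (intro finite_PiE) auto

lemma x_padd: "i < d \<Longrightarrow> padd p G Z (x i)" using ds unfolding dual_system_def by simp

lemma L_padd: "padd p G Z (L c)"
  unfolding padd_def
proof (intro ballI)
  fix y z assume yz: "y \<in> Z" "z \<in> Z"
  have "[L c (y \<otimes> z) = (\<Sum>i<d. c i * (x i y + x i z))] (mod int p)"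
    unfolding L_def
  proof (intro cong_sum cong_mult cong_refl)
    fix i assume "i \<in> {..<d}"
    then show "[x i (y \<otimes> z) = x i y + x i z] (mod int p)" using x_padd[of i] yz unfolding padd_def by simp
  qed
  then show "[L c (y \<otimes> z) = L c y + L c z] (mod int p)" by (simp add: L_def distrib_left sum.distrib)
qed

lemma L_inv_mult: "y \<in> Z \<Longrightarrow> z \<in> Z \<Longrightarrow> root_char p (L c (inv y \<otimes> z)) = inverse (root_char p (L c y)) * root_char p (L c z)"
proof -
  assume yz: "y \<in> Z" "z \<in> Z"
  have "root_char p (L c (inv y \<otimes> z)) = root_char p (- L c y + L c z)"
    using root_char_cong[OF p0 padd_diff[OF L_padd S yz]] by simp
  then show ?thesis unfolding root_char_add root_char_uminus .
qed

lemma orthogonality: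
  assumes z: "z \<in> Z"
  shows "(\<Sum>c\<in>K. root_char p (L c z)) = (if z = \<one> then of_nat (card Z) else 0)"
proof -
  have "card Z = p ^ d * card {\<one>}" using card_eq_coordinates[OF ds] ker by blast
  then have cZ: "card Z = p ^ d" by simp
  have "(\<Sum>c\<in>K. root_char p (L c z)) = (\<Sum>c\<in>K. \<Prod>i<d. root_char p (c i * x i z))"
    unfolding L_def by (simp add: root_char_sum)
  also have "\<dots> = (\<Prod>i<d. \<Sum>k\<in>{0..<int p}. root_char p (k * x i z))"
    unfolding K_def by (rule prod_sum_PiE[symmetric]) auto
  also have "\<dots> = (\<Prod>i<d. if int p dvd x i z then of_nat p else 0)" by (simp only: sum_root_char[OF p0])
  also have "\<dots> = (if z = \<one> then of_nat (card Z) else 0)"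
  proof (cases "z = \<one>")
    case True
    have "int p dvd x i z" if "i < d" for i
      using padd_one[OF x_padd[OF that] S] True by (simp add: cong_0_iff)
    then show ?thesis using True cZ by simp
  next
    case False
    then obtain i where i: "i < d" "\<not> [x i z = 0] (mod int p)" using ker z by blast
    then have "(\<Prod>i<d. if int p dvd x i z then of_nat p else 0 :: complex) = 0"
      by (intro prod_zero) (auto simp: cong_0_iff)
    then show ?thesis using False by simp
  qed
  finally show ?thesis .
qed

definition mult :: "(nat \<Rightarrow> int) \<Rightarrow> nat" where
  "mult c = (SOME m. X (L c) \<one> = of_nat m * of_nat (card Z))"

lemma mult: "X (L c) \<one> = of_nat (mult c) * of_nat (card Z)"
  unfolding mult_def by (rule someI_ex[OF multiplicity_exists[OF L_padd]])

lemma X_L: "X (L c) \<one> = (\<Sum>z\<in>Z. inverse (root_char p (L c z)) * tr z)"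
  unfolding X_def[OF L_padd] chr_def[OF L_padd] using ZG by simp

text \<open>Fourier inversion on \<open>Z\<close>: by orthogonality only the term
  \<open>y = z\<close> survives.\<close>

lemma tr_expand:
  assumes z: "z \<in> Z"
  shows "tr z = (\<Sum>c\<in>K. of_nat (mult c) * root_char p (L c z))"
proof -
  have "of_nat (card Z) * (\<Sum>c\<in>K. of_nat (mult c) * root_char p (L c z)) = (\<Sum>c\<in>K. X (L c) \<one> * root_char p (L c z))"
    by (simp add: mult sum_distrib_left mult_ac)
  also have "\<dots> = (\<Sum>c\<in>K. \<Sum>y\<in>Z. tr y * root_char p (L c (inv y \<otimes> z)))"
    unfolding X_L sum_distrib_right
    by (intro sum.cong refl) (simp add: L_inv_mult z mult_ac)
  also have "\<dots> = (\<Sum>y\<in>Z. tr y * (\<Sum>c\<in>K. root_char p (L c (inv y \<otimes> z))))"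
    by (subst sum.swap) (simp add: sum_distrib_left)
  also have "\<dots> = (\<Sum>y\<in>Z. if y = z then tr y * of_nat (card Z) else 0)"
  proof (rule sum.cong[OF refl])
    fix y assume y: "y \<in> Z"
    have "inv y \<otimes> z \<in> Z" by (intro Zc y z)
    moreover have "inv y \<otimes> z = \<one> \<longleftrightarrow> y = z"
      using ZG[OF y] ZG[OF z] by (metis inv_cancel_left(1) l_inv r_one)
    ultimately show "tr y * (\<Sum>c\<in>K. root_char p (L c (inv y \<otimes> z))) = (if y = z then tr y * of_nat (card Z) else 0)"
      by (simp add: orthogonality)
  qed
  also have "\<dots> = of_nat (card Z) * tr z" using z finS by simp
  finally show ?thesis using card_Z_pos by simp
qed

lemma sum_mult: "(\<Sum>c\<in>K. mult c) = n"
proof -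
  have "root_char p (L c \<one>) = 1" for c
    using root_char_cong[OF p0 padd_one[OF L_padd S]] by simp
  then have "of_nat n = (of_nat (\<Sum>c\<in>K. mult c) :: complex)"
    using tr_expand[OF Zc(3)] tr_one by simp
  then show ?thesis by (simp only: of_nat_eq_iff)
qed

definition scale :: "nat \<Rightarrow> (nat \<Rightarrow> int) \<Rightarrow> nat \<Rightarrow> int" where
  "scale j c = (\<lambda>i\<in>{..<d}. (int j * c i) mod int p)"

lemma scale_K: "scale j c \<in> K"
  unfolding scale_def K_def using p0 by (intro restrict_PiE_iff[THEN iffD2]) auto

lemma L_scale: "[L (scale j c) z = int j * L c z] (mod int p)"
proof -
  have "[L (scale j c) z = (\<Sum>i<d. (int j * c i) * x i z)] (mod int p)"
    unfolding L_def by (intro cong_sum cong_mult cong_refl) (simp add: scale_def cong_def)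
  then show ?thesis by (simp add: L_def sum_distrib_left mult_ac)
qed

text \<open>The traces are rational and the nontrivial \<open>p\<close>-th roots of unity are linearly independent
  over the rationals.\<close>

lemma mult_scale:
  assumes j: "0 < j" "j < p"
  shows "mult (scale j c) = mult c"
proof -
  define w where "w = root_char p 1"
  have wp: "w ^ p = 1" and w1: "w \<noteq> 1"
    using root_char_power_p[OF p0, of 1] root_char_eq_1_iff[OF p0, of 1] p1 by (simp_all add: w_def)
  \<comment> \<open>The values of the inverse character are \<open>w ^ h z\<close>, so the twisted
    trace sum is a polynomial in \<open>w\<close> with integer coefficients \<open>a k\<close>;
    putting \<open>w ^ j\<close> for \<open>w\<close> gives the sum for
    \<open>scale j c\<close>.\<close>
  define h where "h z = nat ((- L c z) mod int p)" for z
  have hp: "h z < p" for z using p0 by (simp add: h_def nat_less_iff)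
  have hk: "[int (h z) = - L c z] (mod int p)" for z using p0 by (simp add: h_def)
  have wpow: "root_char p (int k) = w ^ k" for k using root_char_mult_nat[of p k 1] by (simp add: w_def)
  have "\<forall>z\<in>Z. \<exists>t::nat. tr z = of_nat t" using trace_Nat unfolding tr_def Nats_def by blast
  then obtain \<tau> :: "'a \<Rightarrow> nat" where \<tau>: "\<And>z. z \<in> Z \<Longrightarrow> tr z = of_nat (\<tau> z)" by metis
  define a where "a k = (\<Sum>z\<in>{z \<in> Z. h z = k}. int (\<tau> z))" for k
  have grp: "(\<Sum>k<p. of_int (a k) * v ^ k) = (\<Sum>z\<in>Z. v ^ h z * tr z)" for v :: complex
  proof -
    have "(\<Sum>k<p. of_int (a k) * v ^ k) = (\<Sum>k<p. \<Sum>z\<in>{z \<in> Z. h z = k}. v ^ h z * tr z)"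
      unfolding a_def of_int_sum sum_distrib_right
      by (intro sum.cong refl) (simp add: \<tau> mult.commute)
    also have "\<dots> = (\<Sum>z\<in>Z. v ^ h z * tr z)"
      by (rule sum.group) (use finS hp in auto)
    finally show ?thesis .
  qed
  have 1: "(\<Sum>z\<in>Z. w ^ h z * tr z) = of_nat (mult c * card Z)"
  proof -
    have "w ^ h z = inverse (root_char p (L c z))" for z
      using root_char_cong[OF p0 hk[of z]] wpow by (simp add: root_char_uminus)
    then show ?thesis using X_L[of c] mult[of c] by simp
  qed
  have 2: "(\<Sum>z\<in>Z. (w ^ j) ^ h z * tr z) = of_nat (mult (scale j c) * card Z)"
  proof -
    have "(w ^ j) ^ h z = inverse (root_char p (L (scale j c) z))" for z
    proof -
      have "[int j * int (h z) = int j * (- L c z)] (mod int p)" by (rule cong_mult[OF cong_refl hk])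
      also have "int j * (- L c z) = - (int j * L c z)" by simp
      finally have "root_char p (int (j * h z)) = root_char p (- (int j * L c z))"
        using root_char_cong[OF p0] by simp
      also have "\<dots> = inverse (root_char p (L (scale j c) z))"
        unfolding root_char_uminus root_char_cong[OF p0 L_scale] ..
      finally show ?thesis unfolding wpow by (simp add: power_mult)
    qed
    then show ?thesis using X_L[of "scale j c"] mult[of "scale j c"] by simp
  qed
  \<comment> \<open>Moving the value at \<open>w\<close> into the coefficient of index 0 produces a
    vanishing relation. All \<open>b k\<close> then agree, so the relation holds at
    \<open>w ^ j\<close> as well.\<close>
  define b where "b k = a k - (if k = 0 then int (mult c * card Z) else 0)" for k
  have bsum: "(\<Sum>k<p. of_int (b k) * v ^ k) = (\<Sum>k<p. of_int (a k) * v ^ k) - of_nat (mult c * card Z)" for v :: complex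
  proof -
    have "(\<Sum>k<p. of_int (b k) * v ^ k) = (\<Sum>k<p. of_int (a k) * v ^ k - (if k = 0 then of_nat (mult c * card Z) else 0))"
      by (intro sum.cong refl) (simp add: b_def algebra_simps)
    also have "\<dots> = (\<Sum>k<p. of_int (a k) * v ^ k) - of_nat (mult c * card Z)"
      using p0 by (simp add: sum_subtractf)
    finally show ?thesis .
  qed
  have "(\<Sum>k<p. of_int (b k) * w ^ k) = 0" unfolding bsum grp 1 by simp
  then have b0: "b k = b 0" if "k < p" for k using root_of_unity_relation[OF p wp w1 _ that] by blast
  have "(\<Sum>k<p. of_int (b k) * (w ^ j) ^ k) = of_int (b 0) * (\<Sum>k<p. (w ^ j) ^ k)"
    unfolding sum_distrib_left
  proof (rule sum.cong[OF refl])
    fix k assume "k \<in> {..<p}"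
    then have "b k = b 0" by (intro b0) simp
    then show "of_int (b k) * (w ^ j) ^ k = of_int (b 0) * (w ^ j) ^ k" by (rule arg_cong)
  qed
  also have "(\<Sum>k<p. (w ^ j) ^ k) = 0"
  proof -
    have "w ^ j \<noteq> 1" using root_char_eq_1_iff[OF p0, of "int j"] j unfolding wpow by (auto dest: zdvd_imp_le)
    moreover have "(w ^ j) ^ p = 1" using wp by (simp flip: power_mult add: mult.commute[of j]) (simp add: power_mult)
    ultimately show ?thesis by (simp add: geometric_sum)
  qed
  finally have "of_nat (mult (scale j c) * card Z) = (of_nat (mult c * card Z) :: complex)"
    unfolding bsum grp 2 by simp
  then have "mult (scale j c) * card Z = mult c * card Z" by (simp only: of_nat_eq_iff)
  then show ?thesis using card_Z_pos by simp
qed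

text \<open>On the common kernel of the occurring characters every trace equals \<open>n\<close>, so
  this subgroup acts as the identity and faithfulness applies.\<close>

lemma support_separates:
  assumes z: "z \<in> Z" "\<And>c. c \<in> K \<Longrightarrow> mult c > 0 \<Longrightarrow> int p dvd L c z"
  shows "z = \<one>"
proof -
  let ?T = "{y \<in> Z. \<forall>c\<in>K. mult c > 0 \<longrightarrow> int p dvd L c y}"
  have T1: "\<one> \<in> ?T" using Zc(3) padd_one[OF L_padd S] by (auto simp: cong_0_iff)
  have Ts: "subgroup ?T G"
  proof (rule finite_subgroupI)
    show "?T \<subseteq> carrier G" using ZG by blast
    show "?T \<noteq> {}" using T1 by blast
    fix a b assume ab: "a \<in> ?T" "b \<in> ?T"
    have "int p dvd L c (a \<otimes> b)" if c: "c \<in> K" "mult c > 0" for c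
    proof -
      have "[L c (a \<otimes> b) = L c a + L c b] (mod int p)" using L_padd ab unfolding padd_def by blast
      moreover have "int p dvd L c a + L c b" using ab c by auto
      ultimately show ?thesis by (simp add: cong_dvd_iff)
    qed
    then show "a \<otimes> b \<in> ?T" using ab Zc(1) by blast
  qed (use finS in simp)
  have TZ: "y \<in> Z" if "y \<in> ?T" for y using that by blast
  interpret mat_action n ?T "\<lambda>y z. y \<otimes> z" \<rho>
  proof
    show "finite ?T" using finS by simp
    show "?T \<noteq> {}" using T1 by blast
    show "bij_betw ((\<otimes>) s) ?T ?T" if "s \<in> ?T" for s by (rule subgroup_mult_bij[OF Ts that])
    show "\<rho> s \<in> carrier_mat n n" if "s \<in> ?T" for s by (rule \<rho>_carrier[OF ZG[OF TZ[OF that]]])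
    show "\<rho> (s \<otimes> t) = \<rho> s * \<rho> t" if "s \<in> ?T" "t \<in> ?T" for s t
      by (rule \<rho>_mult[OF ZG[OF TZ[OF that(1)]] ZG[OF TZ[OF that(2)]]])
  qed
  have "\<rho> z = 1\<^sub>m n"
  proof (rule trivial_if_trace_full)
    show "z \<in> ?T" using z by blast
    fix y assume y: "y \<in> ?T"
    have "tr y = (\<Sum>c\<in>K. of_nat (mult c))"
      unfolding tr_expand[OF TZ[OF y]]
    proof (rule sum.cong[OF refl])
      fix c assume "c \<in> K"
      then have "mult c = 0 \<or> root_char p (L c y) = 1" using y root_char_eq_1_iff[OF p0] by auto
      then show "of_nat (mult c) * root_char p (L c y) = of_nat (mult c)" by auto
    qed
    also have "\<dots> = of_nat n" unfolding sum_mult[symmetric] by simp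
    finally show "mat_trace (\<rho> y) = of_nat n" unfolding tr_def .
  qed
  then show ?thesis by (rule \<rho>_faithful[OF z(1)])
qed

text \<open>\<open>B\<close> is a smallest set of occurring characters that separates points of
  \<open>Z\<close>. Minimality gives for each \<open>b\<close> an element \<open>w b\<close> at
  which \<open>b\<close> alone is nontrivial, and the product of these is a \<open>z\<close> at
  which all of \<open>B\<close> is nontrivial. Separation embeds \<open>Z\<close> in the
  residue-valued functions on \<open>B\<close>, so \<open>d \<le> card B\<close>.\<close>

lemma independent_support:
  obtains B w z where "B \<subseteq> {c \<in> K. mult c > 0}" "d \<le> card B" "z \<in> Z"
    "\<And>b. b \<in> B \<Longrightarrow> \<not> int p dvd L b z" "\<And>b. b \<in> B \<Longrightarrow> w b \<in> Z"
    "\<And>b. b \<in> B \<Longrightarrow> \<not> int p dvd L b (w b)" "\<And>b b'. b \<in> B \<Longrightarrow> b' \<in> B \<Longrightarrow> b \<noteq> b' \<Longrightarrow> int p dvd L b' (w b)"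
proof -
  let ?P = "\<lambda>B. B \<subseteq> {c \<in> K. mult c > 0} \<and> (\<forall>z\<in>Z. (\<forall>b\<in>B. int p dvd L b z) \<longrightarrow> z = \<one>)"
  have P: "?P {c \<in> K. mult c > 0}" using support_separates by blast
  obtain B where B0: "?P B \<and> (\<forall>B'. ?P B' \<longrightarrow> card B \<le> card B')"
    by (rule exE[OF ex_has_least_nat[of ?P, OF P, of card]])
  have B: "?P B" using B0 by (rule conjunct1)
  have Bmin: "card B \<le> card B'" if "?P B'" for B'
    by (rule mp[OF spec[OF conjunct2[OF B0]] that])
  have finB: "finite B" by (rule finite_subset[of _ K]) (use B finK in auto)
  have "\<exists>z\<in>Z. \<not> int p dvd L b z \<and> (\<forall>b'\<in>B - {b}. int p dvd L b' z)" if b: "b \<in> B" for b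
  proof -
    have "card (B - {b}) < card B" using finB b by (rule card_Diff1_less)
    then have "\<not> ?P (B - {b})" using Bmin by (meson not_le)
    then obtain z where z: "z \<in> Z" "\<forall>b'\<in>B - {b}. int p dvd L b' z" "z \<noteq> \<one>" using B by blast
    moreover have "\<not> int p dvd L b z"
    proof
      assume "int p dvd L b z"
      then have "\<forall>b'\<in>B. int p dvd L b' z" using z(2) by blast
      then show False using B z by blast
    qed
    ultimately show ?thesis by blast
  qed
  then have "\<forall>b\<in>B. \<exists>z. z \<in> Z \<and> \<not> int p dvd L b z \<and> (\<forall>b'\<in>B - {b}. int p dvd L b' z)" by blast
  then obtain w where w0: "\<forall>b\<in>B. w b \<in> Z \<and> \<not> int p dvd L b (w b) \<and> (\<forall>b'\<in>B - {b}. int p dvd L b' (w b))"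
    by (rule bchoice[THEN exE])
  have w: "w b \<in> Z" "\<not> int p dvd L b (w b)" if "b \<in> B" for b using w0 that by auto
  have w3: "int p dvd L b' (w b)" if "b \<in> B" "b' \<in> B" "b \<noteq> b'" for b b'
  proof -
    have "b' \<in> B - {b}" using that by blast
    then show ?thesis using w0 that(1) by blast
  qed
  have "\<exists>z\<in>Z. (\<forall>b\<in>B'. \<not> int p dvd L b z) \<and> (\<forall>b\<in>B - B'. int p dvd L b z)" if "finite B'" "B' \<subseteq> B" for B'
    using that
  proof (induction B' rule: finite_induct)
    case empty
    show ?case using Zc(3) padd_one[OF L_padd S] by (intro bexI[of _ \<one>]) (auto simp: cong_0_iff)
  next
    case (insert b B')
    then obtain z where z: "z \<in> Z" "\<forall>b\<in>B'. \<not> int p dvd L b z" "\<forall>b\<in>B - B'. int p dvd L b z" by auto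
    have bB: "b \<in> B" using insert by simp
    have sum: "int p dvd L c (z \<otimes> w b) \<longleftrightarrow> int p dvd L c z + L c (w b)" for c
    proof -
      have "[L c (z \<otimes> w b) = L c z + L c (w b)] (mod int p)" using L_padd z(1) w(1)[OF bB] unfolding padd_def by blast
      then show ?thesis by (rule cong_dvd_iff)
    qed
    have "\<not> int p dvd L c (z \<otimes> w b)" if c: "c \<in> insert b B'" for c
    proof (cases "c = b")
      case True
      then have "int p dvd L c z" using z(3) bB insert by auto
      then show ?thesis unfolding sum using w(2)[OF bB] True by (simp add: dvd_add_right_iff)
    next
      case False
      then have "int p dvd L c (w b)" "\<not> int p dvd L c z" using c z(2) w3[OF bB, of c] insert by auto
      then show ?thesis unfolding sum by (simp add: dvd_add_left_iff)
    qed
    moreover have "int p dvd L c (z \<otimes> w b)" if c: "c \<in> B - insert b B'" for c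
      unfolding sum using c z(3) w3[OF bB, of c] by auto
    ultimately show ?case using Zc(1)[OF z(1) w(1)[OF bB]] by blast
  qed
  from this[OF finB subset_refl] obtain z where z: "z \<in> Z" "\<forall>b\<in>B. \<not> int p dvd L b z" by blast
  have "card Z \<le> card (B \<rightarrow>\<^sub>E {0..<int p})"
  proof (rule card_inj_on_le)
    let ?F = "\<lambda>z. \<lambda>b\<in>B. L b z mod int p"
    show "inj_on ?F Z"
    proof (rule inj_onI)
      fix y z assume yz: "y \<in> Z" "z \<in> Z" "?F y = ?F z"
      have "int p dvd L b (inv y \<otimes> z)" if b: "b \<in> B" for b
      proof -
        have "L b y mod int p = L b z mod int p" using fun_cong[OF yz(3), of b] b by simp
        then have "int p dvd L b z - L b y" by (metis mod_eq_dvd_iff)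
        then show ?thesis using cong_dvd_iff[OF padd_diff[OF L_padd S yz(1,2)]] by simp
      qed
      moreover have "inv y \<otimes> z \<in> Z" by (intro Zc yz)
      ultimately have "inv y \<otimes> z = \<one>" using B by blast
      then show "y = z" using ZG[OF yz(1)] ZG[OF yz(2)] by (metis inv_cancel_left(1) r_one)
    qed
    show "?F ` Z \<subseteq> B \<rightarrow>\<^sub>E {0..<int p}" by (intro image_subsetI restrict_PiE_iff[THEN iffD2]) (use p0 in auto)
    show "finite (B \<rightarrow>\<^sub>E {0..<int p})" using finB by (intro finite_PiE) auto
  qed
  also have "card (B \<rightarrow>\<^sub>E {0..<int p}) = p ^ card B" using finB by (simp add: card_PiE)
  also have "card Z = p ^ d * card {\<one>}" using card_eq_coordinates[OF ds] ker by blast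
  finally have "p ^ d \<le> p ^ card B" by simp
  then have "d \<le> card B" using p1 by simp
  then show ?thesis by (intro that[of B z w]) (use B z w w3 in auto)
qed

text \<open>\<open>F\<close> and \<open>N\<close> count, with multiplicity, the characters trivial
  and nontrivial at \<open>z\<close>. The Galois conjugates of \<open>B\<close> give
  \<open>card B * ((p - 1) * s) \<le> N\<close>. The traces over all powers of \<open>z\<close> add
  up to \<open>p * F\<close> by orthogonality and, being non-negative, to at least the term
  \<open>n\<close> at the unit; so \<open>p * N \<le> (p - 1) * n\<close>.\<close>

lemma degree_bound_coordinates: "s * d * p \<le> n"
proof -
  obtain B w z where B: "B \<subseteq> {c \<in> K. mult c > 0}" "d \<le> card B" "z \<in> Z"
    "\<And>b. b \<in> B \<Longrightarrow> \<not> int p dvd L b z" and w: "\<And>b. b \<in> B \<Longrightarrow> w b \<in> Z"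
    "\<And>b. b \<in> B \<Longrightarrow> \<not> int p dvd L b (w b)" "\<And>b b'. b \<in> B \<Longrightarrow> b' \<in> B \<Longrightarrow> b \<noteq> b' \<Longrightarrow> int p dvd L b' (w b)"
    by (rule independent_support) (rule that; assumption)
  have finB: "finite B" by (rule finite_subset[of _ K]) (use B finK in auto)
  have pj: "\<not> int p dvd L (scale j b) y \<longleftrightarrow> \<not> int p dvd L b y" if "0 < j" "j < p" for j b y
  proof -
    have "int p dvd L (scale j b) y \<longleftrightarrow> int p dvd int j * L b y" by (rule cong_dvd_iff[OF L_scale])
    also have "\<dots> \<longleftrightarrow> int p dvd L b y"
      using that p by (auto simp: prime_dvd_mult_iff dest: zdvd_imp_le)
    finally show ?thesis by simp
  qed
  define F where "F = (\<Sum>c\<in>{c \<in> K. int p dvd L c z}. mult c)"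
  define N where "N = (\<Sum>c\<in>{c \<in> K. \<not> int p dvd L c z}. mult c)"
  have FN: "F + N = n"
  proof -
    have "K = {c \<in> K. int p dvd L c z} \<union> {c \<in> K. \<not> int p dvd L c z}" by blast
    then have "(\<Sum>c\<in>K. mult c) = F + N"
      unfolding F_def N_def using finK by (subst sum.union_disjoint[symmetric]) auto
    then show ?thesis using sum_mult by simp
  qed
  have zj: "z [^] (j::nat) \<in> Z" for j by (induction j) (use Zc B(3) in auto)
  have fixed: "n \<le> p * F"
  proof -
    have "(\<Sum>j<p. tr (z [^] j)) = (\<Sum>j<p. \<Sum>c\<in>K. of_nat (mult c) * root_char p (int j * L c z))"
      by (intro sum.cong refl) (simp add: tr_expand[OF zj] root_char_cong[OF p0 padd_pow[OF L_padd S B(3)]])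
    also have "\<dots> = (\<Sum>c\<in>K. of_nat (mult c) * (\<Sum>j<p. root_char p (int j * L c z)))"
      by (subst sum.swap) (simp add: sum_distrib_left)
    also have "\<dots> = (\<Sum>c\<in>K. if int p dvd L c z then of_nat (mult c * p) else 0)"
    proof (rule sum.cong[OF refl])
      fix c
      have "(\<Sum>j<p. root_char p (int j * L c z)) = (\<Sum>k\<in>{0..<int p}. root_char p (k * L c z))"
        by (rule sum.reindex_bij_witness[of _ nat int]) auto
      then show "of_nat (mult c) * (\<Sum>j<p. root_char p (int j * L c z)) = (if int p dvd L c z then of_nat (mult c * p) else 0)"
        unfolding sum_root_char[OF p0] by simp
    qed
    also have "\<dots> = (\<Sum>c\<in>{c \<in> K. int p dvd L c z}. of_nat (mult c * p))"
      by (rule sum.inter_filter[OF finK, symmetric])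
    also have "\<dots> = of_nat (p * F)" unfolding F_def by (simp add: sum_distrib_left mult.commute)
    finally have 1: "(\<Sum>j<p. tr (z [^] j)) = of_nat (p * F)" .
    have "\<exists>t::nat. tr (z [^] j) = of_nat t" for j :: nat using trace_Nat[OF zj[of j]] unfolding tr_def Nats_def by blast
    then obtain t :: "nat \<Rightarrow> nat" where t: "\<And>j::nat. tr (z [^] j) = of_nat (t j)" by metis
    have "of_nat (\<Sum>j<p. t j) = (of_nat (p * F) :: complex)" using 1 t by simp
    then have 2: "(\<Sum>j<p. t j) = p * F" by (simp only: of_nat_eq_iff)
    have "tr (z [^] (0::nat)) = of_nat n" using tr_one by simp
    then have "t 0 = n" unfolding t by (simp only: of_nat_eq_iff)
    then have "n \<le> (\<Sum>j<p. t j)" using member_le_sum[of 0 "{..<p}" t] p0 by simp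
    then show ?thesis using 2 by simp
  qed
  have moved: "card B * ((p - 1) * s) \<le> N"
  proof -
    let ?J = "{1..<p} \<times> B" and ?g = "\<lambda>(j, b). scale j b"
    \<comment> \<open>The elements \<open>w b\<close> tell different members of \<open>B\<close>
      apart, and \<open>z\<close>, at which \<open>b\<close> is nontrivial, tells the multipliers
      \<open>j\<close> apart.\<close>
    have inj: "inj_on ?g ?J"
    proof (rule inj_onI)
      fix a a' assume a: "a \<in> ?J" "a' \<in> ?J" "?g a = ?g a'"
      obtain j b j' b' where e: "a = (j, b)" "a' = (j', b')" by (metis surj_pair)
      have j: "0 < j" "j < p" "0 < j'" "j' < p" "b \<in> B" "b' \<in> B" and eq: "scale j b = scale j' b'" using a e by auto
      have bb: "b = b'"
      proof (rule ccontr)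
        assume "b \<noteq> b'"
        then have "int p dvd L b' (w b)" using w(3) j by blast
        then have "int p dvd L (scale j' b') (w b)" using pj[OF j(3,4)] by blast
        then have "int p dvd L (scale j b) (w b)" using eq by simp
        then show False using pj[OF j(1,2)] w(2)[OF j(5)] by blast
      qed
      have "[int j * L b z = int j' * L b z] (mod int p)"
        using cong_trans[OF cong_sym[OF L_scale[of j b z]]] L_scale[of j' b' z] eq bb by simp
      moreover have "coprime (L b z) (int p)"
        using prime_imp_coprime[of "int p" "L b z"] B(4)[OF j(5)] p by (simp add: coprime_commute)
      ultimately have "[int j = int j'] (mod int p)" by (simp add: cong_mult_rcancel)
      then have "j = j'" using j cong_less_modulus_unique_nat unfolding cong_int_iff by blast
      then show "a = a'" using e bb by simp
    qed
    have sub: "?g ` ?J \<subseteq> {c \<in> K. \<not> int p dvd L c z}"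
      using scale_K pj B(4) by auto
    have big: "s \<le> mult (?g a)" if a: "a \<in> ?J" for a
    proof -
      obtain j b where e: "a = (j, b)" "0 < j" "j < p" "b \<in> B" using a by auto
      have "mult b > 0" using B(1) e(4) by blast
      moreover have "\<exists>z\<in>Z. \<not> int p dvd L b z" using B(3,4) e(4) by blast
      ultimately have "s \<le> mult b" using multiplicity_bound[OF L_padd _ mult] by blast
      then show ?thesis using mult_scale[OF e(2,3), of b] e(1) by simp
    qed
    have "card B * ((p - 1) * s) = (\<Sum>a\<in>?J. s)" by (simp add: card_cartesian_product mult_ac)
    also have "\<dots> \<le> (\<Sum>a\<in>?J. mult (?g a))" by (rule sum_mono) (rule big)
    also have "\<dots> = (\<Sum>c\<in>?g ` ?J. mult c)" using sum.reindex[OF inj, of mult] by simp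
    also have "\<dots> \<le> N" unfolding N_def by (rule sum_mono2[OF _ sub]) (use finK in auto)
    finally show ?thesis .
  qed
  have "p * N \<le> (p - 1) * n"
  proof -
    have "p * N + p * F = p * n" unfolding FN[symmetric] by (simp add: distrib_left)
    then show ?thesis using fixed by (simp add: diff_mult_distrib)
  qed
  then have "p * (d * ((p - 1) * s)) \<le> (p - 1) * n"
    using moved mult_le_mono1[OF B(2), of "(p - 1) * s"] by (meson le_trans mult_le_mono2)
  then have "(p - 1) * (s * d * p) \<le> (p - 1) * n" by (simp only: mult_ac)
  then show ?thesis using p1 by simp
qed

end

lemma degree_bound:
  assumes "card Z = p ^ d"
  shows "s * d * p \<le> n"
proof -
  obtain d' e x where dk: "dual_system d' e x \<and> (\<forall>g\<in>Z. (\<forall>i<d'. [x i g = 0] (mod int p)) \<longrightarrow> g \<in> {\<one>})"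
    using exists_coordinates by (elim exE)
  have "card Z = p ^ d' * card {\<one>}" using card_eq_coordinates[OF conjunct1[OF dk]] conjunct2[OF dk] by blast
  then have "d' = d" using assms p1 by simp
  then show ?thesis using degree_bound_coordinates[OF conjunct1[OF dk] conjunct2[OF dk]] by simp
qed

end

section \<open>Embeddings into symmetric groups\<close>

context group
begin

text \<open>An enumeration of \<open>X\<close> by \<open>{1..card X}\<close> transports the action.
  Outside this range an element of \<open>sym_group\<close> is the identity, hence the default value
  in \<open>\<phi>\<close>.\<close>

lemma action_embedding:
  assumes X: "finite X" and closed: "\<And>g x. g \<in> carrier G \<Longrightarrow> x \<in> X \<Longrightarrow> act g x \<in> X"
    and mult: "\<And>g h x. g \<in> carrier G \<Longrightarrow> h \<in> carrier G \<Longrightarrow> x \<in> X \<Longrightarrow> act (g \<otimes> h) x = act g (act h x)"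
    and one: "\<And>x. x \<in> X \<Longrightarrow> act \<one> x = x"
    and faithful: "\<And>g. g \<in> carrier G \<Longrightarrow> (\<And>x. x \<in> X \<Longrightarrow> act g x = x) \<Longrightarrow> g = \<one>"
  shows "\<exists>\<phi>\<in>hom G (sym_group (card X)). inj_on \<phi> (carrier G)"
proof -
  let ?I = "{1..card X}"
  obtain \<beta> where \<beta>: "bij_betw \<beta> ?I X" using ex_bij_betw_nat_finite_1[OF X] by blast
  define \<gamma> where "\<gamma> = inv_into ?I \<beta>"
  have \<gamma>: "bij_betw \<gamma> X ?I" unfolding \<gamma>_def by (rule bij_betw_inv_into[OF \<beta>])
  have bg: "\<beta> (\<gamma> x) = x" if "x \<in> X" for x unfolding \<gamma>_def by (rule bij_betw_inv_into_right[OF \<beta> that])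
  have gb: "\<gamma> (\<beta> k) = k" if "k \<in> ?I" for k unfolding \<gamma>_def by (rule bij_betw_inv_into_left[OF \<beta> that])
  have bX: "\<beta> k \<in> X" if "k \<in> ?I" for k using \<beta> that by (rule bij_betwE[THEN bspec])
  have gI: "\<gamma> x \<in> ?I" if "x \<in> X" for x using \<gamma> that by (rule bij_betwE[THEN bspec])
  define \<phi> where "\<phi> g = (\<lambda>k. if k \<in> ?I then \<gamma> (act g (\<beta> k)) else k)" for g
  have in_I: "\<phi> g k \<in> ?I" if "g \<in> carrier G" "k \<in> ?I" for g k
    unfolding \<phi>_def using that gI[OF closed[OF that(1) bX[OF that(2)]]] by simp
  have comp: "\<phi> (g \<otimes> h) = \<phi> g \<circ> \<phi> h" if gh: "g \<in> carrier G" "h \<in> carrier G" for g h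
  proof
    fix k show "\<phi> (g \<otimes> h) k = (\<phi> g \<circ> \<phi> h) k"
    proof (cases "k \<in> ?I")
      case True
      have "act h (\<beta> k) \<in> X" by (rule closed[OF gh(2) bX[OF True]])
      then show ?thesis using True gI[of "act h (\<beta> k)"] bg[of "act h (\<beta> k)"] mult[OF gh bX[OF True]]
        unfolding \<phi>_def by simp
    next
      case False
      then show ?thesis unfolding \<phi>_def by (simp only: o_apply if_False)
    qed
  qed
  have id: "\<phi> \<one> = id"
    unfolding \<phi>_def using one[OF bX] gb by auto
  have perm: "\<phi> g permutes ?I" if g: "g \<in> carrier G" for g
  proof (rule bij_imp_permutes)
    have "\<phi> g (\<phi> (inv g) k) = k" "\<phi> (inv g) (\<phi> g k) = k" for k
      using comp[OF g inv_closed[OF g]] comp[OF inv_closed[OF g] g] id g by (simp_all add: fun_eq_iff)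
    then show "bij_betw (\<phi> g) ?I ?I"
      using in_I[OF g] in_I[OF inv_closed[OF g]] by (intro bij_betwI[of _ _ _ "\<phi> (inv g)"]) auto
    show "\<phi> g k = k" if "k \<notin> ?I" for k using that unfolding \<phi>_def by (rule if_not_P)
  qed
  have "\<phi> \<in> hom G (sym_group (card X))"
    unfolding hom_def sym_group_def using perm comp by auto
  moreover have "inj_on \<phi> (carrier G)"
  proof (rule inj_onI)
    fix g h assume gh: "g \<in> carrier G" "h \<in> carrier G" "\<phi> g = \<phi> h"
    have "\<phi> (inv h \<otimes> g) = id"
      using comp[OF inv_closed[OF gh(2)] gh(1)] comp[OF inv_closed[OF gh(2)] gh(2)] gh id by simp
    have "inv h \<otimes> g = \<one>"
    proof (rule faithful)
      show ig: "inv h \<otimes> g \<in> carrier G" using gh by simp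
      fix x assume x: "x \<in> X"
      have "\<phi> (inv h \<otimes> g) (\<gamma> x) = \<gamma> x" using \<open>\<phi> (inv h \<otimes> g) = id\<close> by simp
      then have "\<gamma> (act (inv h \<otimes> g) x) = \<gamma> x" using gI[OF x] bg[OF x] unfolding \<phi>_def by simp
      then show "act (inv h \<otimes> g) x = x" using bg[OF x] bg[OF closed[OF ig x]] by metis
    qed
    then show "g = h" using gh by (metis inv_cancel_left(1) r_one)
  qed
  ultimately show ?thesis by blast
qed

text \<open>The group acts on the disjoint union of \<open>d\<close> coset spaces of size
  \<open>q\<close> each. The kernel is the intersection of all conjugates of all \<open>H i\<close>,
  which \<open>core\<close> makes trivial.\<close>

lemma coset_embedding:
  assumes fin: "finite (carrier G)" and H: "\<And>i. i < d \<Longrightarrow> subgroup (H i) G"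
    and index: "\<And>i. i < d \<Longrightarrow> card (carrier G) = q * card (H i)"
    and core: "\<And>g. g \<in> carrier G \<Longrightarrow> (\<And>i x. i < d \<Longrightarrow> x \<in> carrier G \<Longrightarrow> inv x \<otimes> g \<otimes> x \<in> H i) \<Longrightarrow> g = \<one>"
  shows "\<exists>\<phi>\<in>hom G (sym_group (d * q)). inj_on \<phi> (carrier G)"
proof -
  let ?X = "SIGMA i:{..<d}. (\<lambda>x. l_coset G x (H i)) ` carrier G"
  let ?act = "\<lambda>g (i, c). (i, l_coset G g c)"
  have HG: "H i \<subseteq> carrier G" if "i < d" for i using subgroup.subset[OF H[OF that]] .
  have eqv: "l_coset G x (H i) = l_coset G y (H i) \<longleftrightarrow> inv x \<otimes> y \<in> H i" if i: "i < d" and xy: "x \<in> carrier G" "y \<in> carrier G" for i x y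
  proof
    assume e: "l_coset G x (H i) = l_coset G y (H i)"
    have "y \<otimes> \<one> \<in> l_coset G y (H i)" using subgroup.one_closed[OF H[OF i]] unfolding l_coset_def by blast
    then have "y \<in> l_coset G x (H i)" using e xy by simp
    then obtain h where h: "h \<in> H i" "y = x \<otimes> h" unfolding l_coset_def by blast
    then show "inv x \<otimes> y \<in> H i" using xy HG[OF i] by (auto simp: inv_cancel_left)
  next
    assume e: "inv x \<otimes> y \<in> H i"
    have y: "y = x \<otimes> (inv x \<otimes> y)" using xy by (simp add: inv_cancel_left)
    have "l_coset G y (H i) = l_coset G x (l_coset G (inv x \<otimes> y) (H i))"
      using lcos_m_assoc[OF HG[OF i] xy(1), of "inv x \<otimes> y"] xy y by simp
    also have "l_coset G (inv x \<otimes> y) (H i) = H i" by (rule coset_join3[OF _ H[OF i] e]) (use xy in simp)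
    finally show "l_coset G x (H i) = l_coset G y (H i)" by simp
  qed
  have cardc: "card ((\<lambda>x. l_coset G x (H i)) ` carrier G) = q" if i: "i < d" for i
  proof -
    have "card (carrier G) = card ((\<lambda>x. l_coset G x (H i)) ` carrier G) * card (H i)"
      by (rule card_fibres[OF subgroup_self fin H[OF i] HG[OF i]]) (rule eqv[OF i])
    moreover have "card (H i) > 0"
      using subgroup.one_closed[OF H[OF i]] finite_subset[OF HG[OF i] fin] by (metis card_gt_0_iff empty_iff)
    ultimately show ?thesis using index[OF i] by (metis mult_cancel2 less_irrefl)
  qed
  have "card ?X = (\<Sum>i\<in>{..<d}. card ((\<lambda>x. l_coset G x (H i)) ` carrier G))"
    by (rule card_SigmaI) (use fin in auto)
  then have cX: "card ?X = d * q" using cardc by simp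
  have "\<exists>\<phi>\<in>hom G (sym_group (card ?X)). inj_on \<phi> (carrier G)"
  proof (rule action_embedding[where act = ?act])
    show "finite ?X" using fin by auto
    show "?act g x \<in> ?X" if "g \<in> carrier G" "x \<in> ?X" for g x
      using that HG by (auto simp: lcos_m_assoc)
    show "?act (g \<otimes> h) x = ?act g (?act h x)" if "g \<in> carrier G" "h \<in> carrier G" "x \<in> ?X" for g h x
      using that HG by (auto simp: lcos_m_assoc m_assoc)
    show "?act \<one> x = x" if "x \<in> ?X" for x
      using that HG by (auto simp: lcos_m_assoc)
    fix g assume g: "g \<in> carrier G" and fixes': "\<And>x. x \<in> ?X \<Longrightarrow> ?act g x = x"
    show "g = \<one>"
    proof (rule core[OF g])
      fix i x assume i: "i < d" and x: "x \<in> carrier G"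
      have "?act g (i, l_coset G x (H i)) = (i, l_coset G x (H i))" using i x by (intro fixes') auto
      then have "l_coset G (g \<otimes> x) (H i) = l_coset G x (H i)" using lcos_m_assoc[OF HG[OF i] g x] by simp
      then have "inv x \<otimes> (g \<otimes> x) \<in> H i" using eqv[OF i x, of "g \<otimes> x"] g x by simp
      then show "inv x \<otimes> g \<otimes> x \<in> H i" using g x by (simp add: m_assoc)
    qed
  qed
  then show ?thesis unfolding cX .
qed

section \<open>Permutation matrices and comparison of the three degrees\<close>

lemma perm_degree_le:
  assumes "n > 0" "\<exists>\<phi>\<in>hom G (sym_group n). inj_on \<phi> (carrier G)"
  shows "min_perm_degree G \<le> n"
  unfolding min_perm_degree_def by (rule Least_le) (use assms in blast)

text \<open>Matrix indices start at 0 while the symmetric group acts on \<open>{1..n}\<close>, hence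
  the shifts by \<open>Suc\<close>. Columns are images of unit vectors, so composition becomes
  multiplication in the same order.\<close>

definition perm_mat :: "nat \<Rightarrow> (nat \<Rightarrow> nat) \<Rightarrow> 'k::field mat" where
  "perm_mat n \<pi> = mat n n (\<lambda>(i, j). if \<pi> (Suc j) = Suc i then 1 else 0)"

lemma perm_mat_mult:
  assumes "\<sigma> permutes {1..n}"
  shows "perm_mat n (\<pi> \<circ> \<sigma>) = (perm_mat n \<pi> * perm_mat n \<sigma> :: 'k::field mat)"
proof (rule eq_matI)
  fix i j assume "i < dim_row (perm_mat n \<pi> * perm_mat n \<sigma> :: 'k mat)" "j < dim_col (perm_mat n \<pi> * perm_mat n \<sigma> :: 'k mat)"
  then have ij: "i < n" "j < n" by (auto simp: perm_mat_def)
  have "\<sigma> (Suc j) \<in> {1..n}" using permutes_in_image[OF assms, of "Suc j"] ij by simp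
  then obtain l where l: "\<sigma> (Suc j) = Suc l" "l < n" by (cases "\<sigma> (Suc j)") auto
  have "(perm_mat n \<pi> * perm_mat n \<sigma> :: 'k mat) $$ (i, j) =
    (\<Sum>k<n. (if \<pi> (Suc k) = Suc i then 1 else 0) * (if \<sigma> (Suc j) = Suc k then 1 else 0))"
    using ij by (simp add: perm_mat_def scalar_prod_def lessThan_atLeast0)
  also have "\<dots> = (\<Sum>k<n. if k = l then (if \<pi> (Suc k) = Suc i then 1 else 0) else 0)"
    using l by (intro sum.cong) auto
  also have "\<dots> = perm_mat n (\<pi> \<circ> \<sigma>) $$ (i, j)" using l ij by (simp add: perm_mat_def)
  finally show "perm_mat n (\<pi> \<circ> \<sigma>) $$ (i, j) = (perm_mat n \<pi> * perm_mat n \<sigma> :: 'k mat) $$ (i, j)" ..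
qed (auto simp: perm_mat_def)

lemma perm_mat_id: "perm_mat n id = (1\<^sub>m n :: 'k::field mat)"
  by (intro eq_matI) (auto simp: perm_mat_def)

lemma perm_mat_carrier [simp]: "perm_mat n \<pi> \<in> carrier_mat n n"
  by (simp add: perm_mat_def)

lemma perm_mat_inj:
  assumes "\<pi> permutes {1..n}" "\<sigma> permutes {1..n}" "perm_mat n \<pi> = (perm_mat n \<sigma> :: 'k::field mat)"
  shows "\<pi> = \<sigma>"
proof
  fix k show "\<pi> k = \<sigma> k"
  proof (cases "k \<in> {1..n}")
    case True
    then obtain j where j: "k = Suc j" "j < n" by (cases k) auto
    have "\<sigma> k \<in> {1..n}" using permutes_in_image[OF assms(2), of k] True by simp
    then obtain l where l: "\<sigma> k = Suc l" "l < n" by (cases "\<sigma> k") auto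
    have "perm_mat n \<pi> $$ (l, j) = (perm_mat n \<sigma> :: 'k mat) $$ (l, j)" using assms(3) by simp
    then show ?thesis using l j by (simp add: perm_mat_def split: if_splits)
  next
    case False
    then show ?thesis using permutes_not_in[OF assms(1)] permutes_not_in[OF assms(2)] by metis
  qed
qed

text \<open>The trace counts fixed points.\<close>

lemma perm_mat_quasi: "quasi_permutation_mat (perm_mat n \<pi> :: 'k::field mat)"
proof -
  have "mat_trace (perm_mat n \<pi> :: 'k mat) = (\<Sum>i<n. if \<pi> (Suc i) = Suc i then 1 else 0)"
    by (simp add: mat_trace_def perm_mat_def)
  also have "\<dots> \<in> \<nat>" unfolding sum.If_cases[OF finite_lessThan] by simp
  finally show ?thesis by (simp add: quasi_permutation_mat_def perm_mat_def)
qed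

lemma general_linearI:
  assumes "A \<in> carrier_mat n n" "B \<in> carrier_mat n n" "A * B = 1\<^sub>m n" "B * A = 1\<^sub>m n"
  shows "A \<in> carrier (general_linear TYPE('k::field) n)"
  using assms by (auto simp: general_linear_def units_of_def Units_def ring_mat_def)

lemma general_linear_mult: "mult (general_linear TYPE('k::field) n) = (*)"
  by (simp add: general_linear_def units_of_def ring_mat_def)

lemma general_linear_carrierD:
  "A \<in> carrier (general_linear TYPE('k::field) n) \<Longrightarrow> A \<in> carrier_mat n n \<and> (\<exists>B\<in>carrier_mat n n. A * B = 1\<^sub>m n \<and> B * A = 1\<^sub>m n)"
  by (auto simp: general_linear_def units_of_def Units_def ring_mat_def)

lemma perm_to_quasi_rep:
  assumes \<phi>: "\<phi> \<in> hom G (sym_group n)" "inj_on \<phi> (carrier G)"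
  shows "\<exists>\<rho>\<in>hom G (general_linear TYPE('k::field) n). inj_on \<rho> (carrier G) \<and> (\<forall>g\<in>carrier G. quasi_permutation_mat (\<rho> g))"
proof -
  have perm: "\<phi> g permutes {1..n}" if "g \<in> carrier G" for g
    using hom_in_carrier[OF \<phi>(1) that] by (simp add: sym_group_carrier)
  have comp: "\<phi> (g \<otimes> h) = \<phi> g \<circ> \<phi> h" if "g \<in> carrier G" "h \<in> carrier G" for g h
    using hom_mult[OF \<phi>(1) that] by (simp add: sym_group_mult)
  have id: "\<phi> \<one> = id"
    using hom_one[OF \<phi>(1) is_group sym_group_is_group] by (simp add: sym_group_one)
  let ?\<rho> = "\<lambda>g. perm_mat n (\<phi> g) :: 'k mat"
  have m: "?\<rho> (g \<otimes> h) = ?\<rho> g * ?\<rho> h" if "g \<in> carrier G" "h \<in> carrier G" for g h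
    unfolding comp[OF that] by (rule perm_mat_mult[OF perm[OF that(2)]])
  have one: "?\<rho> \<one> = 1\<^sub>m n" unfolding id by (rule perm_mat_id)
  have "?\<rho> g \<in> carrier (general_linear TYPE('k) n)" if g: "g \<in> carrier G" for g
    by (rule general_linearI[of _ _ "?\<rho> (inv g)"])
      (use m[OF g inv_closed[OF g]] m[OF inv_closed[OF g] g] one g in simp_all)
  then have "?\<rho> \<in> hom G (general_linear TYPE('k) n)"
    unfolding hom_def by (simp add: general_linear_mult m)
  moreover have "inj_on ?\<rho> (carrier G)"
    using \<phi>(2) perm_mat_inj[OF perm perm] unfolding inj_on_def by blast
  ultimately show ?thesis using perm_mat_quasi by blast
qed

lemma quasi_perm_degree_le:
  fixes T :: "'k::field_char_0 itself"
  assumes "n > 0" "\<rho> \<in> hom G (general_linear T n)" "inj_on \<rho> (carrier G)" "\<And>g. g \<in> carrier G \<Longrightarrow> quasi_permutation_mat (\<rho> g)"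
  shows "min_quasi_perm_degree T G \<le> n"
  unfolding min_quasi_perm_degree_def by (rule Least_le) (use assms in blast)

lemma quasi_perm_degree_attained:
  fixes T :: "'k::field_char_0 itself"
  assumes "n > 0" "\<exists>\<rho>\<in>hom G (general_linear T n). inj_on \<rho> (carrier G) \<and> (\<forall>g\<in>carrier G. quasi_permutation_mat (\<rho> g))"
  shows "min_quasi_perm_degree T G > 0 \<and> (\<exists>\<rho>\<in>hom G (general_linear T (min_quasi_perm_degree T G)).
    inj_on \<rho> (carrier G) \<and> (\<forall>g\<in>carrier G. quasi_permutation_mat (\<rho> g)))"
  unfolding min_quasi_perm_degree_def by (rule LeastI) (use assms in blast)

lemma perm_degree_attained:
  assumes "n > 0" "\<exists>\<phi>\<in>hom G (sym_group n). inj_on \<phi> (carrier G)"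
  shows "min_perm_degree G > 0 \<and> (\<exists>\<phi>\<in>hom G (sym_group (min_perm_degree G)). inj_on \<phi> (carrier G))"
  unfolding min_perm_degree_def by (rule LeastI) (use assms in blast)

lemma rational_to_complex_rep:
  assumes \<rho>: "\<rho> \<in> hom G (general_linear TYPE(rat) n)" "inj_on \<rho> (carrier G)" "\<forall>g\<in>carrier G. quasi_permutation_mat (\<rho> g)"
  shows "\<exists>\<rho>\<in>hom G (general_linear TYPE(complex) n). inj_on \<rho> (carrier G) \<and> (\<forall>g\<in>carrier G. quasi_permutation_mat (\<rho> g))"
proof -
  let ?r = "\<lambda>g. map_mat (of_rat :: rat \<Rightarrow> complex) (\<rho> g)"
  have c: "\<rho> g \<in> carrier (general_linear TYPE(rat) n)" if "g \<in> carrier G" for g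
    by (rule hom_in_carrier[OF \<rho>(1) that])
  have m: "?r (g \<otimes> h) = ?r g * ?r h" if gh: "g \<in> carrier G" "h \<in> carrier G" for g h
    using hom_mult[OF \<rho>(1) gh] general_linear_carrierD[OF c[OF gh(1)]] general_linear_carrierD[OF c[OF gh(2)]]
    by (simp add: general_linear_mult of_rat_hom.mat_hom_mult[of _ n n _ n])
  have "?r g \<in> carrier (general_linear TYPE(complex) n)" if g: "g \<in> carrier G" for g
  proof -
    obtain B where B: "\<rho> g \<in> carrier_mat n n" "B \<in> carrier_mat n n" "\<rho> g * B = 1\<^sub>m n" "B * \<rho> g = 1\<^sub>m n"
      using general_linear_carrierD[OF c[OF g]] by blast
    show ?thesis
    proof (rule general_linearI[of _ _ "map_mat of_rat B"])
      show "?r g * map_mat of_rat B = 1\<^sub>m n" "map_mat of_rat B * ?r g = 1\<^sub>m n"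
        using B by (simp_all flip: of_rat_hom.mat_hom_mult[of _ n n _ n] add: of_rat_hom.mat_hom_one)
    qed (use B in auto)
  qed
  then have "?r \<in> hom G (general_linear TYPE(complex) n)"
    unfolding hom_def by (simp add: general_linear_mult m)
  moreover have "inj_on ?r (carrier G)"
  proof (rule inj_onI)
    fix g h assume gh: "g \<in> carrier G" "h \<in> carrier G" "?r g = ?r h"
    have "\<rho> g = \<rho> h" using gh(3) by (rule of_rat_hom.mat_hom_inj)
    then show "g = h" using \<rho>(2) gh by (simp add: inj_on_def)
  qed
  moreover have "quasi_permutation_mat (?r g)" if g: "g \<in> carrier G" for g
  proof -
    have q: "square_mat (\<rho> g)" "mat_trace (\<rho> g) \<in> \<nat>" using \<rho>(3) g unfolding quasi_permutation_mat_def by auto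
    have "mat_trace (?r g) = of_rat (mat_trace (\<rho> g))"
      using q(1) by (simp add: mat_trace_def of_rat_sum)
    then show ?thesis using q unfolding quasi_permutation_mat_def Nats_def by auto
  qed
  ultimately show ?thesis by blast
qed

section \<open>Lower central series and criteria for the degrees\<close>

lemma commutator_subgroup_subgroup:
  assumes "H \<subseteq> carrier G" "K \<subseteq> carrier G"
  shows "subgroup (commutator_subgroup G H K) G"
  unfolding commutator_subgroup_def by (rule generate_is_subgroup) (use assms in \<open>auto simp: subset_iff\<close>)

lemma lower_central_subgroup: "subgroup (lower_central G i) G"
proof (induction i)
  case (Suc i)
  then show ?case using commutator_subgroup_subgroup[OF subgroup.subset] by simp
qed (simp add: subgroup_self)

lemma commutator_subgroup_mono:
  assumes "H \<subseteq> H'"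
  shows "commutator_subgroup G H K \<subseteq> commutator_subgroup G H' K"
  unfolding commutator_subgroup_def by (rule mono_generate) (use assms in blast)

lemma comm_in_commutator_subgroup:
  "x \<in> H \<Longrightarrow> y \<in> K \<Longrightarrow> comm x y \<in> commutator_subgroup G H K"
  unfolding commutator_subgroup_def comm_def by (rule generate.incl) blast

lemma derived_eq_lower_central: "derived G (carrier G) = lower_central G 1"
proof -
  have "derived_set G (carrier G) = {h \<otimes> k \<otimes> inv h \<otimes> inv k |h k. h \<in> carrier G \<and> k \<in> carrier G}"
    by blast
  then show ?thesis unfolding derived_def by (simp add: commutator_subgroup_def)
qed

lemma camina3_of_class_3:
  assumes p: "prime p" and cam: "camina_p_group p G" and cl: "has_nilpotency_class G 3"
  shows "camina3 G p (lower_central G 1) (lower_central G 2)"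
proof -
  let ?L = "lower_central G"
  note sub = subgroup.subset[OF lower_central_subgroup]
  have fin: "finite (carrier G)" and ord: "\<exists>n. card (carrier G) = p ^ n"
    using cam unfolding camina_p_group_def finite_p_group_def Coset.order_def by auto
  have L3: "?L 3 = {\<one>}" and L2: "?L 2 \<noteq> {\<one>}" and L0: "?L 0 \<noteq> {\<one>}"
    using cl spec[of "\<lambda>i. i < 3 \<longrightarrow> ?L i \<noteq> {\<one>}" 0]
    unfolding has_nilpotency_class_def by (simp_all del: lower_central.simps)
  have Suc: "?L 1 = commutator_subgroup G (?L 0) (carrier G)" "?L 2 = commutator_subgroup G (?L 1) (carrier G)"
    "?L 3 = commutator_subgroup G (?L 2) (carrier G)" by (simp_all add: numeral_2_eq_2 numeral_3_eq_3)
  show ?thesis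
  proof (intro camina3.intro camina3_axioms.intro)
    show "?L 2 \<subseteq> ?L 1" unfolding Suc(2) unfolding Suc(1) by (rule commutator_subgroup_mono) (use sub[of 1] Suc(1) in simp)
    show "comm x y \<in> ?L 1" if "x \<in> carrier G" "y \<in> carrier G" for x y
      unfolding Suc(1) by (rule comm_in_commutator_subgroup) (use that in simp_all)
    show "comm x y \<in> ?L 2" if "x \<in> ?L 1" "y \<in> carrier G" for x y
      unfolding Suc(2) by (rule comm_in_commutator_subgroup[OF that])
    show "?L 2 = generate G {comm c g |c g. c \<in> ?L 1 \<and> g \<in> carrier G}"
      unfolding Suc(2) commutator_subgroup_def comm_def ..
    show "u \<otimes> g = g \<otimes> u" if u: "u \<in> ?L 2" and g: "g \<in> carrier G" for u g
    proof -
      have "comm u g \<in> ?L 3" unfolding Suc(3) by (rule comm_in_commutator_subgroup[OF u g])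
      then have "comm u g = \<one>" using L3 by simp
      then show ?thesis using comm_one_iff[of u g] u g sub[of 2] by blast
    qed
    show "\<exists>y\<in>carrier G. comm g y = d" if g: "g \<in> carrier G" "g \<notin> ?L 1" and d: "d \<in> ?L 1" for g d
    proof -
      \<comment> \<open>The class of \<open>inv g\<close> is used because \<open>g\<close> times a
        conjugate of \<open>inv g\<close> is a commutator \<open>comm g x\<close>.\<close>
      have "inv g \<notin> ?L 1" using subgroup.m_inv_closed[OF lower_central_subgroup[of 1], of "inv g"] g by auto
      then have "conjugacy_class G (inv g) = l_coset G (inv g) (?L 1)"
        using cam g(1) unfolding camina_p_group_def derived_eq_lower_central by simp
      moreover have "inv g \<otimes> d \<in> l_coset G (inv g) (?L 1)" using d unfolding l_coset_def by blast
      ultimately obtain x where x: "x \<in> carrier G" "inv g \<otimes> d = x \<otimes> inv g \<otimes> inv x"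
        unfolding conjugacy_class_def by blast
      have dG: "d \<in> carrier G" using d sub[of 1] by blast
      have "comm g x = g \<otimes> (x \<otimes> inv g \<otimes> inv x)" using x(1) g(1) by (simp add: comm_def m_assoc)
      also have "\<dots> = d" unfolding x(2)[symmetric] using g(1) dG by (rule inv_cancel_left(1))
      finally show ?thesis using x(1) by blast
    qed
    show "\<exists>g\<in>carrier G. g \<notin> ?L 1"
    proof (rule ccontr)
      assume "\<not> ?thesis"
      \<comment> \<open>A perfect group has a constant lower central series, so it could not end in
        the trivial group.\<close>
      then have "?L 1 = ?L 0" using sub[of 1] by auto
      then have "?L 3 = ?L 0" using Suc by simp
      then show False using L3 L0 by simp
    qed
  qed (fact group_axioms p fin ord lower_central_subgroup L2)+
qed

text \<open>The image of the unit is idempotent and invertible.\<close>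

lemma general_linear_hom_one:
  assumes "\<rho> \<in> hom G (general_linear TYPE('k::field) n)"
  shows "\<rho> \<one> = 1\<^sub>m n"
proof -
  obtain B where A: "\<rho> \<one> \<in> carrier_mat n n" and B: "B \<in> carrier_mat n n" "\<rho> \<one> * B = 1\<^sub>m n"
    using general_linear_carrierD[OF hom_in_carrier[OF assms one_closed]] by blast
  have "\<rho> \<one> * \<rho> \<one> = \<rho> \<one>"
    using hom_mult[OF assms one_closed one_closed] by (simp add: general_linear_mult)
  then have "\<rho> \<one> * (\<rho> \<one> * B) = \<rho> \<one> * B" using A B(1) by (simp flip: assoc_mult_mat)
  then show ?thesis using A B by simp
qed

lemma central_repI:
  assumes E: "elementary_section G Z {\<one>} p" and fin: "finite (carrier G)"
    and central: "\<And>z g. z \<in> Z \<Longrightarrow> g \<in> carrier G \<Longrightarrow> z \<otimes> g = g \<otimes> z"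
    and moves: "\<And>f g. padd p G Z f \<Longrightarrow> \<exists>z\<in>Z. \<not> int p dvd f z \<Longrightarrow> g \<in> carrier G \<Longrightarrow> g \<notin> Z \<Longrightarrow>
      \<exists>x\<in>carrier G. comm g x \<in> Z \<and> \<not> int p dvd f (comm g x)"
    and index: "card (carrier G) = s * s * card Z"
    and \<rho>: "\<rho> \<in> hom G (general_linear TYPE(complex) n)" "inj_on \<rho> (carrier G)" "\<forall>g\<in>carrier G. quasi_permutation_mat (\<rho> g)"
  shows "central_rep G Z p n s \<rho>"
proof (intro central_rep.intro central_rep_axioms.intro)
  interpret E: elementary_section G Z "{\<one>}" p by (rule E)
  show "\<rho> z = 1\<^sub>m n \<Longrightarrow> z = \<one>" if "z \<in> Z" for z
    using that general_linear_hom_one[OF \<rho>(1)] inj_onD[OF \<rho>(2), of z \<one>] by simp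
  show "mat_trace (\<rho> z) \<in> \<nat>" if "z \<in> Z" for z
    using that \<rho>(3) unfolding quasi_permutation_mat_def by simp
  show "\<rho> g \<in> carrier_mat n n" if "g \<in> carrier G" for g
    using general_linear_carrierD[OF hom_in_carrier[OF \<rho>(1) that]] by simp
  show "\<rho> (g \<otimes> h) = \<rho> g * \<rho> h" if "g \<in> carrier G" "h \<in> carrier G" for g h
    using hom_mult[OF \<rho>(1) that] by (simp add: general_linear_mult)
qed (use E fin central moves index general_linear_hom_one[OF \<rho>(1)] in auto)

text \<open>Permutation matrices are rational and rational matrices are complex, so the three
  degrees are ordered. An embedding of degree \<open>N\<close> bounds the largest from above and the
  complex lower bound the smallest from below.\<close>

lemma degrees_eqI:
  assumes N: "N > 0" and emb: "\<exists>\<phi>\<in>hom G (sym_group N). inj_on \<phi> (carrier G)"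
    and lower: "\<And>n \<rho>. \<rho> \<in> hom G (general_linear TYPE(complex) n) \<Longrightarrow> inj_on \<rho> (carrier G) \<Longrightarrow>
      \<forall>g\<in>carrier G. quasi_permutation_mat (\<rho> g) \<Longrightarrow> N \<le> n"
  shows "c_degree G = N" "q_degree G = N" "min_perm_degree G = N"
proof -
  obtain \<phi> where \<phi>: "\<phi> \<in> hom G (sym_group N)" "inj_on \<phi> (carrier G)" using emb by blast
  note repQ = perm_to_quasi_rep[OF \<phi>, where 'k = rat] and repC = perm_to_quasi_rep[OF \<phi>, where 'k = complex]
  have "c_degree G \<le> N" using repC quasi_perm_degree_le[OF N] by blast
  moreover have "N \<le> c_degree G" using quasi_perm_degree_attained[OF N repC] lower by blast
  ultimately show "c_degree G = N" by simp
  have "q_degree G \<le> N" using repQ quasi_perm_degree_le[OF N] by blast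
  moreover have "N \<le> q_degree G"
    using quasi_perm_degree_attained[OF N repQ] rational_to_complex_rep lower by blast
  ultimately show "q_degree G = N" by simp
  have "min_perm_degree G \<le> N" by (rule perm_degree_le[OF N emb])
  moreover have "N \<le> min_perm_degree G"
    using perm_degree_attained[OF N emb] perm_to_quasi_rep[where 'k = complex] lower by blast
  ultimately show "min_perm_degree G = N" by simp
qed

end

lemma (in elementary_section) dual_systemD:
  assumes "dual_system m e x" "i < m"
  shows "padd p G S (x i)" "e i \<in> S" "[x i (e i) = 1] (mod int p)"
proof -
  have "[x i (e i) = of_bool (i = i)] (mod int p)" using assms unfolding dual_system_def by blast
  then show "[x i (e i) = 1] (mod int p)" by simp
qed (use assms in \<open>auto simp: dual_system_def\<close>)

lemma (in elementary_section) card_coordinate_kernel: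
  assumes ds: "dual_system m e x" and i: "i < m"
  shows "subgroup {g \<in> S. [x i g = 0] (mod int p)} G" "card S = p * card {g \<in> S. [x i g = 0] (mod int p)}"
proof -
  let ?K = "{g \<in> S. [x i g = 0] (mod int p)}"
  note f = dual_systemD(1)[OF ds i] and e = dual_systemD(2,3)[OF ds i]
  have p1: "p > 1" by (rule prime_gt_1_nat[OF p])
  show K: "subgroup ?K G"
  proof (rule finite_subgroupI)
    show "?K \<noteq> {}" using padd_one[OF f S] subgroup.one_closed[OF S] by blast
    show "g \<otimes> h \<in> ?K" if "g \<in> ?K" "h \<in> ?K" for g h
    proof -
      have "[x i (g \<otimes> h) = x i g + x i h] (mod int p)" using f that unfolding padd_def by blast
      also have "[x i g + x i h = 0 + 0] (mod int p)" using that by (intro cong_add) auto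
      finally show ?thesis using that subgroup.m_closed[OF S] by simp
    qed
  qed (use finS SG in auto)
  have "card S = card ((\<lambda>g. x i g mod int p) ` S) * card ?K"
  proof (rule card_fibres[OF S finS K])
    show "x i g mod int p = x i h mod int p \<longleftrightarrow> inv g \<otimes> h \<in> ?K" if "g \<in> S" "h \<in> S" for g h
    proof -
      have "[x i (inv g \<otimes> h) = x i h - x i g] (mod int p)" by (rule padd_diff[OF f S that])
      then have "[x i (inv g \<otimes> h) = 0] (mod int p) \<longleftrightarrow> [x i h - x i g = 0] (mod int p)"
        by (simp add: cong_def)
      also have "\<dots> \<longleftrightarrow> [x i h = x i g] (mod int p)" by (simp only: cong_diff_iff_cong_0)
      finally show ?thesis using that subgroup.m_closed[OF S] subgroup.m_inv_closed[OF S] by (auto simp: cong_def)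
    qed
  qed blast
  also have "(\<lambda>g. x i g mod int p) ` S = {0..<int p}"
  proof (rule Set.equalityI)
    show "{0..<int p} \<subseteq> (\<lambda>g. x i g mod int p) ` S"
    proof
      fix k assume k: "k \<in> {0..<int p}"
      have "e i [^] j \<in> S" for j :: nat
        by (induction j) (use e(1) subgroup.one_closed[OF S] subgroup.m_closed[OF S] in auto)
      moreover have "[x i (e i [^] nat k) = int (nat k) * x i (e i)] (mod int p)" by (rule padd_pow[OF f S e(1)])
      then have "[x i (e i [^] nat k) = int (nat k) * 1] (mod int p)"
        using cong_mult[OF cong_refl e(2)] by (rule cong_trans)
      then have "x i (e i [^] nat k) mod int p = k" using k by (simp add: cong_def)
      ultimately show "k \<in> (\<lambda>g. x i g mod int p) ` S" by (metis image_eqI)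
    qed
  qed (use p1 in auto)
  finally show "card S = p * card ?K" by simp
qed

text \<open>The \<open>d\<close> coordinate kernels have index \<open>p\<close> and trivial
  intersection, which gives an embedding of degree \<open>d * p\<close>. The lower bound is the
  central one with \<open>Z\<close> the whole group and \<open>s = 1\<close>.\<close>

lemma (in group) elementary_abelian_c_degree:
  assumes E: "elementary_section G (carrier G) {\<one>} p" and nontrivial: "carrier G \<noteq> {\<one>}"
    and card: "card (carrier G) = p ^ d"
  shows "c_degree G = d * p"
proof -
  interpret E: elementary_section G "carrier G" "{\<one>}" p by (rule E)
  have p1: "p > 1" by (rule prime_gt_1_nat[OF E.p])
  obtain m e x where ds: "E.dual_system m e x" and ker: "\<And>g. g \<in> carrier G \<Longrightarrow> (\<And>i. i < m \<Longrightarrow> [x i g = 0] (mod int p)) \<Longrightarrow> g \<in> {\<one>}"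
    using E.exists_coordinates by blast
  have "p ^ d = p ^ m" using E.card_eq_coordinates[OF ds ker] card by simp
  then have md: "m = d" using p1 by simp
  have "d > 0"
  proof (rule ccontr)
    assume "\<not> d > 0"
    then have "card (carrier G) = 1" using card by simp
    then obtain a where "carrier G = {a}" by (auto simp: card_1_singleton_iff)
    then show False using nontrivial one_closed by auto
  qed
  let ?K = "\<lambda>i. {g \<in> carrier G. [x i g = 0] (mod int p)}"
  have emb: "\<exists>\<phi>\<in>hom G (sym_group (d * p)). inj_on \<phi> (carrier G)"
  proof (rule coset_embedding[where H = ?K])
    fix g assume g: "g \<in> carrier G" and h: "\<And>i x. i < d \<Longrightarrow> x \<in> carrier G \<Longrightarrow> inv x \<otimes> g \<otimes> x \<in> ?K i"
    have "[x i g = 0] (mod int p)" if "i < m" for i using h[of i \<one>] that md g by simp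
    then show "g = \<one>" using ker[OF g] by blast
  qed (use E.finS E.card_coordinate_kernel[OF ds] md in auto)
  show ?thesis
  proof (rule degrees_eqI(1)[OF _ emb])
    show "d * p > 0" using \<open>d > 0\<close> p1 by simp
    fix n and \<rho> :: "'a \<Rightarrow> complex mat"
    assume \<rho>: "\<rho> \<in> hom G (general_linear TYPE(complex) n)" "inj_on \<rho> (carrier G)" "\<forall>g\<in>carrier G. quasi_permutation_mat (\<rho> g)"
    have "central_rep G (carrier G) p n 1 \<rho>"
      by (rule central_repI[OF E E.finS _ _ _ \<rho>]) (use E.comm_N comm_one_iff in auto)
    from central_rep.degree_bound[OF this card] show "d * p \<le> n" by simp
  qed
qed

section \<open>The centre and the degrees of a Camina group of class three\<close>

context camina3
begin

lemma root_character:
  assumes f: "padd p G U f" and nt: "\<exists>u\<in>U. \<not> int p dvd f u"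
  shows "camina3_char G p D U (\<lambda>u. root_char p (f u))"
proof (intro camina3_char.intro camina3_char_axioms.intro)
  have p0: "p > 0" by (rule prime_gt_0_nat[OF p])
  show "root_char p (f (u \<otimes> v)) = root_char p (f u) * root_char p (f v)" if "u \<in> U" "v \<in> U" for u v
  proof -
    have "[f (u \<otimes> v) = f u + f v] (mod int p)" using f that unfolding padd_def by blast
    then show ?thesis using root_char_cong[OF p0] root_char_add by metis
  qed
  show "\<exists>u\<in>U. root_char p (f u) \<noteq> 1" using nt root_char_eq_1_iff[OF p0] by blast
qed (use camina3_axioms in auto)

lemma exists_nontrivial_functional: "\<exists>f. padd p G U f \<and> (\<exists>u\<in>U. \<not> int p dvd f u)"
proof -
  obtain u where u: "u \<in> U" "u \<notin> {\<one>}" using U_nontrivial U_closed by blast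
  obtain f where "padd p G U f" "f u = 1" using U1.exists_functional[OF u] by blast
  moreover have "\<not> int p dvd 1" using prime_gt_1_nat[OF p] by simp
  ultimately show ?thesis using u(1) by metis
qed

lemma functional_moves:
  assumes f: "padd p G U f" and nt: "\<exists>u\<in>U. \<not> int p dvd f u" and g: "g \<in> carrier G" "g \<notin> U"
  shows "\<exists>x\<in>carrier G. comm g x \<in> U \<and> \<not> int p dvd f (comm g x)"
  using camina3_char.not_U_moves[OF root_character[OF f nt] g] root_char_eq_1_iff[OF prime_gt_0_nat[OF p]] by blast

text \<open>Any element outside \<open>U\<close> has a commutator on which a fixed nontrivial
  functional of \<open>U\<close> does not vanish, so it cannot be central.\<close>

lemma group_center_eq: "group_center G = U"
proof (rule Set.equalityI)
  show "U \<subseteq> group_center G" using U_central unfolding group_center_def by auto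
  obtain f where f: "padd p G U f" "\<exists>u\<in>U. \<not> int p dvd f u" using exists_nontrivial_functional by blast
  show "group_center G \<subseteq> U"
  proof
    fix g assume "g \<in> group_center G"
    then have g: "g \<in> carrier G" "\<And>x. x \<in> carrier G \<Longrightarrow> g \<otimes> x = x \<otimes> g" unfolding group_center_def by auto
    have dvd: "int p dvd f \<one>" using padd_one[OF f(1) U] by (simp add: cong_0_iff)
    show "g \<in> U"
    proof (rule ccontr)
      assume "g \<notin> U"
      then obtain x where x: "x \<in> carrier G" "\<not> int p dvd f (comm g x)"
        using functional_moves[OF f g(1)] by blast
      have "comm g x = \<one>" using comm_one_iff[OF g(1) x(1)] g(2)[OF x(1)] by simp
      then show False using x(2) dvd by simp
    qed
  qed
qed

text \<open>Each of the \<open>d\<close> coordinates of \<open>U\<close> is a character to which the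
  isotropic construction applies. The indices \<open>t i\<close> from different characters agree,
  since their squares are all the index of \<open>U\<close> in \<open>G\<close>.\<close>

lemma center_rank:
  obtains d s where "d > 0" "card U = p ^ d" "card (carrier G) = s * s * card U" "s > 0"
    "\<exists>\<phi>\<in>hom G (sym_group (s * d * p)). inj_on \<phi> (carrier G)"
proof -
  have p0: "p > 0" and p1: "p > 1" using prime_gt_0_nat[OF p] prime_gt_1_nat[OF p] .
  obtain d e x where ds: "U1.dual_system d e x" and ker: "\<And>g. g \<in> U \<Longrightarrow> (\<And>i. i < d \<Longrightarrow> [x i g = 0] (mod int p)) \<Longrightarrow> g \<in> {\<one>}"
    using U1.exists_coordinates by blast
  have cU: "card U = p ^ d" using U1.card_eq_coordinates[OF ds ker] by simp
  have d0: "d > 0"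
  proof (rule ccontr)
    assume "\<not> d > 0"
    then have "U \<subseteq> {\<one>}" using ker by blast
    then show False using U_nontrivial U_closed by blast
  qed
  have x: "padd p G U (x i)" "\<exists>u\<in>U. \<not> int p dvd x i u" if i: "i < d" for i
  proof -
    show "padd p G U (x i)" by (rule U1.dual_systemD(1)[OF ds i])
    have "\<not> int p dvd x i (e i)"
      using U1.dual_systemD(3)[OF ds i] p1 by (simp add: cong_dvd_iff)
    then show "\<exists>u\<in>U. \<not> int p dvd x i u" using U1.dual_systemD(2)[OF ds i] by blast
  qed
  have cpos: "card U > 0" using cU p0 by simp
  have "\<exists>H s. subgroup H G \<and> (\<forall>u\<in>H \<inter> U. root_char p (x i u) = 1) \<and> card (carrier G) = s * s * card U \<and> card (carrier G) = p * s * card H"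
    if "i < d" for i
    by (rule camina3_char.complement_subgroup[OF root_character[OF x[OF that]]])
  then obtain H t where H: "\<And>i. i < d \<Longrightarrow> subgroup (H i) G" "\<And>i u. i < d \<Longrightarrow> u \<in> H i \<inter> U \<Longrightarrow> root_char p (x i u) = 1"
    "\<And>i. i < d \<Longrightarrow> card (carrier G) = t i * t i * card U" "\<And>i. i < d \<Longrightarrow> card (carrier G) = p * t i * card (H i)"
    by metis
  define s where "s = t 0"
  have ts: "t i = s" if "i < d" for i
  proof -
    have "t i * t i = s * s" using H(3)[OF that] H(3)[OF d0] cpos unfolding s_def by (metis mult_cancel2 less_irrefl)
    then have "t i ^ 2 = s ^ 2" by (simp only: power2_eq_square)
    then show ?thesis by (simp add: power2_eq_iff_nonneg)
  qed
  have "card (carrier G) > 0" using fin one_closed card_gt_0_iff by blast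
  then have s0: "s > 0" using H(3)[OF d0] unfolding s_def by (cases "t 0") auto
  have "\<exists>\<phi>\<in>hom G (sym_group (d * (p * s))). inj_on \<phi> (carrier G)"
  proof (rule coset_embedding[where H = H])
    fix g assume g: "g \<in> carrier G" and conj: "\<And>i x. i < d \<Longrightarrow> x \<in> carrier G \<Longrightarrow> inv x \<otimes> g \<otimes> x \<in> H i"
    have gH: "g \<in> H i" if "i < d" for i using conj[OF that one_closed] g by simp
    \<comment> \<open>The commutator of \<open>g\<close> with \<open>y\<close> is \<open>g\<close>
      times the inverse of a conjugate of \<open>g\<close>, both in \<open>H 0\<close>. It lies in
      \<open>U\<close> as well, where elements of \<open>H 0\<close> are killed by the first
      coordinate.\<close>
    have "g \<in> U"
    proof (rule ccontr)
      assume "g \<notin> U"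
      then obtain y where y: "y \<in> carrier G" "comm g y \<in> U" "\<not> int p dvd x 0 (comm g y)"
        using functional_moves[OF x[OF d0] g] by blast
      have "inv (inv y) \<otimes> g \<otimes> inv y \<in> H 0" by (rule conj[OF d0]) (use y in simp)
      then have "inv (y \<otimes> g \<otimes> inv y) \<in> H 0" using y subgroup.m_inv_closed[OF H(1)[OF d0]] by simp
      then have "g \<otimes> inv (y \<otimes> g \<otimes> inv y) \<in> H 0" by (rule subgroup.m_closed[OF H(1)[OF d0] gH[OF d0]])
      moreover have "g \<otimes> inv (y \<otimes> g \<otimes> inv y) = comm g y" using g y by (simp add: comm_def inv_mult_group m_assoc)
      ultimately have "root_char p (x 0 (comm g y)) = 1" using H(2)[OF d0] y(2) by simp
      then show False using y(3) root_char_eq_1_iff[OF p0] by blast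
    qed
    then have "[x i g = 0] (mod int p)" if "i < d" for i
      using H(2)[OF that, of g] gH[OF that] root_char_eq_1_iff[OF p0] by (simp add: cong_0_iff)
    then show "g = \<one>" using ker[OF \<open>g \<in> U\<close>] by blast
  qed (use fin H(1,4) ts in auto)
  moreover have "d * (p * s) = s * d * p" by simp
  ultimately have emb: "\<exists>\<phi>\<in>hom G (sym_group (s * d * p)). inj_on \<phi> (carrier G)" by (simp only:)
  show thesis by (rule that[OF d0 cU H(3)[OF d0, folded s_def] s0 emb])
qed

lemma center_c_degree:
  assumes "card U = p ^ d"
  shows "c_degree (G\<lparr>carrier := U\<rparr>) = d * p"
proof -
  let ?E = "G\<lparr>carrier := U\<rparr>"
  interpret E: group ?E by (rule subgroup_imp_group[OF U])
  have pow: "x [^]\<^bsub>?E\<^esub> (n::nat) = x [^] n" for x n by (simp add: nat_pow_def)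
  have "elementary_section ?E (carrier ?E) {\<one>\<^bsub>?E\<^esub>} p"
  proof (intro elementary_section.intro elementary_section_axioms.intro)
    show "E.comm x y \<in> {\<one>\<^bsub>?E\<^esub>}" if "x \<in> carrier ?E" "y \<in> carrier ?E" for x y
    proof -
      have "x \<otimes>\<^bsub>?E\<^esub> y = y \<otimes>\<^bsub>?E\<^esub> x" using that U_central by simp
      then show ?thesis using E.comm_one_iff[OF that] by blast
    qed
    show "x [^]\<^bsub>?E\<^esub> p \<in> {\<one>\<^bsub>?E\<^esub>}" if "x \<in> carrier ?E" for x
      using that U1.pow_N by (simp add: pow)
  qed (use p E.subgroup_self E.triv_subgroup E.one_closed E.group_axioms finU in auto)
  then show ?thesis
    by (rule E.elementary_abelian_c_degree) (use assms U_nontrivial in auto)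
qed

text \<open>The number of cosets of \<open>U\<close> is \<open>s * s\<close>, so its square root is
  the factor between \<open>s * d * p\<close> and the degree \<open>d * p\<close> of the
  centre.\<close>

lemma degrees:
  "real (c_degree G) = sqrt (real (card (rcosets U))) * real (c_degree (G\<lparr>carrier := U\<rparr>))"
  "c_degree G = min_perm_degree G" "min_perm_degree G = q_degree G"
proof -
  obtain d s where d: "d > 0" "card U = p ^ d" "card (carrier G) = s * s * card U" "s > 0"
    "\<exists>\<phi>\<in>hom G (sym_group (s * d * p)). inj_on \<phi> (carrier G)" using center_rank .
  have p0: "p > 0" by (rule prime_gt_0_nat[OF p])
  have lower: "s * d * p \<le> n" if \<rho>: "\<rho> \<in> hom G (general_linear TYPE(complex) n)" "inj_on \<rho> (carrier G)" "\<forall>g\<in>carrier G. quasi_permutation_mat (\<rho> g)"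
    for n and \<rho> :: "'a \<Rightarrow> complex mat"
  proof -
    have "central_rep G U p n s \<rho>"
      by (rule central_repI[OF U1.elementary_section_axioms fin U_central functional_moves d(3) \<rho>])
    then show ?thesis by (rule central_rep.degree_bound[OF _ d(2)])
  qed
  have "s * d * p > 0" using d p0 by simp
  note eq = degrees_eqI[OF this d(5) lower]
  show "c_degree G = min_perm_degree G" "min_perm_degree G = q_degree G" by (simp_all only: eq)
  have "card (rcosets U) * card U = s * s * card U" using lagrange[OF U] d(3) by (simp add: Coset.order_def)
  moreover have "card U > 0" using d(2) p0 by simp
  ultimately have "card (rcosets U) = s * s" by (metis mult_cancel2 less_irrefl)
  then have "sqrt (real (card (rcosets U))) = real s" by simp
  then show "real (c_degree G) = sqrt (real (card (rcosets U))) * real (c_degree (G\<lparr>carrier := U\<rparr>))"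
    using eq(1) center_c_degree[OF d(2)] by simp
qed

end

hide_const (open) Polynomial.order

theorem theorem6:
  fixes p :: nat and G :: "('a, 'b) monoid_scheme"
  assumes "prime p"
    and "camina_p_group p G"
    and "has_nilpotency_class G 3"
  shows "real (c_degree G) =
           sqrt (real (order (G Mod group_center G)))
             * real (c_degree (G\<lparr>carrier := group_center G\<rparr>)) \<and>
         (odd p \<longrightarrow>
            c_degree G = min_perm_degree G \<and>
            min_perm_degree G = q_degree G \<and>
            real (q_degree G) =
              sqrt (real (order (G Mod group_center G)))
                * real (c_degree (G\<lparr>carrier := group_center G\<rparr>)))"
proof -
  interpret group G using assms(2) unfolding camina_p_group_def finite_p_group_def by simp
  interpret camina3 G p "lower_central G 1" "lower_central G 2"
    by (rule camina3_of_class_3[OF assms])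
  have "Coset.order (G Mod group_center G) = card (rcosets\<^bsub>G\<^esub> (lower_central G 2))"
    by (simp add: group_center_eq Coset.order_def FactGroup_def)
  then show ?thesis using degrees by (simp add: group_center_eq)
qed

end
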